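(* For any partition $\lambda = (\lambda_1, \lambda_2, \ldots, \lambda_\ell)$ of a positive integer $d$, \[ \mathrm{Map}^{\mathrm{st}}(\lambda) = z(\lambda) \sum_{\mu \vdash d} H^<(\lambda; \mu) \, \mathrm{FSMap}^{\mathrm{st}}(\mu), \] where $\mathrm{Map}^{\mathrm{st}}$ and $\mathrm{FSMap}^{\mathrm{st}}$ are the weighted enumerations of (possibly disconnected) stuffed maps and of fully simple stuffed maps, and $H^<(\lambda;\mu)$ is the generating series of strictly monotone Hurwitz numbers.
   Context: **Stuffed maps.** A stuffed map is a finite graph (loops and multiple edges allowed) without isolated vertices, embedded into an oriented compact surface (possibly disconnected); the connected components of the complement are called faces. An oriented edge is an edge with a choice of one of its two orientations; it is adjacent to the face on its left and incident to the vertex it points to. A stuffed map carries an ordered tuple $R=(r_1,\dots,r_n)$ of distinct oriented edges (roots), no two adjacent to the same face. Faces adjacent to roots are boundary faces (boundary face $i$ is adjacent to $r_i$) and are required to be homeomorphic to disks. The remaining faces are internal faces; an internal face may have any genus $g\ge0$ and any positive number of boundary components, each boundary component having a degree (the number of oriented edges along it with the face on their left). Equivalence is by orientation-preserving homeomorphisms carrying vertices, oriented edges and faces to vertices, oriented edges and faces, preserving adjacencies and the tuple of roots. Stuffed maps are counted up to equivalence. **Permutation model.** Equivalently, a stuffed map is encoded by data $(\sigma_0,\sigma_1,\sigma_2;R;\mathcal P,h)$, where $\sigma_0,\sigma_1,\sigma_2$ are permutations of a finite set $\mathbb{E}$ (the oriented edges), $\sigma_1$ is a fixed point free involution, $\sigma_0\sigma_1\sigma_2=\mathrm{id}$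 (permutations multiplied right to left), $R\in\mathbb{E}^n$ is a tuple no two entries of which lie in the same cycle of $\sigma_2$, $\mathcal P$ is an unordered partition of the set of unrooted cycles of $\sigma_2$ (those containing no entry of $R$), and $h:\mathcal P\to\{0,1,2,\dots\}$. Cycles of $\sigma_0$ are vertices, cycles of $\sigma_1$ are edges, rooted cycles of $\sigma_2$ are boundary faces (length = degree), and each part $p\in\mathcal P$ is an internal face of genus $h(p)$ whose boundary components are the cycles in $p$, with degrees their lengths. Two such data are equivalent if there is a bijection $\phi:\mathbb{E}\to\widetilde{\mathbb{E}}$ sending $R$ to $\widetilde R$ (entry by entry), with $\widetilde\sigma_i=\phi\sigma_i\phi^{-1}$ for $i\in\{0,1,2\}$, carrying $\mathcal P$ to $\widetilde{\mathcal P}$, and with $h=\widetilde h\circ\phi$. **Fully simple.** A boundary edge is an oriented edge adjacent to a boundary face. A stuffed map is fully simple if each vertex is incident to at most one boundary edge. **Enumerations.** For positive integers $\mu_1,\dots,\mu_n$, $\mathrm{Map}^{\mathrm{st}}(\mu_1,\dots,\mu_n)$ is the sum, over equivalence classes of stuffed maps $M$ with $n$ boundary faces such that boundary face $i$ has degree $\mu_i$ for $i=1,\dots,n$, of the weight \[ \frac{\hbar^{-\chi(M)}}{|\mathrm{Aut}\,M|}\,\prod_{g\ge0}\prod_{\lambda}t_{g,\lambda}^{f_{g,\lambda}(M)}, \] where the product is over non-empty partitions $\lambda$ and the $t_{g,\lambda}$ are formal variables. Here $\chi(M)$ is the Euler characteristic of the underlying surface with the interiors of the boundary faces removed (number of vertices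 minus number of edges plus the sum over internal faces of $2-2g-b$, for a face of genus $g$ with $b$ boundary components), $f_{g,\lambda}(M)$ is the number of internal faces of genus $g$ with $\ell(\lambda)$ boundary components whose degrees are given by $\lambda$, and $|\mathrm{Aut}\,M|$ is the number of automorphisms, i.e. permutations of the oriented edges arising from an orientation-preserving self-homeomorphism preserving the stuffed map and its tuple of roots (equivalently, self-equivalences of the encoding data). $\mathrm{FSMap}^{\mathrm{st}}(\mu_1,\dots,\mu_n)$ is the same sum restricted to fully simple stuffed maps. Each monomial in the $t_{g,\lambda}$ receives contributions from finitely many stuffed maps, so both are formal power series in the $t_{g,\lambda}$ with coefficients in $\mathbb{Q}[\hbar,\hbar^{-1}]$. **Strictly monotone Hurwitz numbers.** A sequence $\tau_1,\dots,\tau_k$ of transpositions in $\mathfrak{S}_d$ is strictly monotone if $\tau_i=(a_i\ b_i)$ with $a_i<b_i$ and $b_1<b_2<\dots<b_k$. For partitions $\lambda,\mu$ of $d$ and $k\ge 0$, $H^<_k(\lambda;\mu)$ is $\frac1{d!}$ times the number of tuples $(\rho_\lambda,\tau_1,\dots,\tau_k,\rho_\mu)$ of permutations in $\mathfrak{S}_d$ such that $\rho_\lambda$ has cycle type $\lambda$, $\rho_\mu$ has cycle type $\mu$, $\tau_1,\dots,\tau_k$ is a strictly monotone sequence of transpositions, and $\rho_\lambda\tau_1\cdots\tau_k\rho_\mu=\mathrm{id}$. Set $H^<(\lambda;\mu)=\sum_{k\ge0}H^<_k(\lambda;\mu)\,\hbar^k$ (a polynomial in $\hbar$). **Notation.**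 $\mu\vdash d$ means $\mu$ is a partition of $d$; $z(\lambda)=\prod_{i=1}^{\ell(\lambda)}\lambda_i\cdot\prod_{j\ge1}m_j(\lambda)!$, where $\ell(\lambda)$ is the number of parts and $m_j(\lambda)$ is the number of parts equal to $j$. *)

theory Defs
  imports
    Complex_Main
    "HOL-Combinatorics.Permutations"
    "HOL-Combinatorics.Orbits"
    "HOL-Library.Disjoint_Sets"
    "HOL-Library.Multiset"
    "HOL-Library.Poly_Mapping"
begin

section \<open>Coefficients and formal power series\<close>

text \<open>
  Under the convolution product of \<^theory>\<open>HOL-Library.Poly_Mapping\<close>, the finitely supported functions
  from the integers to the rationals form the ring $\mathbb{Q}[\hbar,\hbar^{-1}]$, and
  \<open>Poly_Mapping.single k c\<close> is the Laurent monomial $c\,\hbar^k$.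
\<close>

type_synonym laurent = "int \<Rightarrow>\<^sub>0 rat"

text \<open>
  The variable $t_{g,\lambda}$ is the pair of \<open>g\<close> and the multiset of parts of $\lambda$. A monomial is
  a finite multiset of variables (the multiplicity of a variable is its exponent), and a power series
  is the function taking each monomial to its coefficient.
\<close>

type_synonym tvar = "nat \<times> nat multiset"
type_synonym tmonomial = "tvar multiset"
type_synonym tseries = "tmonomial \<Rightarrow> laurent"


section \<open>Partitions\<close>

definition is_partition :: "nat list \<Rightarrow> nat \<Rightarrow> bool" (infix \<open>\<turnstile>\<close> 50) where
  "mu \<turnstile> d \<longleftrightarrow> sorted_wrt (\<ge>) mu \<and> (\<forall>i\<in>set mu. 0 < i) \<and> sum_list mu = d"

text \<open>Indices \<open>j\<close> that are not parts contribute the factor $0! = 1$ and are left out.\<close>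

definition zfactor :: "nat list \<Rightarrow> nat" where
  "zfactor mu = prod_list mu * (\<Prod>j\<in>set mu. fact (count_list mu j))"


section \<open>Cycles of permutations\<close>

text \<open>
  Fixed points count as cycles of length one. A cycle is represented by its set of elements.
\<close>

definition cycles :: "'a set \<Rightarrow> ('a \<Rightarrow> 'a) \<Rightarrow> 'a set set" where
  "cycles A f = orbit f ` A"

definition cycle_type :: "'a set \<Rightarrow> ('a \<Rightarrow> 'a) \<Rightarrow> nat multiset" where
  "cycle_type A f = image_mset card (mset_set (cycles A f))"


section \<open>Stuffed maps\<close>

text \<open>
  \<open>oedges\<close> is the set of oriented edges. Only the values of \<open>genus\<close> on \<open>parts\<close> are meaningful;
  the equivalence relation below ignores the others.
\<close>

record 'a smap =
  oedges :: "'a set"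
  sigma0 :: "'a \<Rightarrow> 'a"
  sigma1 :: "'a \<Rightarrow> 'a"
  sigma2 :: "'a \<Rightarrow> 'a"
  roots  :: "'a list"
  parts  :: "'a set set set"
  genus  :: "'a set set \<Rightarrow> nat"

definition vertices :: "'a smap \<Rightarrow> 'a set set" where
  "vertices M = cycles (oedges M) (sigma0 M)"

definition edges :: "'a smap \<Rightarrow> 'a set set" where
  "edges M = cycles (oedges M) (sigma1 M)"

definition rooted_cycles :: "'a smap \<Rightarrow> 'a set set" where
  "rooted_cycles M = {c \<in> cycles (oedges M) (sigma2 M). c \<inter> set (roots M) \<noteq> {}}"

definition unrooted_cycles :: "'a smap \<Rightarrow> 'a set set" where
  "unrooted_cycles M = {c \<in> cycles (oedges M) (sigma2 M). c \<inter> set (roots M) = {}}"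

definition stuffed_map :: "'a smap \<Rightarrow> bool" where
  "stuffed_map M \<longleftrightarrow>
     finite (oedges M) \<and>
     sigma0 M permutes oedges M \<and>
     sigma1 M permutes oedges M \<and>
     sigma2 M permutes oedges M \<and>
     (\<forall>e\<in>oedges M. sigma1 M e \<noteq> e \<and> sigma1 M (sigma1 M e) = e) \<and>
     sigma0 M \<circ> sigma1 M \<circ> sigma2 M = id \<and>
     set (roots M) \<subseteq> oedges M \<and>
     (\<forall>i<length (roots M). \<forall>j<length (roots M). i \<noteq> j \<longrightarrow>
        orbit (sigma2 M) (roots M ! i) \<noteq> orbit (sigma2 M) (roots M ! j)) \<and>
     partition_on (unrooted_cycles M) (parts M)"

definition boundary_degrees :: "'a smap \<Rightarrow> nat list" where
  "boundary_degrees M = map (\<lambda>r. card (orbit (sigma2 M) r)) (roots M)"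

definition boundary_edges :: "'a smap \<Rightarrow> 'a set" where
  "boundary_edges M = \<Union> (rooted_cycles M)"

text \<open>The cycle of \<open>sigma0\<close> through an oriented edge is the vertex to which that edge points.\<close>

definition fully_simple :: "'a smap \<Rightarrow> bool" where
  "fully_simple M \<longleftrightarrow> (\<forall>v\<in>vertices M. card {e \<in> v. e \<in> boundary_edges M} \<le> 1)"

definition smap_iso :: "('a \<Rightarrow> 'b) \<Rightarrow> 'a smap \<Rightarrow> 'b smap \<Rightarrow> bool" where
  "smap_iso \<phi> M M' \<longleftrightarrow>
     bij_betw \<phi> (oedges M) (oedges M') \<and>
     (\<forall>e\<in>oedges M. sigma0 M' (\<phi> e) = \<phi> (sigma0 M e)) \<and>
     (\<forall>e\<in>oedges M. sigma1 M' (\<phi> e) = \<phi> (sigma1 M e)) \<and>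
     (\<forall>e\<in>oedges M. sigma2 M' (\<phi> e) = \<phi> (sigma2 M e)) \<and>
     roots M' = map \<phi> (roots M) \<and>
     parts M' = (\<lambda>p. (`) \<phi> ` p) ` parts M \<and>
     (\<forall>p\<in>parts M. genus M p = genus M' ((`) \<phi> ` p))"

text \<open>
  Every finite set is in bijection with a set of natural numbers, so all equivalence classes have
  representatives whose oriented edges are natural numbers.
\<close>

definition smap_equiv :: "(nat smap \<times> nat smap) set" where
  "smap_equiv = {(M, M'). stuffed_map M \<and> stuffed_map M' \<and> (\<exists>\<phi>. smap_iso \<phi> M M')}"

text \<open>
  Automorphisms are permutations of the set of oriented edges; \<open>permutes\<close> makes them the identity
  outside that set, so each one is counted once.
\<close>

definition smap_aut :: "'a smap \<Rightarrow> ('a \<Rightarrow> 'a) set" where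
  "smap_aut M = {\<phi>. \<phi> permutes oedges M \<and> smap_iso \<phi> M M}"

definition euler_char :: "'a smap \<Rightarrow> int" where
  "euler_char M = int (card (vertices M)) - int (card (edges M))
     + (\<Sum>p\<in>parts M. 2 - 2 * int (genus M p) - int (card p))"

text \<open>
  The monomial $\prod_{g,\lambda} t_{g,\lambda}^{f_{g,\lambda}(M)}$: one factor for each internal face.
\<close>

definition face_monomial :: "'a smap \<Rightarrow> tmonomial" where
  "face_monomial M = image_mset (\<lambda>p. (genus M p, image_mset card (mset_set p))) (mset_set (parts M))"

definition smap_weight :: "'a smap \<Rightarrow> laurent" where
  "smap_weight M = Poly_Mapping.single (- euler_char M) (1 / of_nat (card (smap_aut M)))"

text \<open>
  The weighted enumeration of a set of stuffed maps closed under equivalence. The coefficient of \<open>m\<close>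
  sums over the equivalence classes of maps with face monomial \<open>m\<close>. For prescribed boundary degrees
  there are finitely many of these, as the degrees of all faces determine the number of oriented edges.
\<close>

definition smap_enum :: "nat smap set \<Rightarrow> tseries" where
  "smap_enum S m = (\<Sum>C\<in>{M \<in> S. face_monomial M = m} // smap_equiv. smap_weight (SOME M. M \<in> C))"

definition Map_st :: "nat list \<Rightarrow> tseries" where
  "Map_st mu = smap_enum {M. stuffed_map M \<and> boundary_degrees M = mu}"

definition FSMap_st :: "nat list \<Rightarrow> tseries" where
  "FSMap_st mu = smap_enum {M. stuffed_map M \<and> fully_simple M \<and> boundary_degrees M = mu}"


section \<open>Strictly monotone Hurwitz numbers\<close>

definition strictly_monotone :: "nat \<Rightarrow> (nat \<Rightarrow> nat) list \<Rightarrow> bool" where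
  "strictly_monotone d \<tau>s \<longleftrightarrow>
     (\<exists>ps :: (nat \<times> nat) list.
        \<tau>s = map (\<lambda>(a, b). transpose a b) ps \<and>
        (\<forall>(a, b)\<in>set ps. 1 \<le> a \<and> a < b \<and> b \<le> d) \<and>
        sorted_wrt (<) (map snd ps))"

definition hurwitz_tuples ::
  "nat \<Rightarrow> nat \<Rightarrow> nat list \<Rightarrow> nat list \<Rightarrow> ((nat \<Rightarrow> nat) \<times> (nat \<Rightarrow> nat) list \<times> (nat \<Rightarrow> nat)) set"
where
  "hurwitz_tuples d k lam mu =
     {(\<rho>, \<tau>s, \<rho>').
        \<rho> permutes {1..d} \<and> cycle_type {1..d} \<rho> = mset lam \<and>
        length \<tau>s = k \<and> strictly_monotone d \<tau>s \<and>
        \<rho>' permutes {1..d} \<and> cycle_type {1..d} \<rho>' = mset mu \<and>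
        \<rho> \<circ> foldr (\<circ>) \<tau>s id \<circ> \<rho>' = id}"

definition hurwitz_number :: "nat \<Rightarrow> nat \<Rightarrow> nat list \<Rightarrow> nat list \<Rightarrow> rat" where
  "hurwitz_number d k lam mu = of_nat (card (hurwitz_tuples d k lam mu)) / fact d"

text \<open>
  \<^const>\<open>Sum_any\<close> sums over the indices with non-zero summand. There are finitely many, as a strictly
  monotone sequence in the symmetric group of degree \<open>d > 0\<close> has at most \<open>d - 1\<close> terms.
\<close>

definition hurwitz_series :: "nat \<Rightarrow> nat list \<Rightarrow> nat list \<Rightarrow> laurent" where
  "hurwitz_series d lam mu =
     Sum_any (\<lambda>k. Poly_Mapping.single (int k) (hurwitz_number d k lam mu))"

end

theory Submission
  imports Defs
begin

text \<open>
  Number the boundary edges of a map by $1,\dots,d$. The restriction of $\sigma_2$ to them becomes a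
  permutation $\rho$ of $\{1,\dots,d\}$, whose cycles are the boundary faces. Everything rests on the
  following factorization. Let $B$ be the set of boundary edges. Then $\sigma_0 = \pi f$ for exactly
  one pair of permutations such that $\pi$ fixes everything outside $B$ and no cycle of $f$ contains
  two elements of $B$: the permutation $\pi$ is the first return map of $\sigma_0$ to $B$
  (\<open>simple_factor_exists\<close>, \<open>simple_on_unique\<close>). Replacing $\sigma_0$ by $f$ and $\sigma_2$ by
  $\sigma_2\pi$ keeps $\sigma_0\sigma_1\sigma_2 = 1$. Geometrically, it splits every vertex that is
  incident to several boundary edges into one vertex for each of them. The internal faces are not
  changed, the map becomes fully simple, and its boundary permutation becomes $\rho\pi$. Conversely,
  any permutation of the boundary edges of a fully simple map can be used to glue its vertices, so

  \<^item> maps with boundary permutation $\rho$ correspond to pairs of a permutation $\pi$ of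
    $\{1,\dots,d\}$ and a fully simple map with boundary permutation $\rho\pi$ (\<open>glue_bij\<close>), and
  \<^item> splitting increases the number of vertices, and thus the Euler characteristic, by
    $d - c(\pi)$, where $c$ is the number of cycles (\<open>card_cycles_comp_simple\<close>).

  Three facts turn this into the theorem.

  \<^item> Weighting equivalence classes by inverse numbers of automorphisms amounts to counting maps on
    the fixed set of oriented edges $\{0,\dots,N-1\}$ and dividing by $N!$
    (\<open>smap_enum_labelled\<close>). The number $N$ is determined by $d$ and the monomial.
  \<^item> A map that commutes with two permutations is determined by its values at one point of each
    cycle. Hence, if $\rho$ has cycle type $\lambda$, numbering the boundary edges compatibly with
    $\rho$ is the same as choosing roots of degrees $\lambda_1,\dots,\lambda_\ell$
    (\<open>choose_roots\<close>). Every such $\rho$ therefore yields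
    $\mathrm{Map}(\lambda) = \sum_\pi \hbar^{d-c(\pi)}\,\mathrm{FSMap}(\mbox{type of }\rho\pi)$. The
    same principle shows that $d!/z(\lambda)$ permutations have cycle type $\lambda$
    (\<open>card_permutations_of_type\<close>).
  \<^item> Each permutation $\pi$ of $\{1,\dots,d\}$ is the product of exactly one strictly monotone
    sequence of transpositions, and this sequence has length $d - c(\pi)$
    (\<open>strictly_monotone_exists\<close>, \<open>strictly_monotone_unique\<close>, \<open>strictly_monotone_permutes\<close>).
    So the sum of $\hbar^{d-c(\pi)}$ over the pairs $(\rho,\pi)$ for which $\rho$ has type $\lambda$
    and $\rho\pi$ has type $\mu$ is $d!\,H^<(\lambda;\mu)$.

  Summing the formula for $\mathrm{Map}(\lambda)$ over all $\rho$ of cycle type $\lambda$ gives the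
  theorem.
\<close>

section \<open>Permutations whose cycles meet a set at most once\<close>

definition simple_on :: "('a \<Rightarrow> 'a) \<Rightarrow> 'a set \<Rightarrow> bool" where
  "simple_on f B \<longleftrightarrow> (\<forall>b\<in>B. orbit f b \<inter> B \<subseteq> {b})"

lemma self_in_orbit:
  assumes "finite A" "f permutes A" shows "x \<in> orbit f x"
  by (rule permutation_self_in_orbit) (use assms in \<open>auto simp: permutation_permutes\<close>)

lemma orbit_eq:
  assumes "finite A" "f permutes A" "y \<in> orbit f x" shows "orbit f y = orbit f x"
  using cyclic_on_orbit[OF assms(2,1)] assms(3) by (rule orbit_cyclic_eq3)

lemma cycles_disjoint:
  assumes "finite A" "f permutes A" "c \<in> cycles A f" "c' \<in> cycles A f" "x \<in> c" "x \<in> c'"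
  shows "c = c'"
proof -
  from assms(3,4) obtain a b where "c = orbit f a" "c' = orbit f b" unfolding cycles_def by blast
  then show ?thesis
    using orbit_eq[OF assms(1,2), of x a] orbit_eq[OF assms(1,2), of x b] assms(5,6) by simp
qed

lemma Union_cycles:
  assumes "finite A" "f permutes A" shows "\<Union>(cycles A f) = A"
  unfolding cycles_def using permutes_orbit_subset[OF assms(2)] self_in_orbit[OF assms] by blast

lemma finite_cycles: "finite A \<Longrightarrow> finite (cycles A f)"
  by (simp add: cycles_def)

text \<open>
  Following \<open>p \<circ> f\<close>, one runs through the cycle of \<open>f\<close> until it returns to its only point
  \<open>c\<close> in \<open>B\<close>; at this moment \<open>p\<close> switches to the cycle of \<open>f\<close> through \<open>p c\<close>. So \<open>p\<close> strings the
  cycles of \<open>f\<close> together, in the order in which it permutes their points in \<open>B\<close>.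
\<close>

lemma orbit_comp_simple:
  assumes A: "finite A" "f permutes A" and B: "p permutes B" "B \<subseteq> A"
    and s: "simple_on f B" and b: "b \<in> B"
  shows "orbit (p \<circ> f) b = \<Union>(orbit f ` orbit p b)"
proof
  have finB: "finite B" using A B finite_subset by blast
  note selff = self_in_orbit[OF A] and selfp = self_in_orbit[OF finB B(1)]
  have pB: "c \<in> B" if "c \<in> orbit p b" for c
    using permutes_orbit_subset[OF B(1) b] that by blast
  have closed: "p (f x) \<in> \<Union>(orbit f ` orbit p b)" if x: "x \<in> \<Union>(orbit f ` orbit p b)" for x
  proof -
    from x obtain c where c: "c \<in> orbit p b" "x \<in> orbit f c" by blast
    have fx: "f x \<in> orbit f c" using c(2) by (rule orbit.step)
    show ?thesis
    proof (cases "f x \<in> B")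
      case True
      then have "f x = c" using s pB[OF c(1)] fx unfolding simple_on_def by blast
      then have "p (f x) \<in> orbit p b" using c(1) by (simp add: orbit.step)
      then show ?thesis using selff by blast
    next
      case False
      then show ?thesis using B(1) fx c(1) by (auto simp: permutes_not_in)
    qed
  qed
  show "orbit (p \<circ> f) b \<subseteq> \<Union>(orbit f ` orbit p b)"
  proof
    fix x assume "x \<in> orbit (p \<circ> f) b"
    then show "x \<in> \<Union>(orbit f ` orbit p b)"
    proof induction
      case base
      show ?case using closed[of b] selff selfp by auto
    next
      case (step y)
      then show ?case using closed[of y] by auto
    qed
  qed
  have pf: "(p \<circ> f) permutes A"
    using A(2) permutes_subset[OF B] by (rule permutes_compose)
  note selfpf = self_in_orbit[OF A(1) pf]
  have inner: "orbit f c \<subseteq> orbit (p \<circ> f) b" if c: "c \<in> B" "c \<in> orbit (p \<circ> f) b" for c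
  proof
    have key: "f y \<in> orbit (p \<circ> f) b" if y: "y \<in> orbit f c" "y \<in> orbit (p \<circ> f) b" for y
    proof (cases "f y \<in> B")
      case True
      then have "f y = c" using s c orbit.step[OF y(1)] unfolding simple_on_def by blast
      then show ?thesis using c by simp
    next
      case False
      then have "f y = (p \<circ> f) y" using B(1) by (simp add: permutes_not_in)
      then show ?thesis using y(2) orbit.step by metis
    qed
    fix x assume "x \<in> orbit f c"
    then show "x \<in> orbit (p \<circ> f) b"
    proof induction
      case base
      show ?case using key[OF selff c(2)] .
    next
      case (step y)
      then show ?case by (rule key)
    qed
  qed
  have pstep: "p c \<in> orbit (p \<circ> f) b" if c: "c \<in> B" "c \<in> orbit (p \<circ> f) b" for c
  proof -
    \<comment> \<open>The point before \<open>c\<close> on its cycle of \<open>f\<close> is the one that \<open>p \<circ> f\<close> sends to \<open>p c\<close>.\<close>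
    have "inv f c \<in> orbit f c"
      by (metis A(1,2) orbit.base orbit_eq permutes_inverses(1) selff)
    then have "inv f c \<in> orbit (p \<circ> f) b" using inner c by blast
    then have "(p \<circ> f) (inv f c) \<in> orbit (p \<circ> f) b" by (rule orbit.step)
    then show ?thesis using permutes_inverses(1)[OF A(2)] by simp
  qed
  have "c \<in> orbit (p \<circ> f) b" if "c \<in> orbit p b" for c
    using that
  proof induction
    case base
    show ?case using pstep b selfpf by blast
  next
    case (step y)
    then show ?case using pstep pB by blast
  qed
  then show "\<Union>(orbit f ` orbit p b) \<subseteq> orbit (p \<circ> f) b"
    using inner pB by blast
qed

lemma orbit_comp_simple_Int:
  assumes "finite A" "f permutes A" "p permutes B" "B \<subseteq> A" "simple_on f B" "b \<in> B"
  shows "orbit (p \<circ> f) b \<inter> B = orbit p b"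
proof (intro set_eqI iffI)
  fix x assume "x \<in> orbit (p \<circ> f) b \<inter> B"
  then obtain c where "c \<in> orbit p b" "x \<in> orbit f c" "x \<in> B"
    unfolding orbit_comp_simple[OF assms] by blast
  moreover from this have "c \<in> B" using permutes_orbit_subset[OF assms(3,6)] by blast
  ultimately show "x \<in> orbit p b" using assms(5) unfolding simple_on_def by blast
next
  fix x assume x: "x \<in> orbit p b"
  then have "x \<in> B" using permutes_orbit_subset[OF assms(3,6)] by blast
  then show "x \<in> orbit (p \<circ> f) b \<inter> B"
    unfolding orbit_comp_simple[OF assms] using x self_in_orbit[OF assms(1,2)] by blast
qed

text \<open>
  This is the uniqueness of the factorization of a permutation into a permutation of \<open>B\<close> and one
  whose cycles meet \<open>B\<close> at most once: two factorizations \<open>q \<circ> f = q' \<circ> f'\<close> give \<open>f' = p \<circ> f\<close>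
  with \<open>p = inv q' \<circ> q\<close>. Inside \<open>B\<close>, the cycles of \<open>p \<circ> f\<close> are those of \<open>p\<close>.
\<close>

lemma simple_on_unique:
  assumes "finite A" "f permutes A" "p permutes B" "B \<subseteq> A" "simple_on f B" "simple_on (p \<circ> f) B"
  shows "p = id"
proof
  fix x
  show "p x = id x"
  proof (cases "x \<in> B")
    case True
    have "orbit p x \<subseteq> {x}"
      using orbit_comp_simple_Int[OF assms(1-5) True] assms(6) True unfolding simple_on_def by blast
    then show ?thesis using orbit.base[of p x] by auto
  next
    case False
    then show ?thesis using assms(3) by (simp add: permutes_not_in)
  qed
qed

lemma card_orbits_simple:
  assumes "finite A" "f permutes A" "simple_on f B"
  shows "card (orbit f ` B) = card B"
proof (rule card_image, rule inj_onI)
  fix x y assume xy: "x \<in> B" "y \<in> B" "orbit f x = orbit f y"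
  then have "y \<in> orbit f x \<inter> B" using self_in_orbit[OF assms(1,2), of y] by simp
  then show "x = y" using assms(3) xy(1) unfolding simple_on_def by auto
qed

lemma cycles_meeting:
  assumes "finite A" "f permutes A" "B \<subseteq> A"
  shows "{c \<in> cycles A f. c \<inter> B \<noteq> {}} = orbit f ` B"
proof (intro set_eqI iffI)
  fix c assume "c \<in> {c \<in> cycles A f. c \<inter> B \<noteq> {}}"
  then obtain a b where ab: "c = orbit f a" "b \<in> orbit f a" "b \<in> B" by (auto simp: cycles_def)
  then show "c \<in> orbit f ` B" using orbit_eq[OF assms(1,2) ab(2)] by auto
next
  fix c assume "c \<in> orbit f ` B"
  then show "c \<in> {c \<in> cycles A f. c \<inter> B \<noteq> {}}"
    using self_in_orbit[OF assms(1,2)] assms(3) unfolding cycles_def by blast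
qed

text \<open>
  A cycle that avoids \<open>B\<close> only uses the values of the permutation at points outside \<open>B\<close> with image
  outside \<open>B\<close>.
\<close>

lemma cycles_avoiding_cong_le:
  assumes "finite A" "f permutes A" "\<And>x. x \<notin> B \<Longrightarrow> f x \<notin> B \<Longrightarrow> f x = g x"
  shows "{c \<in> cycles A f. c \<inter> B = {}} \<subseteq> {c \<in> cycles A g. c \<inter> B = {}}"
proof
  fix c assume "c \<in> {c \<in> cycles A f. c \<inter> B = {}}"
  then obtain a where a: "a \<in> A" "c = orbit f a" "c \<inter> B = {}" by (auto simp: cycles_def)
  have "orbit g a = orbit f a"
  proof (rule orbit_cong[OF self_in_orbit[OF assms(1,2)]])
    fix s assume s: "s \<in> orbit f a"
    then have "f s \<in> orbit f a" by (rule orbit.step)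
    then have "s \<notin> B" "f s \<notin> B" using s a by auto
    then show "g s = f s" using assms(3) by simp
  qed
  then show "c \<in> {c \<in> cycles A g. c \<inter> B = {}}" using a by (auto simp: cycles_def)
qed

lemma cycles_avoiding_cong:
  assumes "finite A" "f permutes A" "g permutes A"
    and "\<And>x. x \<notin> B \<Longrightarrow> f x \<notin> B \<or> g x \<notin> B \<Longrightarrow> f x = g x"
  shows "{c \<in> cycles A f. c \<inter> B = {}} = {c \<in> cycles A g. c \<inter> B = {}}"
proof
  show "{c \<in> cycles A f. c \<inter> B = {}} \<subseteq> {c \<in> cycles A g. c \<inter> B = {}}"
    using assms(4) by (intro cycles_avoiding_cong_le[OF assms(1,2)]) blast
  show "{c \<in> cycles A g. c \<inter> B = {}} \<subseteq> {c \<in> cycles A f. c \<inter> B = {}}"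
    using assms(4)[symmetric] by (intro cycles_avoiding_cong_le[OF assms(1,3)]) blast
qed

lemma card_cycles_split:
  assumes "finite A" "f permutes A" "B \<subseteq> A"
  shows "card (cycles A f) = card {c \<in> cycles A f. c \<inter> B = {}} + card (orbit f ` B)"
proof -
  let ?D = "{c \<in> cycles A f. c \<inter> B = {}}"
  have "cycles A f = ?D \<union> orbit f ` B" unfolding cycles_meeting[OF assms, symmetric] by blast
  moreover have "?D \<inter> orbit f ` B = {}" unfolding cycles_meeting[OF assms, symmetric] by blast
  moreover have "finite ?D" "finite (orbit f ` B)"
    using finite_cycles[OF assms(1)] finite_subset[OF assms(3,1)] by auto
  ultimately show ?thesis using card_Un_disjoint[of ?D "orbit f ` B"] by presburger
qed

text \<open>
  Composing with \<open>p\<close> does not affect the cycles that avoid \<open>B\<close>. The others are counted by \<open>B\<close>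
  itself before the composition, and by the cycles of \<open>p\<close> after it.
\<close>

lemma card_cycles_comp_simple:
  assumes A: "finite A" "f permutes A" "p permutes B" "B \<subseteq> A" "simple_on f B"
  shows "card (cycles A (p \<circ> f)) + card B = card (cycles A f) + card (cycles B p)"
proof -
  have pf: "(p \<circ> f) permutes A"
    using A(2) permutes_subset[OF A(3,4)] by (rule permutes_compose)
  have "orbit (p \<circ> f) ` B = (\<lambda>c. \<Union>(orbit f ` c)) ` cycles B p"
    unfolding cycles_def image_image by (rule image_cong[OF refl orbit_comp_simple[OF A]])
  moreover have "inj_on (\<lambda>c. \<Union>(orbit f ` c)) (cycles B p)"
  proof (rule inj_on_inverseI[where g = "\<lambda>C. C \<inter> B"])
    fix c assume "c \<in> cycles B p"
    then obtain b where "b \<in> B" "c = orbit p b" by (auto simp: cycles_def)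
    then show "\<Union>(orbit f ` c) \<inter> B = c"
      using orbit_comp_simple_Int[OF A] orbit_comp_simple[OF A] by metis
  qed
  ultimately have "card (orbit (p \<circ> f) ` B) = card (cycles B p)" by (simp add: card_image)
  moreover have avoiding: "{c \<in> cycles A (p \<circ> f). c \<inter> B = {}} = {c \<in> cycles A f. c \<inter> B = {}}"
  proof (rule cycles_avoiding_cong[OF A(1) pf A(2)])
    fix x assume "(p \<circ> f) x \<notin> B \<or> f x \<notin> B"
    then have "f x \<notin> B" using permutes_in_image[OF A(3)] by simp
    then show "(p \<circ> f) x = f x" using A(3) by (simp add: permutes_not_in)
  qed
  ultimately show ?thesis
    using card_cycles_split[OF A(1,2,4)] card_cycles_split[OF A(1) pf A(4)]
      card_orbits_simple[OF A(1,2,5)] avoiding by simp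
qed

text \<open>
  The factor \<open>p\<close> is the first return map of \<open>f\<close> to \<open>B\<close>. Undoing it closes the path of \<open>f\<close>
  from a point of \<open>B\<close> just before its return to \<open>B\<close>.
\<close>

lemma simple_factor_exists:
  assumes A: "finite A" "f permutes A" "B \<subseteq> A"
  obtains p f' where "p permutes B" "f' permutes A" "simple_on f' B" "f = p \<circ> f'"
proof -
  define k where "k b = (LEAST n. 0 < n \<and> (f ^^ n) b \<in> B)" for b
  define r where "r b = (if b \<in> B then (f ^^ k b) b else b)" for b
  have kP: "0 < k b \<and> (f ^^ k b) b \<in> B" if "b \<in> B" for b
  proof -
    obtain n where "0 < n" "b = (f ^^ n) b"
      using self_in_orbit[OF A(1,2), of b] unfolding orbit_altdef by auto
    then have "0 < n \<and> (f ^^ n) b \<in> B" using that by simp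
    then show ?thesis unfolding k_def by (rule LeastI)
  qed
  have kmin: "(f ^^ n) b \<notin> B" if "0 < n" "n < k b" for b n
    using not_less_Least[of n "\<lambda>n. 0 < n \<and> (f ^^ n) b \<in> B"] that unfolding k_def by blast
  have finB: "finite B" using A finite_subset by blast
  \<comment> \<open>If two points have the same first return, the one with the longer way passes through the
      other before it returns, which is only possible if they coincide.\<close>
  have inj: "b = c" if bc: "b \<in> B" "c \<in> B" "(f ^^ k b) b = (f ^^ k c) c" "k b \<le> k c" for b c
  proof -
    have "(f ^^ k c) c = (f ^^ k b) ((f ^^ (k c - k b)) c)"
      using bc(4) by (metis comp_apply funpow_add le_add_diff_inverse)
    moreover have "inj (f ^^ k b)" using A(2) by (simp add: inj_fn permutes_inj)
    ultimately have "b = (f ^^ (k c - k b)) c" using bc(3) by (simp add: inj_eq)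
    then have "k c - k b = 0" using kmin[of "k c - k b" c] kP[OF bc(1)] bc(1) by force
    then show ?thesis using \<open>b = _\<close> by simp
  qed
  have "inj_on r B"
  proof (rule inj_onI)
    fix x y assume "x \<in> B" "y \<in> B" "r x = r y"
    then show "x = y" using inj[of x y] inj[of y x] by (cases "k x \<le> k y") (auto simp: r_def)
  qed
  moreover have "r ` B \<subseteq> B" using kP by (auto simp: r_def)
  ultimately have "bij_betw r B B"
    using finB by (metis bij_betw_imageI card_image card_subset_eq)
  then have rB: "r permutes B" by (rule bij_imp_permutes) (simp add: r_def)
  define f' where "f' = inv r \<circ> f"
  have f'A: "f' permutes A" unfolding f'_def
    using A(2) permutes_subset[OF permutes_inv[OF rB] A(3)] by (rule permutes_compose)
  have "f = r \<circ> f'" unfolding f'_def using permutes_inverses(1)[OF rB] by auto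
  moreover have "simple_on f' B" unfolding simple_on_def
  proof (intro ballI subsetI)
    fix b x assume b: "b \<in> B" and x: "x \<in> orbit f' b \<inter> B"
    \<comment> \<open>The set \<open>?S\<close> is the cycle of \<open>f'\<close> through \<open>b\<close>; it meets \<open>B\<close> only at the time \<open>j = 0\<close>.\<close>
    let ?S = "{(f ^^ j) b |j. j < k b}"
    have cl: "f' y \<in> ?S" if "y \<in> ?S" for y
    proof -
      from that obtain j where j: "y = (f ^^ j) b" "j < k b" by blast
      show ?thesis
      proof (cases "Suc j = k b")
        case True
        then have "f y = r b" using j b by (auto simp: r_def simp flip: True)
        then have "f' y = b" unfolding f'_def using permutes_inverses(2)[OF rB] by simp
        then have "f' y = (f ^^ 0) b" by simp
        then show ?thesis using kP[OF b] by blast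
      next
        case False
        then have "Suc j < k b" using j by simp
        moreover have "f y = (f ^^ Suc j) b" using j by simp
        moreover have "inv r (f y) = f y"
          using kmin[OF _ \<open>Suc j < k b\<close>] permutes_not_in[OF permutes_inv[OF rB]]
          by (simp add: j)
        ultimately show ?thesis unfolding f'_def by (metis (mono_tags, lifting) comp_apply mem_Collect_eq)
      qed
    qed
    have b0: "b \<in> ?S" using kP[OF b] by (auto intro!: exI[of _ 0])
    have "x \<in> orbit f' b" using x by blast
    then have "x \<in> ?S"
    proof induction
      case base show ?case using cl[OF b0] .
    next
      case (step y) then show ?case using cl by blast
    qed
    then obtain j where j: "x = (f ^^ j) b" "j < k b" by blast
    then have "j = 0" using x kmin[of j b] by blast
    then show "x \<in> {b}" using j by simp
  qed
  ultimately show thesis using that rB f'A by blast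
qed

section \<open>Strictly monotone factorizations\<close>

definition comp_list :: "('a \<Rightarrow> 'a) list \<Rightarrow> 'a \<Rightarrow> 'a" where
  "comp_list fs = foldr (\<circ>) fs id"

lemma comp_list_Nil [simp]: "comp_list [] = id"
  by (simp add: comp_list_def)

lemma comp_list_snoc: "comp_list (fs @ [f]) = comp_list fs \<circ> f"
  unfolding comp_list_def by (induction fs) (simp_all add: comp_assoc)

lemma strictly_monotone_0: "strictly_monotone 0 ts \<longleftrightarrow> ts = []"
proof
  assume "strictly_monotone 0 ts"
  then obtain ps :: "(nat \<times> nat) list" where "ts = map (\<lambda>(a, b). transpose a b) ps"
    "\<forall>(a, b)\<in>set ps. 1 \<le> a \<and> a < b \<and> b \<le> 0"
    unfolding strictly_monotone_def by blast
  then show "ts = []" by (cases ps) auto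
qed (auto simp: strictly_monotone_def)

text \<open>
  As the larger entries of the transpositions increase, the largest point can only occur in the last
  one. All properties of strictly monotone sequences follow by induction from this.
\<close>

lemma strictly_monotone_Suc:
  "strictly_monotone (Suc d) ts \<longleftrightarrow> strictly_monotone d ts \<or>
     (\<exists>ts' a. ts = ts' @ [transpose a (Suc d)] \<and> strictly_monotone d ts' \<and> 1 \<le> a \<and> a \<le> d)"
  (is "?L \<longleftrightarrow> ?R")
proof
  assume ?L
  then obtain ps where ps: "ts = map (\<lambda>(a, b). transpose a b) ps"
    "\<forall>(a, b)\<in>set ps. 1 \<le> a \<and> a < b \<and> b \<le> Suc d" "sorted_wrt (<) (map snd ps)"
    unfolding strictly_monotone_def by blast
  show ?R
  proof (cases "\<forall>(a,b)\<in>set ps. b \<le> d")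
    case True
    then have "strictly_monotone d ts" unfolding strictly_monotone_def using ps
      by (intro exI[of _ ps]) auto
    then show ?thesis ..
  next
    case False
    then have "ps \<noteq> []" by auto
    then obtain qs a b where q: "ps = qs @ [(a, b)]" by (metis rev_exhaust surj_pair)
    have qb: "y < b" if "(x, y) \<in> set qs" for x y
      using ps(3) that unfolding q by (force simp: sorted_wrt_append)
    have b: "b = Suc d"
    proof (rule ccontr)
      assume "b \<noteq> Suc d"
      then have "b \<le> d" using ps(2) q by auto
      then show False using False qb unfolding q by force
    qed
    have "strictly_monotone d (map (\<lambda>(a, b). transpose a b) qs)"
      unfolding strictly_monotone_def using ps(2,3) qb unfolding q b
      by (intro exI[of _ qs]) (fastforce simp: sorted_wrt_append)
    moreover have "ts = map (\<lambda>(a, b). transpose a b) qs @ [transpose a (Suc d)]"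
      using ps(1) by (simp add: q b)
    moreover have "1 \<le> a" "a \<le> d" using ps(2) by (auto simp: q b)
    ultimately show ?thesis by blast
  qed
next
  assume ?R
  then show ?L
  proof
    assume "strictly_monotone d ts"
    then show ?L unfolding strictly_monotone_def by fastforce
  next
    assume "\<exists>ts' a. ts = ts' @ [transpose a (Suc d)] \<and> strictly_monotone d ts' \<and> 1 \<le> a \<and> a \<le> d"
    then obtain qs a where "ts = map (\<lambda>(a, b). transpose a b) qs @ [transpose a (Suc d)]"
      "\<forall>(a, b)\<in>set qs. 1 \<le> a \<and> a < b \<and> b \<le> d" "sorted_wrt (<) (map snd qs)" "1 \<le> a" "a \<le> d"
      unfolding strictly_monotone_def by blast
    then show ?L unfolding strictly_monotone_def
      by (intro exI[of _ "qs @ [(a, Suc d)]"]) (fastforce simp: sorted_wrt_append)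
  qed
qed

lemma card_cycles_fixed_last:
  assumes "p permutes {1..d}"
  shows "card (cycles {1..Suc d} p) = Suc (card (cycles {1..d} p))"
proof -
  have "p (Suc d) = Suc d" using assms by (simp add: permutes_not_in)
  then have "orbit p (Suc d) = {Suc d}" by (simp add: orbit_eq_singleton_iff)
  then have "cycles {1..Suc d} p = insert {Suc d} (cycles {1..d} p)"
    by (simp add: cycles_def atLeastAtMostSuc_conv)
  moreover have "{Suc d} \<notin> cycles {1..d} p"
  proof
    assume "{Suc d} \<in> cycles {1..d} p"
    then have "Suc d \<in> \<Union>(cycles {1..d} p)" by blast
    then have "Suc d \<in> {1..d}" unfolding Union_cycles[OF finite_atLeastAtMost assms] .
    then show False by simp
  qed
  ultimately show ?thesis using finite_cycles[of "{1..d}" p] by simp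
qed

text \<open>
  Multiplying by the transposition inserts the new point into the cycle of \<open>a\<close>. This is the case
  \<open>B = {1..d}\<close> of the cycle count above, because every cycle of the transposition contains exactly
  one point of \<open>{1..d}\<close>.
\<close>

lemma card_cycles_transpose_last:
  assumes p: "p permutes {1..d}" and a: "1 \<le> a" "a \<le> d"
  shows "card (cycles {1..Suc d} (p \<circ> transpose a (Suc d))) = card (cycles {1..d} p)"
proof -
  let ?t = "transpose a (Suc d)"
  have t: "?t permutes {1..Suc d}" using a by (intro permutes_swap_id) auto
  have orb: "orbit ?t b \<subseteq> {b, ?t b}" for b
  proof
    fix x assume "x \<in> orbit ?t b" then show "x \<in> {b, ?t b}"
      by induction auto
  qed
  have simple: "simple_on ?t {1..d}" unfolding simple_on_def
    using orb a by (fastforce simp: transpose_def split: if_splits)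
  have "orbit ?t (Suc d) = orbit ?t a"
    using permutation_orbit_step[of ?t a] t permutation_permutes
    by (metis finite_atLeastAtMost transpose_apply_first)
  then have "cycles {1..Suc d} ?t = orbit ?t ` {1..d}"
    using a by (auto simp: cycles_def atLeastAtMostSuc_conv)
  then have "card (cycles {1..Suc d} ?t) = d"
    using card_orbits_simple[OF _ t simple] by simp
  then show ?thesis using card_cycles_comp_simple[OF _ t p _ simple] by simp
qed

lemma strictly_monotone_permutes:
  assumes "strictly_monotone d ts"
  shows "comp_list ts permutes {1..d}" "length ts + card (cycles {1..d} (comp_list ts)) = d"
proof -
  have "comp_list ts permutes {1..d} \<and> length ts + card (cycles {1..d} (comp_list ts)) = d"
    using assms
  proof (induction d arbitrary: ts)
    case 0
    then have "ts = []" by (simp add: strictly_monotone_0)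
    then show ?case by (simp add: cycles_def id_def)
  next
    case (Suc d)
    from Suc.prems[unfolded strictly_monotone_Suc] show ?case
    proof (elim disjE exE conjE)
      assume "strictly_monotone d ts"
      then have IH: "comp_list ts permutes {1..d}" "length ts + card (cycles {1..d} (comp_list ts)) = d"
        using Suc.IH by auto
      then show ?thesis using card_cycles_fixed_last[OF IH(1)]
        by (auto intro: permutes_subset)
    next
      fix ts' a
      assume a: "ts = ts' @ [transpose a (Suc d)]" "strictly_monotone d ts'" "1 \<le> a" "a \<le> d"
      then have IH: "comp_list ts' permutes {1..d}" "length ts' + card (cycles {1..d} (comp_list ts')) = d"
        using Suc.IH by auto
      have "comp_list ts' permutes {1..Suc d}" using IH(1) by (rule permutes_subset) auto
      moreover have "transpose a (Suc d) permutes {1..Suc d}" using a by (intro permutes_swap_id) auto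
      ultimately have "comp_list ts permutes {1..Suc d}"
        unfolding a(1) comp_list_snoc by (metis permutes_compose)
      then show ?thesis using card_cycles_transpose_last[OF IH(1) a(3,4)] IH(2)
        unfolding a(1) comp_list_snoc length_append by (simp add: comp_def)
    qed
  qed
  then show "comp_list ts permutes {1..d}" "length ts + card (cycles {1..d} (comp_list ts)) = d"
    by auto
qed

text \<open>
  The product fixes \<open>Suc d\<close> if and only if this point does not occur in the sequence. Otherwise the
  last transposition exchanges \<open>Suc d\<close> with its preimage under the product.
\<close>

lemma strictly_monotone_unique:
  assumes "strictly_monotone d ts" "strictly_monotone d us" "comp_list ts = comp_list us"
  shows "ts = us"
  using assms
proof (induction d arbitrary: ts us)
  case 0
  then show ?case by (simp add: strictly_monotone_0)
next
  case (Suc d)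
  have fix_last: "comp_list vs (Suc d) = Suc d" if "strictly_monotone d vs" for vs
    using strictly_monotone_permutes(1)[OF that] by (simp add: permutes_not_in)
  have move: "comp_list (vs @ [transpose a (Suc d)]) a = Suc d" if "strictly_monotone d vs" for vs a
    using fix_last[OF that] by (simp add: comp_list_snoc)
  have injc: "comp_list vs x = comp_list vs y \<Longrightarrow> x = y" if "strictly_monotone (Suc d) vs" for vs x y
    using permutes_inj[OF strictly_monotone_permutes(1)[OF that]] by (simp add: inj_eq)
  consider "strictly_monotone d ts" "strictly_monotone d us"
    | ts' a where "ts = ts' @ [transpose a (Suc d)]" "strictly_monotone d ts'" "a \<le> d" "strictly_monotone d us"
    | us' a where "us = us' @ [transpose a (Suc d)]" "strictly_monotone d us'" "a \<le> d" "strictly_monotone d ts"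
    | ts' a us' b where "ts = ts' @ [transpose a (Suc d)]" "strictly_monotone d ts'"
       "us = us' @ [transpose b (Suc d)]" "strictly_monotone d us'"
    using Suc.prems(1,2) unfolding strictly_monotone_Suc by blast
  then show ?case
  proof cases
    case 1
    then show ?thesis using Suc.IH Suc.prems(3) by blast
  next
    case (2 ts' a)
    then have "comp_list us (Suc d) = comp_list us a"
      using move[OF 2(2), of a] fix_last[OF 2(4)] Suc.prems(3) unfolding 2(1) by metis
    then show ?thesis using injc[OF Suc.prems(2)] 2(3) by force
  next
    case (3 us' a)
    then have "comp_list ts (Suc d) = comp_list ts a"
      using move[OF 3(2), of a] fix_last[OF 3(4)] Suc.prems(3) unfolding 3(1) by metis
    then show ?thesis using injc[OF Suc.prems(1)] 3(3) by force
  next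
    case (4 ts' a us' b)
    have "comp_list us a = comp_list us b"
      using move[OF 4(2), of a] move[OF 4(4), of b] Suc.prems(3) unfolding 4(1,3) by metis
    then have ab: "a = b" using injc[OF Suc.prems(2)] by blast
    have "comp_list ts' \<circ> transpose a (Suc d) = comp_list us' \<circ> transpose a (Suc d)"
      using Suc.prems(3) unfolding 4 ab comp_list_snoc .
    then have "comp_list ts' \<circ> (transpose a (Suc d) \<circ> transpose a (Suc d))
      = comp_list us' \<circ> (transpose a (Suc d) \<circ> transpose a (Suc d))"
      unfolding o_assoc by simp
    then have "comp_list ts' = comp_list us'" by simp
    then have "ts' = us'" by (rule Suc.IH[OF 4(2,4)])
    then show ?thesis using 4(1,3) ab by simp
  qed
qed

lemma strictly_monotone_exists:
  assumes "p permutes {1..d}"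
  shows "\<exists>ts. strictly_monotone d ts \<and> comp_list ts = p"
  using assms
proof (induction d arbitrary: p)
  case 0
  then show ?case by (auto simp: strictly_monotone_0)
next
  case (Suc d)
  show ?case
  proof (cases "p (Suc d) = Suc d")
    case True
    have "p permutes {1..d}"
      by (rule permutes_superset[OF Suc.prems]) (use True in \<open>auto simp: atLeastAtMostSuc_conv\<close>)
    then show ?thesis using Suc.IH strictly_monotone_Suc by blast
  next
    case False
    \<comment> \<open>Multiplying by the transposition of \<open>Suc d\<close> and its preimage makes \<open>Suc d\<close> a fixed point.\<close>
    define a where "a = inv p (Suc d)"
    have pa: "p a = Suc d" unfolding a_def by (rule permutes_inverses(1)[OF Suc.prems])
    have "a \<in> {1..Suc d}" using permutes_in_image[OF Suc.prems, of a] pa by simp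
    moreover have "a \<noteq> Suc d" using pa False by auto
    ultimately have a: "1 \<le> a" "a \<le> d" by auto
    let ?t = "transpose a (Suc d)"
    have t: "?t permutes {1..Suc d}" using a by (intro permutes_swap_id) auto
    have "(p \<circ> ?t) permutes {1..d}"
    proof (rule permutes_superset[OF permutes_compose[OF t Suc.prems]])
      fix x assume "x \<in> {1..Suc d} - {1..d}"
      then have "x = Suc d" by auto
      then show "(p \<circ> ?t) x = x" using pa by simp
    qed
    then obtain ts where ts: "strictly_monotone d ts" "comp_list ts = p \<circ> ?t" using Suc.IH by blast
    have "comp_list (ts @ [?t]) = p \<circ> (?t \<circ> ?t)"
      unfolding comp_list_snoc ts(2) by (simp only: o_assoc)
    then have "comp_list (ts @ [?t]) = p" by simp
    moreover have "strictly_monotone (Suc d) (ts @ [?t])"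
      using ts(1) a unfolding strictly_monotone_Suc by blast
    ultimately show ?thesis by blast
  qed
qed

section \<open>Permutations with roots on their cycles\<close>

definition root_system :: "('a \<Rightarrow> 'a) \<Rightarrow> 'a list \<Rightarrow> bool" where
  "root_system f s \<longleftrightarrow> distinct (map (orbit f) s)"

definition degrees :: "('a \<Rightarrow> 'a) \<Rightarrow> 'a list \<Rightarrow> nat list" where
  "degrees f s = map (\<lambda>r. card (orbit f r)) s"

text \<open>
  The positions on disjoint cycles of lengths \<open>lam ! 0\<close>, \<open>lam ! 1\<close>, \dots: the pair \<open>(i, j)\<close> is the
  \<open>j\<close>-th point after the root of the \<open>i\<close>-th cycle. With \<open>next_slot\<close>, they are the universal
  permutation with roots of degrees \<open>lam\<close>, and \<open>root_walk\<close> identifies any other one with it.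
\<close>

definition slots :: "nat list \<Rightarrow> (nat \<times> nat) set" where
  "slots lam = (SIGMA i:{..<length lam}. {..<lam ! i})"

definition next_slot :: "nat list \<Rightarrow> nat \<times> nat \<Rightarrow> nat \<times> nat" where
  "next_slot lam = (\<lambda>(i, j). (i, Suc j mod lam ! i))"

definition root_walk :: "('a \<Rightarrow> 'a) \<Rightarrow> 'a list \<Rightarrow> nat \<times> nat \<Rightarrow> 'a" where
  "root_walk f s = (\<lambda>(i, j). (f ^^ j) (s ! i))"

lemma length_degrees [simp]: "length (degrees f s) = length s"
  by (simp add: degrees_def)

lemma finite_slots: "finite (slots lam)"
  by (simp add: slots_def)

lemma card_slots: "card (slots lam) = sum_list lam"
  by (simp add: slots_def sum_list_sum_nth atLeast0LessThan)

lemma orbit_enum: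
  assumes "finite A" "f permutes A"
  shows "bij_betw (\<lambda>j. (f ^^ j) x) {..<card (orbit f x)} (orbit f x)"
    and "(f ^^ card (orbit f x)) x = x" and "0 < card (orbit f x)"
proof -
  note self = self_in_orbit[OF assms, of x]
  let ?n = "funpow_dist1 f x x"
  have inj: "inj_on (\<lambda>j. (f ^^ j) x) {0..<?n}" by (rule inj_on_funpow_dist1[OF self])
  have im: "orbit f x = (\<lambda>j. (f ^^ j) x) ` {0..<?n}" by (rule orbit_conv_funpow_dist1[OF self])
  have n: "card (orbit f x) = ?n" using card_image[OF inj] im by simp
  show "bij_betw (\<lambda>j. (f ^^ j) x) {..<card (orbit f x)} (orbit f x)"
    unfolding n bij_betw_def using inj im by (simp add: atLeast0LessThan)
  show "(f ^^ card (orbit f x)) x = x" unfolding n by (rule funpow_dist1_prop[OF self])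
  show "0 < card (orbit f x)" unfolding n by simp
qed

lemma root_walk_bij:
  assumes A: "finite A" "f permutes A" and s: "root_system f s"
  shows "bij_betw (root_walk f s) (slots (degrees f s)) (\<Union>(orbit f ` set s))"
  unfolding bij_betw_def
proof
  have nth: "degrees f s ! i = card (orbit f (s ! i))" if "i < length s" for i
    using that by (simp add: degrees_def)
  note enum = orbit_enum(1)[OF A, unfolded bij_betw_def]
  have mem: "(f ^^ j) (s ! i) \<in> orbit f (s ! i)" for i j
    by (rule funpow_in_orbit) (rule self_in_orbit[OF A])
  show "inj_on (root_walk f s) (slots (degrees f s))"
  proof (rule inj_onI, clarify)
    fix i j i' j'
    assume a: "(i, j) \<in> slots (degrees f s)" "(i', j') \<in> slots (degrees f s)"
      and eq: "root_walk f s (i, j) = root_walk f s (i', j')"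
    have i: "i < length s" "i' < length s" using a by (auto simp: slots_def)
    have "orbit f (s ! i) = orbit f (s ! i')"
      using eq orbit_eq[OF A mem, of j i] orbit_eq[OF A mem, of j' i'] by (simp add: root_walk_def)
    then have ii: "i = i'"
      using s i unfolding root_system_def
      by (metis length_map nth_map nth_eq_iff_index_eq)
    have "j = j'"
      using conjunct1[OF enum, of "s ! i"] a eq i unfolding ii
      by (auto simp: root_walk_def slots_def nth inj_on_def)
    then show "i = i' \<and> j = j'" using ii by simp
  qed
  have "root_walk f s ` slots (degrees f s) = (\<Union>i<length s. (\<lambda>j. (f ^^ j) (s ! i)) ` {..<card (orbit f (s ! i))})"
    by (force simp: slots_def root_walk_def nth)
  also have "\<dots> = (\<Union>i<length s. orbit f (s ! i))"
    using enum by simp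
  also have "\<dots> = \<Union>(orbit f ` set s)"
    by (auto simp: set_conv_nth)
  finally show "root_walk f s ` slots (degrees f s) = \<Union>(orbit f ` set s)" .
qed

lemma root_walk_step:
  assumes A: "finite A" "f permutes A" and x: "x \<in> slots (degrees f s)"
  shows "f (root_walk f s x) = root_walk f s (next_slot (degrees f s) x)"
    and "next_slot (degrees f s) x \<in> slots (degrees f s)"
proof -
  obtain i j where ij: "x = (i, j)" by fastforce
  have i: "i < length s" and j: "j < card (orbit f (s ! i))"
    using x by (auto simp: slots_def degrees_def ij)
  have per: "(f ^^ (Suc j mod card (orbit f (s ! i)))) (s ! i) = (f ^^ Suc j) (s ! i)"
    by (rule funpow_mod_eq[OF orbit_enum(2)[OF A]])
  show "f (root_walk f s x) = root_walk f s (next_slot (degrees f s) x)"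
    using per i by (simp add: root_walk_def next_slot_def ij degrees_def)
  show "next_slot (degrees f s) x \<in> slots (degrees f s)"
    using i j by (auto simp: next_slot_def slots_def ij degrees_def)
qed

lemma root_walk_0: "i < length s \<Longrightarrow> root_walk f s (i, 0) = s ! i"
  by (simp add: root_walk_def)

lemma slot_0:
  assumes "finite A" "f permutes A" "i < length s"
  shows "(i, 0) \<in> slots (degrees f s)"
  using assms(3) orbit_enum(3)[OF assms(1,2)] by (simp add: slots_def degrees_def)

text \<open>
  Both permutations are isomorphic to the one on the slots of their common degrees.
\<close>

lemma equivariant_exists:
  assumes A: "finite A" "f permutes A" and s: "root_system f s"
    and C: "finite C" "g permutes C" and r: "root_system g r"
    and deg: "degrees f s = degrees g r"
  obtains b where "bij_betw b (\<Union>(orbit f ` set s)) (\<Union>(orbit g ` set r))"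
    "\<And>x. x \<in> \<Union>(orbit f ` set s) \<Longrightarrow> b (f x) = g (b x)" "map b s = r"
proof
  let ?S = "slots (degrees f s)"
  let ?t = "inv_into ?S (root_walk f s)"
  let ?b = "root_walk g r \<circ> ?t"
  have tf: "bij_betw (root_walk f s) ?S (\<Union>(orbit f ` set s))" by (rule root_walk_bij[OF A s])
  have tg: "bij_betw (root_walk g r) ?S (\<Union>(orbit g ` set r))"
    unfolding deg by (rule root_walk_bij[OF C r])
  show "bij_betw ?b (\<Union>(orbit f ` set s)) (\<Union>(orbit g ` set r))"
    by (rule bij_betw_trans[OF bij_betw_inv_into[OF tf] tg])
  have val: "?b (root_walk f s z) = root_walk g r z" if "z \<in> ?S" for z
    using bij_betw_inv_into_left[OF tf that] by simp
  show "?b (f x) = g (?b x)" if "x \<in> \<Union>(orbit f ` set s)" for x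
  proof -
    from that obtain z where z: "z \<in> ?S" "x = root_walk f s z"
      using tf unfolding bij_betw_def by blast
    have "?b (f x) = root_walk g r (next_slot (degrees f s) z)"
      using val[OF root_walk_step(2)[OF A z(1)]] root_walk_step(1)[OF A z(1)] z(2) by simp
    also have "\<dots> = g (root_walk g r z)"
      using root_walk_step(1)[OF C z(1)[unfolded deg]] deg by simp
    finally show ?thesis using val[OF z(1)] z(2) by simp
  qed
  have len: "length s = length r" using deg length_degrees by metis
  show "map ?b s = r"
  proof (rule nth_equalityI)
    fix i assume "i < length (map ?b s)"
    then show "map ?b s ! i = r ! i"
      using val[OF slot_0[OF A]] by (simp add: root_walk_0 len)
  qed (simp add: len)
qed

text \<open>
  A map that commutes with the permutations propagates from a root along its cycle.
\<close>

lemma equivariant_unique: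
  assumes b: "\<And>x. x \<in> \<Union>(orbit f ` set s) \<Longrightarrow> b (f x) = g (b x)"
    and b': "\<And>x. x \<in> \<Union>(orbit f ` set s) \<Longrightarrow> b' (f x) = g (b' x)"
    and eq: "map b s = map b' s" and x: "x \<in> \<Union>(orbit f ` set s)"
    and A: "finite A" "f permutes A"
  shows "b x = b' x"
proof -
  from x obtain y where y: "y \<in> set s" "x \<in> orbit f y" by blast
  have base_eq: "b y = b' y" using eq y(1) by simp
  from y(2) show ?thesis
  proof induction
    case base
    have "y \<in> \<Union>(orbit f ` set s)" using y(1) self_in_orbit[OF A] by blast
    then show ?case using b b' base_eq by simp
  next
    case (step z)
    then have "z \<in> \<Union>(orbit f ` set s)" using y(1) by blast
    then show ?case using b b' step by simp
  qed
qed

lemma root_system_covers: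
  assumes A: "finite A" "f permutes A" and s: "set s \<subseteq> A" "root_system f s"
    and sum: "sum_list (degrees f s) = card A"
  shows "\<Union>(orbit f ` set s) = A"
proof (rule card_subset_eq[OF A(1)])
  show "\<Union>(orbit f ` set s) \<subseteq> A" using s permutes_orbit_subset[OF A(2)] by blast
  show "card (\<Union>(orbit f ` set s)) = card A"
    using bij_betw_same_card[OF root_walk_bij[OF A s(2)]] sum by (simp add: card_slots)
qed

lemma root_system_cycles:
  assumes A: "finite A" "f permutes A" and s: "set s \<subseteq> A"
    and cov: "\<Union>(orbit f ` set s) = A"
  shows "cycles A f = set (map (orbit f) s)"
proof -
  have "cycles A f \<subseteq> orbit f ` set s"
  proof
    fix c assume "c \<in> cycles A f"
    then obtain a where a: "a \<in> A" "c = orbit f a" by (auto simp: cycles_def)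
    then obtain y where "y \<in> set s" "a \<in> orbit f y" using cov by blast
    then show "c \<in> orbit f ` set s" using a(2) orbit_eq[OF A] by blast
  qed
  then show ?thesis using s by (auto simp: cycles_def)
qed

lemma root_system_cycle_type:
  assumes A: "finite A" "f permutes A" and s: "set s \<subseteq> A" "root_system f s"
    and sum: "sum_list (degrees f s) = card A"
  shows "cycle_type A f = mset (degrees f s)"
proof -
  have "mset_set (cycles A f) = mset (map (orbit f) s)"
    unfolding root_system_cycles[OF A s(1) root_system_covers[OF assms]]
    by (rule mset_set_set) (use s(2) in \<open>simp only: root_system_def\<close>)
  then show ?thesis by (simp add: cycle_type_def degrees_def image_mset.compositionality o_def)
qed

lemma sum_cycle_type:
  assumes "finite A" "f permutes A"
  shows "sum_mset (cycle_type A f) = card A"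
proof -
  have "sum_mset (cycle_type A f) = (\<Sum>c\<in>cycles A f. card c)"
    by (simp add: cycle_type_def sum_unfold_sum_mset)
  also have "\<dots> = card (\<Union>(cycles A f))"
  proof (rule card_Union_disjoint[symmetric])
    show "pairwise disjnt (cycles A f)"
      using cycles_disjoint[OF assms] unfolding pairwise_def disjnt_def by blast
    show "finite c" if "c \<in> cycles A f" for c
      using that Union_cycles[OF assms] assms(1) by (metis Union_upper finite_subset)
  qed
  finally show ?thesis by (simp add: Union_cycles[OF assms])
qed

text \<open>
  A sequence of roots is chosen by taking, independently, one element of each cycle; here \<open>h\<close> plays
  the role of the map from elements to cycles.
\<close>

lemma card_sequences_in_fibres:
  assumes "\<And>c. c \<in> set cs \<Longrightarrow> finite {x. h x = c}"
  shows "finite {s. map h s = cs} \<and> card {s. map h s = cs} = (\<Prod>c\<leftarrow>cs. card {x. h x = c})"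
  using assms
proof (induction cs)
  case Nil
  then show ?case by simp
next
  case (Cons c cs)
  have eq: "{s. map h s = c # cs} = (\<lambda>(x, s). x # s) ` ({x. h x = c} \<times> {s. map h s = cs})"
    by (auto simp: map_eq_Cons_conv)
  have "inj_on (\<lambda>(x, s). x # s) ({x. h x = c} \<times> {s. map h s = cs})" by (auto simp: inj_on_def)
  then show ?case unfolding eq using Cons by (simp add: card_image card_cartesian_product)
qed

text \<open>
  If \<open>h\<close> takes the values \<open>lam\<close> with the right multiplicities on \<open>C\<close>, the elements of \<open>C\<close> can only
  be permuted among those with equal value. In the induction, the first entry can be any of the
  elements with value \<open>x\<close>, and their number is the factor by which \<open>fact (count_list lam x)\<close> grows.
\<close>

lemma card_arrangements:
  assumes "finite C" "image_mset h (mset_set C) = mset lam"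
  shows "finite {cs. distinct cs \<and> set cs \<subseteq> C \<and> map h cs = lam} \<and>
    card {cs. distinct cs \<and> set cs \<subseteq> C \<and> map h cs = lam} = (\<Prod>j\<in>set lam. fact (count_list lam j))"
  using assms
proof (induction lam arbitrary: C)
  case Nil
  have "{cs. distinct cs \<and> set cs \<subseteq> C \<and> map h cs = []} = {[]}" by auto
  then show ?case by simp
next
  case (Cons x lam)
  let ?F = "\<lambda>C lam. {cs. distinct cs \<and> set cs \<subseteq> C \<and> map h cs = lam}"
  let ?D = "{c \<in> C. h c = x}"
  have IH: "finite (?F (C - {c}) lam) \<and> card (?F (C - {c}) lam) = (\<Prod>j\<in>set lam. fact (count_list lam j))"
    if "c \<in> ?D" for c
  proof (rule Cons.IH)
    have "mset_set C = add_mset c (mset_set (C - {c}))"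
      using that Cons.prems(1) by (simp add: mset_set.remove)
    then show "image_mset h (mset_set (C - {c})) = mset lam" using Cons.prems(2) that by simp
  qed (use Cons.prems in simp)
  have "card ?D = count (image_mset h (mset_set C)) x"
    using Cons.prems(1) by (auto simp: count_image_mset intro!: arg_cong[where f = card])
  then have cD: "card ?D = count_list (x # lam) x" using Cons.prems(2) by (simp add: count_mset)
  have eq: "?F C (x # lam) = (\<Union>c\<in>?D. (#) c ` ?F (C - {c}) lam)"
  proof (intro set_eqI iffI)
    fix cs assume "cs \<in> ?F C (x # lam)"
    then obtain c cs' where c: "cs = c # cs'" "h c = x" "map h cs' = lam" "distinct cs" "set cs \<subseteq> C"
      by (auto simp: map_eq_Cons_conv)
    then have "c \<in> ?D" "cs' \<in> ?F (C - {c}) lam" by auto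
    then show "cs \<in> (\<Union>c\<in>?D. (#) c ` ?F (C - {c}) lam)" using c(1) by blast
  qed auto
  have "card (?F C (x # lam)) = (\<Sum>c\<in>?D. card ((#) c ` ?F (C - {c}) lam))"
    unfolding eq using Cons.prems(1) IH by (intro card_UN_disjoint) auto
  also have "\<dots> = (\<Sum>c\<in>?D. (\<Prod>j\<in>set lam. fact (count_list lam j)))"
    using IH by (intro sum.cong refl) (simp add: card_image)
  also have "\<dots> = count_list (x # lam) x * (\<Prod>j\<in>set lam. fact (count_list lam j))"
    by (simp only: sum_constant cD) simp
  also have "\<dots> = (\<Prod>j\<in>set (x # lam). fact (count_list (x # lam) j))"
  proof -
    have "(\<Prod>j\<in>set lam. fact (count_list lam j)) = (\<Prod>j\<in>insert x (set lam). fact (count_list lam j) :: nat)"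
      by (rule prod.mono_neutral_left) (auto simp: count_list_0_iff)
    also have "\<dots> = fact (count_list lam x) * (\<Prod>j\<in>set lam - {x}. fact (count_list lam j))"
      by (simp add: prod.insert_remove)
    finally have 1: "(\<Prod>j\<in>set lam. fact (count_list lam j)) = fact (count_list lam x) * (\<Prod>j\<in>set lam - {x}. fact (count_list lam j) :: nat)" .
    have "(\<Prod>j\<in>set (x # lam). fact (count_list (x # lam) j)) =
      fact (Suc (count_list lam x)) * (\<Prod>j\<in>set lam - {x}. fact (count_list (x # lam) j) :: nat)"
      by (simp add: prod.insert_remove)
    also have "(\<Prod>j\<in>set lam - {x}. fact (count_list (x # lam) j)) = (\<Prod>j\<in>set lam - {x}. fact (count_list lam j) :: nat)"
      by (rule prod.cong) auto
    finally show ?thesis unfolding 1 by (simp add: algebra_simps)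
  qed
  finally show ?case using Cons.prems(1) IH unfolding eq by auto
qed

text \<open>
  One first orders the cycles such that their lengths form the list \<open>lam\<close>, which gives the factorials
  in \<^const>\<open>zfactor\<close>, and then chooses a root on each of them, which gives the product of the parts.
\<close>

lemma card_root_systems:
  assumes A: "finite A" "f permutes A" and t: "cycle_type A f = mset lam"
  shows "finite {s. set s \<subseteq> A \<and> root_system f s \<and> degrees f s = lam} \<and>
    card {s. set s \<subseteq> A \<and> root_system f s \<and> degrees f s = lam} = zfactor lam"
proof -
  let ?C = "{cs. distinct cs \<and> set cs \<subseteq> cycles A f \<and> map card cs = lam}"
  have C: "finite ?C \<and> card ?C = (\<Prod>j\<in>set lam. fact (count_list lam j))"
    using t by (intro card_arrangements finite_cycles A(1)) (simp add: cycle_type_def)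
  have fib: "{x. orbit f x = c} = c \<and> finite c" if c: "c \<in> cycles A f" for c
  proof -
    have "c \<subseteq> A" using Union_cycles[OF A] c by blast
    moreover have "x \<in> c \<longleftrightarrow> orbit f x = c" for x
    proof -
      from c obtain a where "c = orbit f a" by (auto simp: cycles_def)
      then show ?thesis using self_in_orbit[OF A, of x] orbit_eq[OF A, of x a] by metis
    qed
    ultimately show ?thesis using finite_subset[OF _ A(1), of c] by blast
  qed
  have Cs: "finite {s. map (orbit f) s = cs} \<and> card {s. map (orbit f) s = cs} = prod_list lam"
    if cs: "cs \<in> ?C" for cs
  proof -
    have "map (\<lambda>c. card {x. orbit f x = c}) cs = map card cs"
      using cs fib by (intro map_cong) auto
    then have "map (\<lambda>c. card {x. orbit f x = c}) cs = lam"
      using cs by (metis (mono_tags, lifting) mem_Collect_eq)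
    moreover have "finite {x. orbit f x = c}" if "c \<in> set cs" for c using fib cs that by auto
    ultimately show ?thesis using card_sequences_in_fibres[of cs "orbit f"] by simp
  qed
  have eq: "{s. set s \<subseteq> A \<and> root_system f s \<and> degrees f s = lam} = (\<Union>cs\<in>?C. {s. map (orbit f) s = cs})"
  proof (intro set_eqI iffI)
    fix s assume "s \<in> {s. set s \<subseteq> A \<and> root_system f s \<and> degrees f s = lam}"
    then have "map (orbit f) s \<in> ?C" by (auto simp: root_system_def degrees_def cycles_def)
    then show "s \<in> (\<Union>cs\<in>?C. {s. map (orbit f) s = cs})" by blast
  next
    fix s assume "s \<in> (\<Union>cs\<in>?C. {s. map (orbit f) s = cs})"
    then have s: "map (orbit f) s \<in> ?C" by blast
    moreover have "set s \<subseteq> A"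
    proof
      fix x assume "x \<in> set s"
      then have "orbit f x \<subseteq> A" using s Union_cycles[OF A] by auto
      then show "x \<in> A" using self_in_orbit[OF A, of x] by blast
    qed
    ultimately show "s \<in> {s. set s \<subseteq> A \<and> root_system f s \<and> degrees f s = lam}"
      by (simp add: root_system_def degrees_def o_def)
  qed
  have "card (\<Union>cs\<in>?C. {s. map (orbit f) s = cs}) = (\<Sum>cs\<in>?C. card {s. map (orbit f) s = cs})"
    using C Cs by (intro card_UN_disjoint) auto
  also have "\<dots> = card ?C * prod_list lam" using Cs by simp
  finally show ?thesis unfolding eq using C Cs by (simp add: zfactor_def mult.commute)
qed

lemma zfactor_pos:
  assumes "\<And>x. x \<in> set lam \<Longrightarrow> 0 < x"
  shows "0 < zfactor lam"
proof -
  have "0 < prod_list lam" using assms by (induction lam) auto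
  moreover have "0 < (\<Prod>j\<in>set lam. fact (count_list lam j) :: nat)" by (intro prod_pos) simp
  ultimately show ?thesis unfolding zfactor_def by (rule mult_pos_pos)
qed

lemma root_system_exists:
  assumes "finite A" "f permutes A" "cycle_type A f = mset lam" "\<And>x. x \<in> set lam \<Longrightarrow> 0 < x"
  shows "\<exists>s. set s \<subseteq> A \<and> root_system f s \<and> degrees f s = lam"
proof (rule ccontr)
  assume "\<not> ?thesis"
  then have "{s. set s \<subseteq> A \<and> root_system f s \<and> degrees f s = lam} = {}" by blast
  then have "card {s. set s \<subseteq> A \<and> root_system f s \<and> degrees f s = lam} = 0"
    by (simp only: card.empty)
  then have "zfactor lam = 0" using card_root_systems[OF assms(1-3)] by metis
  moreover have "0 < zfactor lam" using assms(4) by (rule zfactor_pos)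
  ultimately show False by simp
qed

text \<open>
  A bijection \<open>h\<close> between the slots and \<open>A\<close> transports the rotation of the slots to \<open>A\<close>.
\<close>

lemma permutation_of_degrees_exists:
  assumes A: "finite A" and sum: "sum_list lam = card A" and pos: "\<And>x. x \<in> set lam \<Longrightarrow> 0 < x"
  shows "\<exists>f s. f permutes A \<and> set s \<subseteq> A \<and> root_system f s \<and> degrees f s = lam"
proof -
  let ?S = "slots lam"
  obtain h where h: "bij_betw h ?S A"
    using finite_same_card_bij[OF finite_slots A, of lam] sum by (auto simp: card_slots)
  have next_in: "next_slot lam z \<in> ?S" if "z \<in> ?S" for z
    using that by (auto simp: slots_def next_slot_def split: prod.splits)
  have "inj_on (next_slot lam) ?S"
  proof (rule inj_onI)
    fix y z assume yz: "y \<in> ?S" "z \<in> ?S" "next_slot lam y = next_slot lam z"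
    obtain i j i' j' where ij: "y = (i, j)" "z = (i', j')" by fastforce
    have "i = i'" "j < lam ! i" "j' < lam ! i" "Suc j mod lam ! i = Suc j' mod lam ! i"
      using yz by (auto simp: ij next_slot_def slots_def)
    then show "y = z" unfolding ij by (auto simp: mod_Suc split: if_splits)
  qed
  then have nb: "bij_betw (next_slot lam) ?S ?S"
    using next_in by (metis bij_betw_imageI card_image card_subset_eq finite_slots image_subsetI)
  define g where "g = (\<lambda>x. if x \<in> A then h (next_slot lam (inv_into ?S h x)) else x)"
  have gh: "g (h z) = h (next_slot lam z)" if "z \<in> ?S" for z
    using that h bij_betwE[OF h] by (simp add: g_def bij_betw_inv_into_left)
  have "bij_betw (h \<circ> (next_slot lam \<circ> inv_into ?S h)) A A"
    by (rule bij_betw_trans[OF bij_betw_trans[OF bij_betw_inv_into[OF h] nb] h])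
  then have "bij_betw g A A"
    by (subst bij_betw_cong[where g = "h \<circ> (next_slot lam \<circ> inv_into ?S h)"]) (auto simp: g_def)
  then have gA: "g permutes A" by (rule bij_imp_permutes) (simp add: g_def)
  define s where "s = map (\<lambda>i. h (i, 0)) [0..<length lam]"
  have slot: "(i, j) \<in> ?S" if "i < length lam" "j < lam ! i" for i j
    using that by (simp add: slots_def)
  have lpos: "0 < lam ! i" if "i < length lam" for i using pos that by simp
  have pow: "(g ^^ j) (h (i, 0)) = h (i, j mod lam ! i)" if i: "i < length lam" for i j
  proof (induction j)
    case 0 then show ?case by simp
  next
    case (Suc j)
    have "(i, j mod lam ! i) \<in> ?S" using i lpos[OF i] by (intro slot) auto
    then show ?case using Suc gh by (simp add: next_slot_def mod_Suc_eq)
  qed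
  have orb: "orbit g (h (i, 0)) = h ` ({i} \<times> {..<lam ! i})" if i: "i < length lam" for i
  proof -
    have "orbit g (h (i, 0)) = {(g ^^ n) (h (i, 0)) |n. True}"
      by (rule orbit_altdef_self_in) (rule self_in_orbit[OF A gA])
    also have "\<dots> = h ` ({i} \<times> {..<lam ! i})"
    proof (intro set_eqI iffI)
      fix x assume "x \<in> {(g ^^ n) (h (i, 0)) |n. True}"
      then show "x \<in> h ` ({i} \<times> {..<lam ! i})" using pow[OF i] lpos[OF i] by auto
    next
      fix x assume "x \<in> h ` ({i} \<times> {..<lam ! i})"
      then obtain j where "j < lam ! i" "x = h (i, j)" by auto
      then have "x = (g ^^ j) (h (i, 0))" using pow[OF i] by simp
      then show "x \<in> {(g ^^ n) (h (i, 0)) |n. True}" by blast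
    qed
    finally show ?thesis .
  qed
  have hinj: "inj_on h ?S" using h by (rule bij_betw_imp_inj_on)
  have "degrees g s = lam"
  proof (rule nth_equalityI)
    fix i assume "i < length (degrees g s)"
    then have i: "i < length lam" by (simp add: s_def)
    have "inj_on h ({i} \<times> {..<lam ! i})" using slot i by (intro inj_on_subset[OF hinj]) auto
    then show "degrees g s ! i = lam ! i"
      using i by (simp add: degrees_def s_def orb card_image card_cartesian_product)
  qed (simp add: s_def)
  moreover have "root_system g s"
    unfolding root_system_def distinct_conv_nth
  proof (intro allI impI)
    fix i j assume "i < length (map (orbit g) s)" "j < length (map (orbit g) s)" and ne: "i \<noteq> j"
    then have i: "i < length lam" and j: "j < length lam" by (auto simp: s_def)
    have "h (i, 0) \<notin> h ` ({j} \<times> {..<lam ! j})"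
    proof
      assume "h (i, 0) \<in> h ` ({j} \<times> {..<lam ! j})"
      then obtain k where "k < lam ! j" "h (i, 0) = h (j, k)" by auto
      then show False using inj_onD[OF hinj] slot[OF i lpos[OF i]] slot[OF j] ne by blast
    qed
    then have "orbit g (h (i, 0)) \<noteq> orbit g (h (j, 0))"
      using self_in_orbit[OF A gA, of "h (i, 0)"] orb[OF j] by auto
    then show "map (orbit g) s ! i \<noteq> map (orbit g) s ! j" using i j by (simp add: s_def)
  qed
  moreover have "set s \<subseteq> A" using bij_betwE[OF h] slot lpos by (auto simp: s_def)
  ultimately show ?thesis using gA by blast
qed

lemma equivariant_permutation_exists:
  assumes A: "finite A" "f permutes A" "set s \<subseteq> A" "root_system f s" "degrees f s = lam"
    and B: "g permutes A" "set r \<subseteq> A" "root_system g r" "degrees g r = lam"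
    and sum: "sum_list lam = card A"
  obtains b where "b permutes A" "g = b \<circ> f \<circ> inv b" "map b s = r"
proof -
  have cf: "\<Union>(orbit f ` set s) = A" using A sum by (intro root_system_covers) auto
  have cg: "\<Union>(orbit g ` set r) = A" using A B sum by (intro root_system_covers) auto
  have "degrees f s = degrees g r" using A(5) B(4) by simp
  then obtain b where b: "bij_betw b A A" "\<And>x. x \<in> A \<Longrightarrow> b (f x) = g (b x)" "map b s = r"
    using equivariant_exists[OF A(1,2,4) A(1) B(1,3)] unfolding cf cg by metis
  define h where "h = (\<lambda>x. if x \<in> A then b x else x)"
  have "bij_betw h A A" using b(1) by (subst bij_betw_cong[where g = b]) (auto simp: h_def)
  then have hA: "h permutes A" by (rule bij_imp_permutes) (simp add: h_def)
  have "h \<circ> f = g \<circ> h"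
    using b(2) permutes_in_image[OF A(2)] permutes_not_in[OF A(2)] permutes_not_in[OF B(1)]
    by (auto simp: h_def)
  then have "h \<circ> f \<circ> inv h = g" by (simp add: comp_assoc permutes_inv_o(1)[OF hA])
  moreover have "map h s = r" using b(3) A(3) by (auto simp: h_def)
  ultimately show ?thesis using that hA by blast
qed

lemma conj_orbit:
  assumes "finite A" "f permutes A" "b permutes A"
  shows "orbit (b \<circ> f \<circ> inv b) (b x) = b ` orbit f x"
  by (rule orbit_inverse[symmetric, OF self_in_orbit[OF assms(1,2)]])
    (simp add: permutes_inverses(2)[OF assms(3)])

text \<open>
  The group of all permutations of \<open>A\<close> acts by conjugation on the pairs of a permutation with roots
  of degrees \<open>lam\<close>. Any two such pairs are conjugate by exactly one permutation, so there are
  \<open>fact (card A)\<close> pairs, and \<^const>\<open>zfactor\<close> counts those with a given first component.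
\<close>

lemma card_permutations_of_type:
  assumes A: "finite A" and sum: "sum_list lam = card A" and pos: "\<And>x. x \<in> set lam \<Longrightarrow> 0 < x"
  shows "card {f. f permutes A \<and> cycle_type A f = mset lam} * zfactor lam = fact (card A)"
proof -
  let ?R = "\<lambda>f. {s. set s \<subseteq> A \<and> root_system f s \<and> degrees f s = lam}"
  let ?T = "{f. f permutes A \<and> cycle_type A f = mset lam}"
  obtain f0 s0 where f0: "f0 permutes A" "set s0 \<subseteq> A" "root_system f0 s0" "degrees f0 s0 = lam"
    using permutation_of_degrees_exists[OF assms] by blast
  have cov: "\<Union>(orbit f0 ` set s0) = A" using A f0 sum by (intro root_system_covers) auto
  let ?act = "\<lambda>b. (b \<circ> f0 \<circ> inv b, map b s0)"
  have "bij_betw ?act {b. b permutes A} (Sigma ?T ?R)"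
    unfolding bij_betw_def
  proof
    show "inj_on ?act {b. b permutes A}"
    proof (rule inj_onI, clarify, rule ext)
      fix b c x
      assume bc: "b permutes A" "c permutes A" "b \<circ> f0 \<circ> inv b = c \<circ> f0 \<circ> inv c" "map b s0 = map c s0"
      have e: "b (f0 y) = (b \<circ> f0 \<circ> inv b) (b y)" "c (f0 y) = (c \<circ> f0 \<circ> inv c) (c y)" for y
        using permutes_inverses(2)[OF bc(1)] permutes_inverses(2)[OF bc(2)] by simp_all
      show "b x = c x"
      proof (cases "x \<in> A")
        case True
        then show ?thesis
          by (intro equivariant_unique[where f = f0 and g = "b \<circ> f0 \<circ> inv b" and s = s0, OF e(1) e(2)[folded bc(3)] bc(4) _ A f0(1)])
            (simp add: cov)
      qed (use bc(1,2) in \<open>simp add: permutes_not_in\<close>)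
    qed
    show "?act ` {b. b permutes A} = Sigma ?T ?R"
    proof (intro set_eqI iffI)
      fix z assume "z \<in> ?act ` {b. b permutes A}"
      then obtain b where b: "b permutes A" "z = (b \<circ> f0 \<circ> inv b, map b s0)" by blast
      let ?g = "b \<circ> f0 \<circ> inv b"
      note orb = conj_orbit[OF A f0(1) b(1)]
      have inj: "inj b" using b(1) by (rule permutes_inj)
      have gA: "?g permutes A" using b(1) f0(1) by (intro permutes_compose permutes_inv)
      have "degrees ?g (map b s0) = degrees f0 s0"
        by (rule nth_equalityI)
          (simp_all add: degrees_def orb card_image[OF inj_on_subset[OF inj subset_UNIV]])
      then have dg: "degrees ?g (map b s0) = lam" using f0(4) by simp
      have rs: "root_system ?g (map b s0)"
      proof -
        have "map (orbit ?g) (map b s0) = map ((`) b) (map (orbit f0) s0)" by (simp add: orb)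
        moreover have "inj_on ((`) b) (set (map (orbit f0) s0))" using inj by (simp add: inj_on_def inj_image_eq_iff)
        ultimately show ?thesis using f0(3) unfolding root_system_def by (simp only: distinct_map)
      qed
      have sub: "set (map b s0) \<subseteq> A" using f0(2) permutes_in_image[OF b(1)] by auto
      have "cycle_type A ?g = mset lam"
        using root_system_cycle_type[OF A gA sub rs] dg sum by simp
      then show "z \<in> Sigma ?T ?R" using b(2) gA dg rs sub by blast
    next
      fix z assume "z \<in> Sigma ?T ?R"
      then obtain g r where z: "z = (g, r)" "g permutes A" "set r \<subseteq> A" "root_system g r" "degrees g r = lam"
        by blast
      obtain b where "b permutes A" "g = b \<circ> f0 \<circ> inv b" "map b s0 = r"
        using equivariant_permutation_exists[OF A f0 z(2-5) sum] by blast
      then show "z \<in> ?act ` {b. b permutes A}" using z(1) by blast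
    qed
  qed
  then have "card {b. b permutes A} = card (Sigma ?T ?R)" by (rule bij_betw_same_card)
  then have "fact (card A) = card (Sigma ?T ?R)"
    using card_permutations[OF refl A] by (rule trans[OF sym, rotated])
  also have "\<dots> = (\<Sum>f\<in>?T. card (?R f))"
  proof (rule card_SigmaI)
    show "finite ?T" using finite_permutations[OF A] by (rule rev_finite_subset) auto
    show "\<forall>f\<in>?T. finite (?R f)" using card_root_systems[OF A] by blast
  qed
  also have "\<dots> = (\<Sum>f\<in>?T. zfactor lam)"
    by (rule sum.cong[OF refl]) (use card_root_systems[OF A] in blast)
  also have "\<dots> = card ?T * zfactor lam" by simp
  finally show ?thesis by simp
qed

section \<open>Isomorphisms of stuffed maps\<close>

text \<open>
  A stuffed map in which a boundary face may carry several roots. This makes it possible to number all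
  boundary edges by listing them as roots, and still to use the notions of boundary edges, fully
  simple maps, internal faces and Euler characteristic.
\<close>

definition multirooted :: "'a smap \<Rightarrow> bool" where
  "multirooted M \<longleftrightarrow>
     finite (oedges M) \<and>
     sigma0 M permutes oedges M \<and>
     sigma1 M permutes oedges M \<and>
     sigma2 M permutes oedges M \<and>
     (\<forall>e\<in>oedges M. sigma1 M e \<noteq> e \<and> sigma1 M (sigma1 M e) = e) \<and>
     sigma0 M \<circ> sigma1 M \<circ> sigma2 M = id \<and>
     set (roots M) \<subseteq> oedges M \<and>
     partition_on (unrooted_cycles M) (parts M)"

lemma stuffed_map_iff: "stuffed_map M \<longleftrightarrow> multirooted M \<and> root_system (sigma2 M) (roots M)"
  unfolding stuffed_map_def multirooted_def root_system_def distinct_conv_nth by auto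

lemma boundary_degrees_eq: "boundary_degrees M = degrees (sigma2 M) (roots M)"
  by (simp add: boundary_degrees_def degrees_def)

lemma cycles_image:
  assumes A: "finite A" "f permutes A" and eq: "\<And>x. x \<in> A \<Longrightarrow> g (h x) = h (f x)"
  shows "x \<in> A \<Longrightarrow> orbit g (h x) = h ` orbit f x" and "cycles (h ` A) g = (`) h ` cycles A f"
proof -
  show orb: "orbit g (h x) = h ` orbit f x" if "x \<in> A" for x
  proof (rule orbit_inverse[symmetric, OF self_in_orbit[OF A]])
    fix y assume "y \<in> orbit f x"
    then have "y \<in> A" using permutes_orbit_subset[OF A(2) that] by blast
    then show "g (h y) = h (f y)" by (rule eq)
  qed
  show "cycles (h ` A) g = (`) h ` cycles A f"
    unfolding cycles_def image_image by (rule image_cong[OF refl]) (rule orb)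
qed

lemma multirooted_parts_subset:
  assumes "multirooted M" "p \<in> parts M" "c \<in> p"
  shows "c \<in> unrooted_cycles M" "c \<subseteq> oedges M"
proof -
  have "partition_on (unrooted_cycles M) (parts M)" using assms(1) by (simp add: multirooted_def)
  from partition_onD1[OF this] show c: "c \<in> unrooted_cycles M" using assms(2,3) by blast
  have p2: "sigma2 M permutes oedges M" using assms(1) by (simp add: multirooted_def)
  from c obtain a where "a \<in> oedges M" "c = orbit (sigma2 M) a"
    by (auto simp: unrooted_cycles_def cycles_def)
  then show "c \<subseteq> oedges M" using permutes_orbit_subset[OF p2] by simp
qed

lemma finite_parts:
  assumes "multirooted M"
  shows "finite (unrooted_cycles M)" "finite (parts M)" "p \<in> parts M \<Longrightarrow> finite p"
proof -
  show u: "finite (unrooted_cycles M)"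
    using assms finite_cycles[of "oedges M"] unfolding multirooted_def unrooted_cycles_def by simp
  show "finite (parts M)" using finite_elements[OF u] assms by (simp add: multirooted_def)
  show "finite p" if "p \<in> parts M"
    by (rule finite_subset[OF _ u]) (use multirooted_parts_subset(1)[OF assms that] in blast)
qed

text \<open>
  All data of a map that enter the enumerations are invariant under isomorphisms. The codomain
  \<open>M'\<close> is arbitrary, so that its defining properties can be derived from those of \<open>M\<close>.
\<close>

locale smap_isomorphism =
  fixes \<phi> :: "'a \<Rightarrow> 'b" and M :: "'a smap" and M' :: "'b smap"
  assumes pre: "multirooted M" and iso: "smap_iso \<phi> M M'"
begin

lemma bij: "bij_betw \<phi> (oedges M) (oedges M')"
  using iso by (simp add: smap_iso_def)

lemma inj: "inj_on \<phi> (oedges M)" and im: "\<phi> ` oedges M = oedges M'"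
  using bij by (auto simp: bij_betw_def)

lemma fin: "finite (oedges M)"
  and p0: "sigma0 M permutes oedges M" and p1: "sigma1 M permutes oedges M"
  and p2: "sigma2 M permutes oedges M"
  using pre by (auto simp: multirooted_def)

lemma vertices_eq: "vertices M' = (`) \<phi> ` vertices M"
  unfolding vertices_def im[symmetric]
  by (rule cycles_image(2)[OF fin p0]) (use iso in \<open>simp add: smap_iso_def\<close>)

lemma edges_eq: "edges M' = (`) \<phi> ` edges M"
  unfolding edges_def im[symmetric]
  by (rule cycles_image(2)[OF fin p1]) (use iso in \<open>simp add: smap_iso_def\<close>)

lemma faces_eq: "cycles (oedges M') (sigma2 M') = (`) \<phi> ` cycles (oedges M) (sigma2 M)"
  unfolding im[symmetric]
  by (rule cycles_image(2)[OF fin p2]) (use iso in \<open>simp add: smap_iso_def\<close>)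

lemma face_orbit: "x \<in> oedges M \<Longrightarrow> orbit (sigma2 M') (\<phi> x) = \<phi> ` orbit (sigma2 M) x"
  by (rule cycles_image(1)[OF fin p2]) (use iso in \<open>simp_all add: smap_iso_def\<close>)

lemma roots_eq: "roots M' = map \<phi> (roots M)" and roots_sub: "set (roots M) \<subseteq> oedges M"
  using iso pre by (auto simp: smap_iso_def multirooted_def)

lemma parts_eq: "parts M' = (\<lambda>p. (`) \<phi> ` p) ` parts M"
  using iso by (simp add: smap_iso_def)

lemma inj_sets: "inj_on ((`) \<phi>) (Pow (oedges M))"
  by (rule inj_on_image_Pow[OF inj])

lemma cycle_subset: "f permutes oedges M \<Longrightarrow> cycles (oedges M) f \<subseteq> Pow (oedges M)"
  unfolding cycles_def by (intro image_subsetI PowI permutes_orbit_subset)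

lemma meets_roots: "c \<subseteq> oedges M \<Longrightarrow> \<phi> ` c \<inter> set (roots M') = {} \<longleftrightarrow> c \<inter> set (roots M) = {}"
proof -
  assume c: "c \<subseteq> oedges M"
  have "\<phi> ` c \<inter> set (roots M') = \<phi> ` (c \<inter> set (roots M))"
    unfolding roots_eq set_map using inj_on_image_Int[OF inj c roots_sub] by simp
  then show ?thesis by simp
qed

lemma rooted_eq: "rooted_cycles M' = (`) \<phi> ` rooted_cycles M"
  and unrooted_eq: "unrooted_cycles M' = (`) \<phi> ` unrooted_cycles M"
proof -
  have m: "\<phi> ` c \<inter> set (roots M') = {} \<longleftrightarrow> c \<inter> set (roots M) = {}"
    if "c \<in> cycles (oedges M) (sigma2 M)" for c
    by (rule meets_roots) (use cycle_subset[OF p2] that in blast)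
  show "rooted_cycles M' = (`) \<phi> ` rooted_cycles M"
    unfolding rooted_cycles_def faces_eq Compr_image_eq
    by (rule arg_cong[where f = "(`) ((`) \<phi>)"]) (use m in auto)
  show "unrooted_cycles M' = (`) \<phi> ` unrooted_cycles M"
    unfolding unrooted_cycles_def faces_eq Compr_image_eq
    by (rule arg_cong[where f = "(`) ((`) \<phi>)"]) (use m in auto)
qed

lemma boundary_eq: "boundary_edges M' = \<phi> ` boundary_edges M"
  unfolding boundary_edges_def rooted_eq by auto

lemma card_image_sub: "c \<subseteq> oedges M \<Longrightarrow> card (\<phi> ` c) = card c"
  by (rule card_image) (rule inj_on_subset[OF inj])

lemma degrees_eq: "boundary_degrees M' = boundary_degrees M"
proof (rule nth_equalityI)
  fix i assume "i < length (boundary_degrees M')"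
  then have i: "i < length (roots M)" by (simp add: boundary_degrees_def roots_eq)
  then have r: "roots M ! i \<in> oedges M" using roots_sub by auto
  show "boundary_degrees M' ! i = boundary_degrees M ! i"
    using i face_orbit[OF r] card_image_sub[OF permutes_orbit_subset[OF p2 r]]
    by (simp add: boundary_degrees_def roots_eq)
qed (simp add: boundary_degrees_def roots_eq)

lemma fully_simple_eq: "fully_simple M' \<longleftrightarrow> fully_simple M"
proof -
  have bsub: "boundary_edges M \<subseteq> oedges M"
    using cycle_subset[OF p2] by (auto simp: boundary_edges_def rooted_cycles_def)
  have "card {e \<in> \<phi> ` v. e \<in> boundary_edges M'} = card {e \<in> v. e \<in> boundary_edges M}"
    if v: "v \<in> vertices M" for v
  proof -
    have vs: "v \<subseteq> oedges M" using v cycle_subset[OF p0] by (auto simp: vertices_def)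
    have "{e \<in> \<phi> ` v. e \<in> boundary_edges M'} = \<phi> ` v \<inter> \<phi> ` boundary_edges M"
      by (auto simp: boundary_eq)
    also have "\<dots> = \<phi> ` (v \<inter> boundary_edges M)" using inj_on_image_Int[OF inj vs bsub] by simp
    finally have "card {e \<in> \<phi> ` v. e \<in> boundary_edges M'} = card (v \<inter> boundary_edges M)"
      using card_image_sub[of "v \<inter> boundary_edges M"] vs by (simp add: le_infI1)
    then show ?thesis by (simp only: Int_def)
  qed
  then show ?thesis unfolding fully_simple_def vertices_eq by simp
qed

lemma parts_sub: "p \<in> parts M \<Longrightarrow> p \<subseteq> Pow (oedges M)"
  using multirooted_parts_subset[OF pre] by blast

lemma inj_parts: "inj_on (\<lambda>p. (`) \<phi> ` p) (parts M)"
  using inj_on_subset[OF inj_on_image_Pow[OF inj_sets], of "parts M"] parts_sub by blast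

lemma genus_eq: "p \<in> parts M \<Longrightarrow> genus M' ((`) \<phi> ` p) = genus M p"
  using iso by (simp add: smap_iso_def)

lemma inj_part: "p \<in> parts M \<Longrightarrow> inj_on ((`) \<phi>) p"
  by (rule inj_on_subset[OF inj_sets parts_sub])

lemma face_monomial_eq: "face_monomial M' = face_monomial M"
proof -
  have type_eq: "image_mset card (mset_set ((`) \<phi> ` p)) = image_mset card (mset_set p)" if p: "p \<in> parts M" for p
  proof -
    have "image_mset card (mset_set ((`) \<phi> ` p)) = image_mset (\<lambda>c. card (\<phi> ` c)) (mset_set p)"
      by (simp add: image_mset_mset_set[OF inj_part[OF p], symmetric] image_mset.compositionality o_def)
    also have "\<dots> = image_mset card (mset_set p)"
      by (rule image_mset_cong)
        (use parts_sub[OF p] finite_parts(3)[OF pre p] card_image_sub in auto)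
    finally show ?thesis .
  qed
  have "face_monomial M' = image_mset (\<lambda>p. (genus M' ((`) \<phi> ` p), image_mset card (mset_set ((`) \<phi> ` p)))) (mset_set (parts M))"
    by (simp add: face_monomial_def parts_eq image_mset_mset_set[OF inj_parts, symmetric] image_mset.compositionality o_def)
  also have "\<dots> = face_monomial M"
    unfolding face_monomial_def
    by (rule image_mset_cong) (use finite_parts(2)[OF pre] type_eq genus_eq in auto)
  finally show ?thesis .
qed

lemma euler_char_eq: "euler_char M' = euler_char M"
proof -
  have "card (vertices M') = card (vertices M)"
    unfolding vertices_eq using cycle_subset[OF p0] by (auto simp: vertices_def intro!: card_image inj_on_subset[OF inj_sets])
  moreover have "card (edges M') = card (edges M)"
    unfolding edges_eq using cycle_subset[OF p1] by (auto simp: edges_def intro!: card_image inj_on_subset[OF inj_sets])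
  moreover have "(\<Sum>p\<in>parts M'. 2 - 2 * int (genus M' p) - int (card p)) =
    (\<Sum>p\<in>parts M. 2 - 2 * int (genus M p) - int (card p))"
    unfolding parts_eq sum.reindex[OF inj_parts]
    by (rule sum.cong) (simp_all add: genus_eq card_image[OF inj_part])
  ultimately show ?thesis unfolding euler_char_def by simp
qed

lemma partition: "partition_on (unrooted_cycles M') (parts M')"
proof -
  have "unrooted_cycles M \<subseteq> Pow (oedges M)" using cycle_subset[OF p2] by (auto simp: unrooted_cycles_def)
  then have "inj_on ((`) \<phi>) (unrooted_cycles M)" by (rule inj_on_subset[OF inj_sets])
  moreover have "partition_on (unrooted_cycles M) (parts M)" using pre by (simp add: multirooted_def)
  moreover from this have "{} \<notin> (\<lambda>p. (`) \<phi> ` p) ` parts M" using partition_onD3 by auto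
  ultimately show ?thesis unfolding unrooted_eq parts_eq
    using partition_on_inj_image[of "unrooted_cycles M" "parts M" "(`) \<phi>"] by simp
qed

lemma root_system_eq: "root_system (sigma2 M') (roots M') \<longleftrightarrow> root_system (sigma2 M) (roots M)"
proof -
  have "map (orbit (sigma2 M')) (roots M') = map ((`) \<phi>) (map (orbit (sigma2 M)) (roots M))"
    using roots_sub face_orbit by (auto simp: roots_eq)
  moreover have "inj_on ((`) \<phi>) (set (map (orbit (sigma2 M)) (roots M)))"
  proof (rule inj_on_subset[OF inj_sets])
    show "set (map (orbit (sigma2 M)) (roots M)) \<subseteq> Pow (oedges M)"
      unfolding set_map using roots_sub by (intro image_subsetI PowI permutes_orbit_subset[OF p2]) blast
  qed
  ultimately show ?thesis
    unfolding root_system_def by (metis distinct_map)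
qed

end

section \<open>Enumeration by labelled maps\<close>

lemma smap_iso_self: "smap_iso id M M"
  by (simp add: smap_iso_def)

lemma smap_iso_comp:
  assumes "multirooted M" "smap_iso \<phi> M M'" "smap_iso \<psi> M' M''"
  shows "smap_iso (\<psi> \<circ> \<phi>) M M''"
proof -
  interpret smap_isomorphism \<phi> M M' by unfold_locales fact+
  have i: "\<phi> e \<in> oedges M'" if "e \<in> oedges M" for e using im that by blast
  have pm: "(`) \<phi> ` p \<in> parts M'" if "p \<in> parts M" for p using parts_eq that by blast
  have im2: "(`) \<psi> ` (`) \<phi> ` p = (`) (\<psi> \<circ> \<phi>) ` p" for p by (auto simp: image_image)
  show ?thesis
    unfolding smap_iso_def
  proof (intro conjI ballI)
    show "bij_betw (\<psi> \<circ> \<phi>) (oedges M) (oedges M'')"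
      using bij assms(3) by (auto simp: smap_iso_def intro: bij_betw_trans)
    show "parts M'' = (\<lambda>p. (`) (\<psi> \<circ> \<phi>) ` p) ` parts M"
      using assms(3) by (auto simp: smap_iso_def parts_eq image_image)
    fix p assume p: "p \<in> parts M"
    have "genus M p = genus M' ((`) \<phi> ` p)" using genus_eq[OF p] by simp
    also have "\<dots> = genus M'' ((`) \<psi> ` (`) \<phi> ` p)" using assms(3) pm[OF p] by (simp add: smap_iso_def)
    finally show "genus M p = genus M'' ((`) (\<psi> \<circ> \<phi>) ` p)" unfolding im2 .
  qed (use assms(2,3) i in \<open>auto simp: smap_iso_def\<close>)
qed

lemma smap_iso_cong:
  assumes "multirooted M" "smap_iso \<phi> M M'" "\<And>e. e \<in> oedges M \<Longrightarrow> \<psi> e = \<phi> e"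
  shows "smap_iso \<psi> M M'"
proof -
  interpret smap_isomorphism \<phi> M M' by unfold_locales fact+
  have e: "\<psi> e = \<phi> e" if "e \<in> oedges M" for e using assms(3) that .
  have cyc: "\<psi> ` c = \<phi> ` c" if "c \<subseteq> oedges M" for c using e that by (intro image_cong) auto
  have pt: "(`) \<psi> ` p = (`) \<phi> ` p" if "p \<in> parts M" for p
    by (rule image_cong[OF refl], rule cyc) (use parts_sub[OF that] in blast)
  have in_s: "sigma0 M x \<in> oedges M" "sigma1 M x \<in> oedges M" "sigma2 M x \<in> oedges M" if "x \<in> oedges M" for x
    using that permutes_in_image[OF p0] permutes_in_image[OF p1] permutes_in_image[OF p2] by auto
  show ?thesis unfolding smap_iso_def
  proof (intro conjI ballI)
    show "bij_betw \<psi> (oedges M) (oedges M')" using bij e by (simp cong: bij_betw_cong)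
    show "roots M' = map \<psi> (roots M)" unfolding roots_eq using roots_sub e by (intro map_cong) auto
    show "parts M' = (\<lambda>p. (`) \<psi> ` p) ` parts M" unfolding parts_eq by (rule image_cong[OF refl]) (use pt in simp)
    fix p assume "p \<in> parts M"
    then show "genus M p = genus M' ((`) \<psi> ` p)" using pt genus_eq by simp
  qed (use assms(2) e in_s in \<open>simp_all add: smap_iso_def\<close>)
qed

lemma smap_iso_inverse:
  assumes "multirooted M" "smap_iso \<phi> M M'"
  shows "smap_iso (inv_into (oedges M) \<phi>) M' M"
proof -
  interpret smap_isomorphism \<phi> M M' by unfold_locales fact+
  let ?i = "inv_into (oedges M) \<phi>"
  have l: "?i (\<phi> e) = e" if "e \<in> oedges M" for e using inj that by simp
  have in_s: "sigma0 M x \<in> oedges M" "sigma1 M x \<in> oedges M" "sigma2 M x \<in> oedges M" if "x \<in> oedges M" for x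
    using that permutes_in_image[OF p0] permutes_in_image[OF p1] permutes_in_image[OF p2] by auto
  have step: "\<tau> (?i e) = ?i (\<tau>' e)"
    if cl: "\<And>x. x \<in> oedges M \<Longrightarrow> \<tau> x \<in> oedges M"
      and eqv: "\<And>x. x \<in> oedges M \<Longrightarrow> \<tau>' (\<phi> x) = \<phi> (\<tau> x)" and e: "e \<in> oedges M'" for \<tau> \<tau>' e
  proof -
    obtain x where x: "x \<in> oedges M" "e = \<phi> x" using e im by blast
    show ?thesis using cl[OF x(1)] eqv[OF x(1)] l x by simp
  qed
  have pt: "(`) ?i ` (`) \<phi> ` p = p" if "p \<in> parts M" for p
  proof -
    have "?i ` \<phi> ` c = c" if "c \<in> p" for c
      using parts_sub[OF \<open>p \<in> parts M\<close>] that by (intro inv_into_image_cancel[OF inj]) blast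
    then show ?thesis by (force simp: image_image)
  qed
  show ?thesis unfolding smap_iso_def
  proof (intro conjI ballI)
    show "bij_betw ?i (oedges M') (oedges M)" using bij by (rule bij_betw_inv_into)
    show "sigma0 M (?i e) = ?i (sigma0 M' e)" if "e \<in> oedges M'" for e
      by (rule step[OF in_s(1) _ that]) (use iso in \<open>auto simp: smap_iso_def\<close>)
    show "sigma1 M (?i e) = ?i (sigma1 M' e)" if "e \<in> oedges M'" for e
      by (rule step[OF in_s(2) _ that]) (use iso in \<open>auto simp: smap_iso_def\<close>)
    show "sigma2 M (?i e) = ?i (sigma2 M' e)" if "e \<in> oedges M'" for e
      by (rule step[OF in_s(3) _ that]) (use iso in \<open>auto simp: smap_iso_def\<close>)
    show "roots M = map ?i (roots M')"
      unfolding roots_eq map_map using roots_sub l by (intro map_idI[symmetric]) auto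
    have "(\<lambda>p. (`) ?i ` p) ` parts M' = (\<lambda>p. p) ` parts M"
      unfolding parts_eq image_image[of "\<lambda>p. (`) ?i ` p"] by (rule image_cong[OF refl]) (rule pt)
    then show "parts M = (\<lambda>p. (`) ?i ` p) ` parts M'" by simp
    fix q assume "q \<in> parts M'"
    then obtain p where "p \<in> parts M" "q = (`) \<phi> ` p" unfolding parts_eq by blast
    then show "genus M' q = genus M ((`) ?i ` q)" using pt genus_eq by simp
  qed
qed

definition relabel :: "('a \<Rightarrow> 'b) \<Rightarrow> 'a smap \<Rightarrow> 'b smap" where
  "relabel \<phi> M =
     (let E = oedges M; conj = (\<lambda>f x. if x \<in> \<phi> ` E then \<phi> (f (inv_into E \<phi> x)) else x)
      in \<lparr>oedges = \<phi> ` E, sigma0 = conj (sigma0 M), sigma1 = conj (sigma1 M), sigma2 = conj (sigma2 M),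
          roots = map \<phi> (roots M), parts = (\<lambda>p. (`) \<phi> ` p) ` parts M,
          genus = (\<lambda>q. if q \<in> (\<lambda>p. (`) \<phi> ` p) ` parts M
                       then genus M (inv_into (parts M) (\<lambda>p. (`) \<phi> ` p) q) else 0)\<rparr>)"

lemma smap_iso_relabel:
  assumes "multirooted M" "inj_on \<phi> (oedges M)"
  shows "smap_iso \<phi> M (relabel \<phi> M)"
proof -
  have "inj_on ((`) ((`) \<phi>)) (Pow (Pow (oedges M)))"
    by (intro inj_on_image_Pow assms(2))
  then have ip: "inj_on (\<lambda>p. (`) \<phi> ` p) (parts M)"
  proof (rule inj_on_subset)
    show "parts M \<subseteq> Pow (Pow (oedges M))" using multirooted_parts_subset(2)[OF assms(1)] by auto
  qed
  show ?thesis
    unfolding smap_iso_def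
  proof (intro conjI ballI)
    fix p assume "p \<in> parts M"
    then show "genus M p = genus (relabel \<phi> M) ((`) \<phi> ` p)"
      using inv_into_f_f[OF ip] by (simp add: relabel_def Let_def)
  qed (use assms(2) in \<open>auto simp: relabel_def Let_def bij_betw_def\<close>)
qed

lemma conj_permutes:
  assumes "f permutes A" "inj_on h A"
  shows "(\<lambda>x. if x \<in> h ` A then h (f (inv_into A h x)) else x) permutes (h ` A)" (is "?g permutes _")
proof (rule bij_imp_permutes)
  have h: "bij_betw h A (h ` A)" using assms(2) by (simp add: bij_betw_def)
  have "bij_betw (h \<circ> (f \<circ> inv_into A h)) (h ` A) (h ` A)"
    by (rule bij_betw_trans[OF bij_betw_trans[OF bij_betw_inv_into[OF h] permutes_imp_bij[OF assms(1)]] h])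
  then show "bij_betw ?g (h ` A) (h ` A)"
    by (subst bij_betw_cong[where g = "h \<circ> (f \<circ> inv_into A h)"]) auto
qed simp

lemma multirooted_relabel:
  assumes "multirooted M" "inj_on \<phi> (oedges M)"
  shows "multirooted (relabel \<phi> M)"
proof -
  let ?M = "relabel \<phi> M"
  interpret smap_isomorphism \<phi> M ?M by unfold_locales (use assms smap_iso_relabel in auto)
  have perm: "sigma0 ?M permutes oedges ?M" "sigma1 ?M permutes oedges ?M" "sigma2 ?M permutes oedges ?M"
    using conj_permutes[OF p0 assms(2)] conj_permutes[OF p1 assms(2)] conj_permutes[OF p2 assms(2)]
    by (simp_all add: relabel_def Let_def)
  have in_s: "sigma1 M x \<in> oedges M" "sigma2 M x \<in> oedges M" if "x \<in> oedges M" for x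
    using that permutes_in_image[OF p1] permutes_in_image[OF p2] by auto
  have eqv: "sigma0 ?M (\<phi> x) = \<phi> (sigma0 M x)" "sigma1 ?M (\<phi> x) = \<phi> (sigma1 M x)" "sigma2 ?M (\<phi> x) = \<phi> (sigma2 M x)"
    if "x \<in> oedges M" for x using iso that by (simp_all add: smap_iso_def)
  have ids: "sigma0 M (sigma1 M (sigma2 M x)) = x" for x
    using pre fun_cong[of _ _ x] unfolding multirooted_def by (metis comp_apply id_apply)
  have "sigma0 ?M (sigma1 ?M (sigma2 ?M y)) = y" for y
  proof (cases "y \<in> oedges ?M")
    case True
    then obtain x where "x \<in> oedges M" "y = \<phi> x" using im by blast
    then show ?thesis using eqv in_s ids by simp
  qed (use perm in \<open>simp add: permutes_not_in\<close>)
  then have "sigma0 ?M \<circ> sigma1 ?M \<circ> sigma2 ?M = id" by auto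
  moreover have "\<forall>e\<in>oedges ?M. sigma1 ?M e \<noteq> e \<and> sigma1 ?M (sigma1 ?M e) = e"
  proof
    fix e assume "e \<in> oedges ?M"
    then obtain x where x: "x \<in> oedges M" "e = \<phi> x" using im by blast
    then have "sigma1 M x \<noteq> x" "sigma1 M (sigma1 M x) = x" using pre by (auto simp: multirooted_def)
    then show "sigma1 ?M e \<noteq> e \<and> sigma1 ?M (sigma1 ?M e) = e"
      using x eqv in_s inj_on_eq_iff[OF inj] by simp
  qed
  moreover have "finite (oedges ?M)" using fin im by (metis finite_imageI)
  moreover have "set (roots ?M) \<subseteq> oedges ?M" using roots_sub im unfolding roots_eq by auto
  ultimately show ?thesis using perm partition unfolding multirooted_def by blast
qed

lemma stuffed_map_relabel:
  assumes "stuffed_map M" "inj_on \<phi> (oedges M)"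
  shows "stuffed_map (relabel \<phi> M)"
proof -
  interpret smap_isomorphism \<phi> M "relabel \<phi> M"
    by unfold_locales (use assms smap_iso_relabel in \<open>auto simp: stuffed_map_iff\<close>)
  have "multirooted (relabel \<phi> M)" by (rule multirooted_relabel[OF pre assms(2)])
  then show ?thesis using assms(1) root_system_eq by (simp add: stuffed_map_iff)
qed

text \<open>
  The values of \<open>genus\<close> outside \<open>parts\<close> do not matter for equivalence. Normalizing them to zero makes
  the number of maps on a given set of oriented edges finite, and makes an isomorphism determine its
  codomain.
\<close>

definition labelled_maps :: "nat \<Rightarrow> nat smap set" where
  "labelled_maps N = {M. stuffed_map M \<and> oedges M = {..<N} \<and> (\<forall>p. p \<notin> parts M \<longrightarrow> genus M p = 0)}"

lemma labelled_iso_unique: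
  assumes "multirooted M" "smap_iso \<phi> M M'" "smap_iso \<phi> M M''" "M' \<in> labelled_maps N" "M'' \<in> labelled_maps N"
  shows "M' = M''"
proof -
  interpret a: smap_isomorphism \<phi> M M' by unfold_locales fact+
  interpret b: smap_isomorphism \<phi> M M'' by unfold_locales fact+
  have o: "oedges M' = oedges M''" using assms(4,5) by (simp add: labelled_maps_def)
  have perm: "sigma0 M' permutes oedges M'" "sigma1 M' permutes oedges M'" "sigma2 M' permutes oedges M'"
    "sigma0 M'' permutes oedges M'" "sigma1 M'' permutes oedges M'" "sigma2 M'' permutes oedges M'"
    using assms(4,5) by (auto simp: labelled_maps_def stuffed_map_def)
  have ext: "f = g" if p: "f permutes oedges M'" "g permutes oedges M'"
      and eq: "\<And>x. x \<in> oedges M \<Longrightarrow> f (\<phi> x) = g (\<phi> x)" for f g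
  proof
    fix y show "f y = g y"
    proof (cases "y \<in> oedges M'")
      case True
      then obtain x where "x \<in> oedges M" "y = \<phi> x" using a.im by blast
      then show ?thesis using eq by simp
    qed (use p in \<open>simp add: permutes_not_in\<close>)
  qed
  have "sigma0 M' = sigma0 M''" "sigma1 M' = sigma1 M''" "sigma2 M' = sigma2 M''"
    by (rule ext[OF perm(1,4)] ext[OF perm(2,5)] ext[OF perm(3,6)],
      use assms(2,3) in \<open>simp add: smap_iso_def\<close>)+
  moreover have "parts M' = parts M''" using a.parts_eq b.parts_eq by simp
  moreover have "genus M' = genus M''"
  proof
    fix q show "genus M' q = genus M'' q"
    proof (cases "q \<in> parts M'")
      case True
      then obtain p where "p \<in> parts M" "q = (`) \<phi> ` p" using a.parts_eq by auto
      then show ?thesis using a.genus_eq b.genus_eq by simp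
    next
      case False
      then have "q \<notin> parts M''" using \<open>parts M' = parts M''\<close> by simp
      then show ?thesis using False assms(4,5) by (simp add: labelled_maps_def)
    qed
  qed
  moreover have "roots M' = roots M''" using a.roots_eq b.roots_eq by simp
  ultimately show ?thesis using o by (intro smap.equality) auto
qed

lemma relabel_labelled:
  assumes "stuffed_map M" "inj_on \<phi> (oedges M)" "\<phi> ` oedges M = {..<N}"
  shows "relabel \<phi> M \<in> labelled_maps N"
proof -
  have "oedges (relabel \<phi> M) = {..<N}" using assms(3) by (simp add: relabel_def Let_def)
  moreover have "\<forall>p. p \<notin> parts (relabel \<phi> M) \<longrightarrow> genus (relabel \<phi> M) p = 0"
    by (simp add: relabel_def Let_def)
  ultimately show ?thesis using stuffed_map_relabel[OF assms(1,2)] by (simp add: labelled_maps_def)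
qed

text \<open>
  An isomorphism has no prescribed values outside the set of oriented edges; \<^const>\<open>extensional\<close>
  makes it count only once.
\<close>

definition smap_isos :: "'a smap \<Rightarrow> 'b smap \<Rightarrow> ('a \<Rightarrow> 'b) set" where
  "smap_isos M M' = {\<phi> \<in> extensional (oedges M). smap_iso \<phi> M M'}"

text \<open>
  Composition with a fixed isomorphism turns automorphisms into isomorphisms.
\<close>

lemma card_smap_isos:
  assumes M: "multirooted M" and \<psi>: "smap_iso \<psi> M M'"
  shows "card (smap_isos M M') = card (smap_aut M)"
proof -
  interpret smap_isomorphism \<psi> M M' by unfold_locales fact+
  let ?E = "oedges M"
  have "bij_betw (\<lambda>\<alpha>. restrict (\<psi> \<circ> \<alpha>) ?E) (smap_aut M) (smap_isos M M')"
    unfolding bij_betw_def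
  proof
    show "inj_on (\<lambda>\<alpha>. restrict (\<psi> \<circ> \<alpha>) ?E) (smap_aut M)"
    proof (rule inj_onI, rule ext)
      fix \<alpha> \<beta> x assume a: "\<alpha> \<in> smap_aut M" "\<beta> \<in> smap_aut M" "restrict (\<psi> \<circ> \<alpha>) ?E = restrict (\<psi> \<circ> \<beta>) ?E"
      then have p: "\<alpha> permutes ?E" "\<beta> permutes ?E" by (auto simp: smap_aut_def)
      show "\<alpha> x = \<beta> x"
      proof (cases "x \<in> ?E")
        case True
        then have "\<psi> (\<alpha> x) = \<psi> (\<beta> x)" using fun_cong[OF a(3), of x] by simp
        then show ?thesis
          using True inj_onD[OF inj] permutes_in_image[OF p(1)] permutes_in_image[OF p(2)] by blast
      qed (use p in \<open>simp add: permutes_not_in\<close>)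
    qed
    show "(\<lambda>\<alpha>. restrict (\<psi> \<circ> \<alpha>) ?E) ` smap_aut M = smap_isos M M'"
    proof (intro set_eqI iffI)
      fix \<phi> assume "\<phi> \<in> (\<lambda>\<alpha>. restrict (\<psi> \<circ> \<alpha>) ?E) ` smap_aut M"
      then obtain \<alpha> where \<alpha>: "\<alpha> \<in> smap_aut M" "\<phi> = restrict (\<psi> \<circ> \<alpha>) ?E" by blast
      have "smap_iso (\<psi> \<circ> \<alpha>) M M'" using \<alpha>(1) by (intro smap_iso_comp[OF M _ \<psi>]) (simp add: smap_aut_def)
      then have "smap_iso \<phi> M M'" by (rule smap_iso_cong[OF M]) (simp add: \<alpha>(2))
      then show "\<phi> \<in> smap_isos M M'" by (simp add: smap_isos_def \<alpha>(2))
    next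
      fix \<phi> assume "\<phi> \<in> smap_isos M M'"
      then have \<phi>: "\<phi> \<in> extensional ?E" "smap_iso \<phi> M M'" by (auto simp: smap_isos_def)
      define \<alpha> where "\<alpha> = (\<lambda>x. if x \<in> ?E then inv_into ?E \<psi> (\<phi> x) else x)"
      have iso\<alpha>: "smap_iso \<alpha> M M"
        by (rule smap_iso_cong[OF M smap_iso_comp[OF M \<phi>(2) smap_iso_inverse[OF M \<psi>]]]) (simp add: \<alpha>_def)
      then have "bij_betw \<alpha> ?E ?E" by (simp add: smap_iso_def)
      then have "\<alpha> permutes ?E" by (rule bij_imp_permutes) (simp add: \<alpha>_def)
      then have "\<alpha> \<in> smap_aut M" using iso\<alpha> by (simp add: smap_aut_def)
      moreover have "\<phi> = restrict (\<psi> \<circ> \<alpha>) ?E"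
      proof
        fix x show "\<phi> x = restrict (\<psi> \<circ> \<alpha>) ?E x"
        proof (cases "x \<in> ?E")
          case True
          then have "\<phi> x \<in> \<psi> ` ?E" using \<phi>(2) im by (auto simp: smap_iso_def bij_betw_def)
          then show ?thesis using True f_inv_into_f by (simp add: \<alpha>_def f_inv_into_f)
        qed (use \<phi>(1) in \<open>simp add: extensional_def\<close>)
      qed
      ultimately show "\<phi> \<in> (\<lambda>\<alpha>. restrict (\<psi> \<circ> \<alpha>) ?E) ` smap_aut M" by blast
    qed
  qed
  then show ?thesis by (simp add: bij_betw_same_card)
qed

lemma prod_falling_fact: "(\<Prod>i<n. n - i) = (fact n :: nat)"
  by (simp add: fact_prod_rev atLeast0LessThan)

text \<open>
  Each of the \<open>fact N\<close> bijections from the oriented edges to \<open>{..<N}\<close> is an isomorphism to exactly one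
  labelled map, and each labelled map in the class is obtained from as many bijections as there are
  automorphisms.
\<close>

lemma card_labelled_class:
  assumes M: "stuffed_map M" and N: "card (oedges M) = N"
  shows "card {M' \<in> labelled_maps N. \<exists>\<phi>. smap_iso \<phi> M M'} * card (smap_aut M) = fact N"
proof -
  let ?E = "oedges M" and ?L = "{M' \<in> labelled_maps N. \<exists>\<phi>. smap_iso \<phi> M M'}"
  let ?P = "{\<phi> \<in> ?E \<rightarrow>\<^sub>E {..<N}. inj_on \<phi> ?E}"
  have pre: "multirooted M" using M by (simp add: stuffed_map_iff)
  have fin: "finite ?E" using pre by (simp add: multirooted_def)
  have im: "\<phi> ` ?E = {..<N}" if "\<phi> \<in> ?P" for \<phi>
  proof (rule card_subset_eq)
    show "\<phi> ` ?E \<subseteq> {..<N}" using that by (auto simp: PiE_def)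
    show "card (\<phi> ` ?E) = card {..<N}" using that N by (simp add: card_image)
  qed simp
  have cP: "card ?P = fact N"
    using card_inj_on_subset_funcset[OF fin finite_lessThan subset_refl, of N] N
    by (simp add: atLeast0LessThan prod_falling_fact)
  have fP: "finite ?P" using fin by (simp add: finite_PiE)
  have UN: "?P = (\<Union>M'\<in>?L. smap_isos M M')"
  proof (intro set_eqI iffI)
    fix \<phi> assume \<phi>: "\<phi> \<in> ?P"
    have "smap_iso \<phi> M (relabel \<phi> M)" using \<phi> by (intro smap_iso_relabel pre) simp
    moreover have "relabel \<phi> M \<in> labelled_maps N" using \<phi> im[OF \<phi>] by (intro relabel_labelled M) simp_all
    moreover have "\<phi> \<in> extensional ?E" using \<phi> by (simp add: PiE_def)
    ultimately show "\<phi> \<in> (\<Union>M'\<in>?L. smap_isos M M')" unfolding smap_isos_def by blast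
  next
    fix \<phi> assume "\<phi> \<in> (\<Union>M'\<in>?L. smap_isos M M')"
    then obtain M' where "M' \<in> labelled_maps N" "\<phi> \<in> extensional ?E" "smap_iso \<phi> M M'"
      by (auto simp: smap_isos_def)
    then show "\<phi> \<in> ?P" by (auto simp: labelled_maps_def smap_iso_def bij_betw_def PiE_def)
  qed
  have finL: "finite ?L"
  proof (rule finite_surj[OF fP])
    show "?L \<subseteq> (\<lambda>\<phi>. relabel \<phi> M) ` ?P"
    proof
      fix M' assume M': "M' \<in> ?L"
      then obtain \<psi> where "smap_iso \<psi> M M'" by blast
      then have iso: "smap_iso (restrict \<psi> ?E) M M'" by (rule smap_iso_cong[OF pre]) simp
      then have \<phi>: "restrict \<psi> ?E \<in> ?P" using M' unfolding UN smap_isos_def by auto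
      have "smap_iso (restrict \<psi> ?E) M (relabel (restrict \<psi> ?E) M)" using \<phi> by (intro smap_iso_relabel pre) simp
      moreover have "relabel (restrict \<psi> ?E) M \<in> labelled_maps N"
        using \<phi> im[OF \<phi>] by (intro relabel_labelled M) simp_all
      ultimately have "M' = relabel (restrict \<psi> ?E) M" using labelled_iso_unique[OF pre iso] M' by blast
      then show "M' \<in> (\<lambda>\<phi>. relabel \<phi> M) ` ?P" using \<phi> by blast
    qed
  qed
  have "fact N = card (\<Union>M'\<in>?L. smap_isos M M')" using cP UN by simp
  also have "\<dots> = (\<Sum>M'\<in>?L. card (smap_isos M M'))"
  proof (rule card_UN_disjoint[OF finL])
    show "\<forall>M'\<in>?L. finite (smap_isos M M')" using fP UN by (metis (no_types, lifting) UN_upper finite_subset)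
    show "\<forall>M'\<in>?L. \<forall>M''\<in>?L. M' \<noteq> M'' \<longrightarrow> smap_isos M M' \<inter> smap_isos M M'' = {}"
      using labelled_iso_unique[OF pre] unfolding smap_isos_def by blast
  qed
  also have "\<dots> = (\<Sum>M'\<in>?L. card (smap_aut M))"
    by (rule sum.cong[OF refl]) (use card_smap_isos[OF pre] in blast)
  finally show ?thesis by simp
qed

text \<open>
  The boundary components of all faces partition the oriented edges. Hence only finitely many maps contribute to a coefficient,
  all with the same number of oriented edges.
\<close>

lemma card_oedges:
  assumes "stuffed_map M"
  shows "card (oedges M) = sum_list (boundary_degrees M) + (\<Sum>(g, l)\<in>#face_monomial M. sum_mset l)"
proof -
  have pre: "multirooted M" and rs: "root_system (sigma2 M) (roots M)" using assms by (auto simp: stuffed_map_iff)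
  have A: "finite (oedges M)" "sigma2 M permutes oedges M" and part: "partition_on (unrooted_cycles M) (parts M)"
    and r: "set (roots M) \<subseteq> oedges M"
    using pre by (auto simp: multirooted_def)
  let ?C = "cycles (oedges M) (sigma2 M)"
  have finC: "finite ?C" by (rule finite_cycles[OF A(1)])
  have rooted: "rooted_cycles M = set (map (orbit (sigma2 M)) (roots M))"
    using cycles_meeting[OF A r] by (simp add: rooted_cycles_def)
  have "card (oedges M) = (\<Sum>c\<in>?C. card c)"
    using sum_cycle_type[OF A] by (simp add: cycle_type_def sum_unfold_sum_mset)
  also have "?C = rooted_cycles M \<union> unrooted_cycles M"
    by (auto simp: rooted_cycles_def unrooted_cycles_def)
  also have "(\<Sum>c\<in>rooted_cycles M \<union> unrooted_cycles M. card c)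
      = (\<Sum>c\<in>rooted_cycles M. card c) + (\<Sum>c\<in>unrooted_cycles M. card c)"
    by (rule sum.union_disjoint) (use finC in \<open>auto simp: rooted_cycles_def unrooted_cycles_def\<close>)
  also have "(\<Sum>c\<in>rooted_cycles M. card c) = sum_list (boundary_degrees M)"
    using sum_list_distinct_conv_sum_set[of "map (orbit (sigma2 M)) (roots M)" card] rs
    unfolding rooted root_system_def by (simp add: boundary_degrees_def o_def)
  also have "(\<Sum>c\<in>unrooted_cycles M. card c) = (\<Sum>p\<in>parts M. \<Sum>c\<in>p. card c)"
    unfolding partition_onD1[OF part]
  proof (rule sum.Union_disjoint[THEN trans])
    show "\<forall>p\<in>parts M. finite p" using finite_parts(3)[OF pre] by blast
    show "\<forall>p\<in>parts M. \<forall>q\<in>parts M. p \<noteq> q \<longrightarrow> p \<inter> q = {}"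
      using partition_onD2[OF part] by (auto simp: disjoint_def)
  qed simp
  also have "\<dots> = (\<Sum>(g, l)\<in>#face_monomial M. sum_mset l)"
    by (simp add: face_monomial_def image_mset.compositionality o_def sum_unfold_sum_mset)
  finally show ?thesis .
qed

lemma finite_labelled_maps:
  "finite {M \<in> labelled_maps N. face_monomial M = m}" (is "finite ?L")
proof -
  let ?E = "{..<N}"
  let ?P = "{f. f permutes ?E}"
  let ?H = "{h. \<forall>x. (x \<in> Pow (Pow ?E) \<longrightarrow> h x \<in> insert 0 (fst ` set_mset m)) \<and> (x \<notin> Pow (Pow ?E) \<longrightarrow> h x = (0::nat))}"
  let ?t = "\<lambda>M. (sigma0 M, sigma1 M, sigma2 M, roots M, parts M, genus M)"
  have fin: "finite (?P \<times> ?P \<times> ?P \<times> {xs. set xs \<subseteq> ?E \<and> length xs \<le> N} \<times> Pow (Pow (Pow ?E)) \<times> ?H)"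
    by (intro finite_cartesian_product finite_permutations finite_lists_length_le
      finite_set_of_finite_funs finite_Pow_iff[THEN iffD2]) auto
  have inj: "inj_on ?t ?L"
    by (rule inj_onI) (auto simp: labelled_maps_def intro: smap.equality)
  have "?t ` ?L \<subseteq> ?P \<times> ?P \<times> ?P \<times> {xs. set xs \<subseteq> ?E \<and> length xs \<le> N} \<times> Pow (Pow (Pow ?E)) \<times> ?H"
  proof (rule image_subsetI)
    fix M assume M: "M \<in> ?L"
    then have st: "stuffed_map M" "oedges M = ?E" by (auto simp: labelled_maps_def)
    then have pre: "multirooted M" and rs: "root_system (sigma2 M) (roots M)" by (auto simp: stuffed_map_iff)
    have "distinct (roots M)" using rs unfolding root_system_def distinct_map by blast
    then have len: "length (roots M) \<le> N"
      using pre st(2) card_mono[of ?E "set (roots M)"] by (simp add: multirooted_def distinct_card)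
    have sub: "parts M \<in> Pow (Pow (Pow ?E))"
      using multirooted_parts_subset(2)[OF pre] st(2) by auto
    \<comment> \<open>The monomial bounds the genera.\<close>
    have "genus M \<in> ?H"
    proof (intro CollectI allI conjI impI)
      fix p
      show "genus M p \<in> insert 0 (fst ` set_mset m)"
      proof (cases "p \<in> parts M")
        case True
        then have "(genus M p, image_mset card (mset_set p)) \<in># m"
          using M finite_parts(2)[OF pre] by (auto simp: face_monomial_def)
        then show ?thesis by force
      qed (use M in \<open>auto simp: labelled_maps_def\<close>)
      assume "p \<notin> Pow (Pow ?E)"
      then have "p \<notin> parts M" using sub by blast
      then show "genus M p = 0" using M by (simp add: labelled_maps_def)
    qed
    then show "?t M \<in> ?P \<times> ?P \<times> ?P \<times> {xs. set xs \<subseteq> ?E \<and> length xs \<le> N} \<times> Pow (Pow (Pow ?E)) \<times> ?H"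
      using pre st(2) len sub by (simp add: multirooted_def)
  qed
  then have "finite (?t ` ?L)" using fin by (rule finite_subset)
  then show ?thesis using inj by (rule finite_imageD)
qed

lemma equiv_smap_equiv: "equiv {M. stuffed_map M} smap_equiv"
proof (rule equivI)
  show "smap_equiv \<subseteq> {M. stuffed_map M} \<times> {M. stuffed_map M}" by (auto simp: smap_equiv_def)
  show "refl_on {M. stuffed_map M} smap_equiv"
    using smap_iso_self by (auto simp: smap_equiv_def refl_on_def)
  show "sym smap_equiv"
    using smap_iso_inverse by (auto simp: smap_equiv_def sym_def stuffed_map_iff)
  show "trans smap_equiv"
    by (rule transI) (auto simp: smap_equiv_def stuffed_map_iff intro: smap_iso_comp)
qed

text \<open>
  The class of \<open>M\<close> contains \<open>fact N / card (smap_aut M)\<close> labelled maps, so dividing the number of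
  labelled maps by \<open>fact N\<close> weights the class by the inverse of its number of automorphisms.
\<close>

lemma smap_enum_labelled:
  assumes S: "\<And>M. M \<in> S \<Longrightarrow> stuffed_map M"
    and closed: "\<And>M M' \<phi>. M \<in> S \<Longrightarrow> stuffed_map M' \<Longrightarrow> smap_iso \<phi> M M' \<Longrightarrow> M' \<in> S"
    and N: "\<And>M. M \<in> S \<Longrightarrow> face_monomial M = m \<Longrightarrow> card (oedges M) = N"
  shows "smap_enum S m = Poly_Mapping.single 0 (1 / fact N) *
    (\<Sum>M | M \<in> labelled_maps N \<and> M \<in> S \<and> face_monomial M = m. Poly_Mapping.single (- euler_char M) 1)"
proof -
  let ?S = "{M \<in> S. face_monomial M = m}"
  let ?L = "{M. M \<in> labelled_maps N \<and> M \<in> S \<and> face_monomial M = m}"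
  let ?g = "\<lambda>M. smap_equiv `` {M}"
  let ?w = "\<lambda>M. Poly_Mapping.single (- euler_char M) 1 :: laurent"
  have finL: "finite ?L" by (rule finite_subset[OF _ finite_labelled_maps[of N m]]) auto
  have closed': "M' \<in> ?S \<and> euler_char M' = euler_char M" if "M \<in> ?S" "(M, M') \<in> smap_equiv" for M M'
  proof -
    from that(2) obtain \<phi> where \<phi>: "stuffed_map M" "stuffed_map M'" "smap_iso \<phi> M M'" by (auto simp: smap_equiv_def)
    then interpret smap_isomorphism \<phi> M M' by unfold_locales (auto simp: stuffed_map_iff)
    show ?thesis using that(1) closed[OF _ \<phi>(2,3)] face_monomial_eq euler_char_eq by simp
  qed
  have geq: "?g M = ?g M' \<longleftrightarrow> (M, M') \<in> smap_equiv" if "stuffed_map M'" for M M'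
    using eq_equiv_class[OF _ equiv_smap_equiv, of M M'] equiv_class_eq[OF equiv_smap_equiv, of M M'] that by blast
  have Q: "?S // smap_equiv = ?g ` ?L"
  proof
    show "?g ` ?L \<subseteq> ?S // smap_equiv" by (auto simp: quotient_def)
    show "?S // smap_equiv \<subseteq> ?g ` ?L"
    proof
      fix C assume "C \<in> ?S // smap_equiv"
      then obtain M where M: "M \<in> ?S" "C = ?g M" by (auto simp: quotient_def)
      then have st: "stuffed_map M" and fin: "finite (oedges M)" using S by (auto simp: stuffed_map_def)
      have "card (oedges M) = card {..<N}" using M N by simp
      then obtain \<phi> where \<phi>: "bij_betw \<phi> (oedges M) {..<N}"
        using finite_same_card_bij[OF fin finite_lessThan] by blast
      then have inj: "inj_on \<phi> (oedges M)" "\<phi> ` oedges M = {..<N}" by (auto simp: bij_betw_def)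
      let ?M = "relabel \<phi> M"
      have "?M \<in> labelled_maps N" by (rule relabel_labelled[OF st inj])
      moreover have eqv: "(M, ?M) \<in> smap_equiv"
        using st stuffed_map_relabel[OF st inj(1)] smap_iso_relabel[OF _ inj(1)]
        by (auto simp: smap_equiv_def stuffed_map_iff)
      ultimately have "?M \<in> ?L" using closed'[OF M(1)] by simp
      moreover have "C = ?g ?M" using equiv_class_eq[OF equiv_smap_equiv eqv] M(2) by simp
      ultimately show "C \<in> ?g ` ?L" by blast
    qed
  qed
  have fibre: "Poly_Mapping.single 0 (1 / fact N) * sum ?w {M \<in> ?L. ?g M = C} = smap_weight (SOME M. M \<in> C)"
    if C: "C \<in> ?g ` ?L" for C
  proof -
    from C obtain M0 where M0: "M0 \<in> ?L" "C = ?g M0" by blast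
    define R where "R = (SOME M. M \<in> C)"
    have "M0 \<in> C" using M0 S equiv_class_self[OF equiv_smap_equiv] by simp
    then have "R \<in> C" unfolding R_def by (rule someI)
    then have eqv: "(M0, R) \<in> smap_equiv" using M0(2) by simp
    have M0S: "M0 \<in> ?S" using M0(1) by simp
    have R: "R \<in> ?S" "C = ?g R"
      using closed'[OF M0S eqv] equiv_class_eq[OF equiv_smap_equiv eqv] M0(2) by simp_all
    then have st: "stuffed_map R" and NR: "card (oedges R) = N" using S N by auto
    let ?K = "{M' \<in> labelled_maps N. \<exists>\<phi>. smap_iso \<phi> R M'}"
    have K: "M' \<in> ?K \<longleftrightarrow> M' \<in> labelled_maps N \<and> (R, M') \<in> smap_equiv" for M'
      using st by (auto simp: smap_equiv_def labelled_maps_def)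
    have "{M \<in> ?L. ?g M = C} = ?K"
    proof (intro set_eqI iffI)
      fix M assume M: "M \<in> {M \<in> ?L. ?g M = C}"
      then have "(R, M) \<in> smap_equiv" using geq[of M R] R(2) S by auto
      then show "M \<in> ?K" using M K by simp
    next
      fix M assume "M \<in> ?K"
      then have M: "M \<in> labelled_maps N" "(R, M) \<in> smap_equiv" using K by auto
      then have "M \<in> ?S" using closed'[OF R(1)] by blast
      moreover from this have "?g M = C" using geq[of M R] R(2) S M(2) by auto
      ultimately show "M \<in> {M \<in> ?L. ?g M = C}" using M(1) by simp
    qed
    then have "sum ?w {M \<in> ?L. ?g M = C} = sum ?w ?K" by simp
    also have "\<dots> = (\<Sum>M\<in>?K. ?w R)"
      by (rule sum.cong[OF refl]) (use K closed'[OF R(1)] in auto)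
    also have "\<dots> = Poly_Mapping.single 0 (of_nat (card ?K)) * ?w R" by simp
    finally have "Poly_Mapping.single 0 (1 / fact N) * sum ?w {M \<in> ?L. ?g M = C}
      = Poly_Mapping.single (- euler_char R) (of_nat (card ?K) / fact N)"
      by (simp add: mult_single del: single_of_nat flip: mult.assoc)
    moreover have "of_nat (card ?K) / fact N = (1 / of_nat (card (smap_aut R)) :: rat)"
    proof -
      have c: "card ?K * card (smap_aut R) = fact N" by (rule card_labelled_class[OF st NR])
      then have "of_nat (card ?K) * of_nat (card (smap_aut R)) = (fact N :: rat)"
        by (metis of_nat_fact of_nat_mult)
      moreover have "card (smap_aut R) \<noteq> 0" using c by (metis fact_nonzero mult_0_right)
      ultimately show ?thesis by (simp add: divide_simps)
    qed
    ultimately show ?thesis by (simp add: smap_weight_def R_def)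
  qed
  have "smap_enum S m = (\<Sum>C\<in>?g ` ?L. smap_weight (SOME M. M \<in> C))"
    by (simp only: smap_enum_def Q)
  also have "\<dots> = (\<Sum>C\<in>?g ` ?L. Poly_Mapping.single 0 (1 / fact N) * sum ?w {M \<in> ?L. ?g M = C})"
    by (rule sum.cong[OF refl]) (rule fibre[symmetric])
  also have "\<dots> = Poly_Mapping.single 0 (1 / fact N) * (\<Sum>C\<in>?g ` ?L. sum ?w {M \<in> ?L. ?g M = C})"
    by (rule sum_distrib_left[symmetric])
  also have "(\<Sum>C\<in>?g ` ?L. sum ?w {M \<in> ?L. ?g M = C}) = sum ?w ?L"
    by (rule sum.group[OF finL finite_imageI[OF finL] subset_refl])
  finally show ?thesis .
qed

section \<open>Maps with numbered boundary edges\<close>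

text \<open>
  Which faces are internal, and so which edges are boundary edges, depends on the roots only through
  the set of faces that contain one.
\<close>

lemma reroot:
  assumes pre: "multirooted M" and r: "set r \<subseteq> oedges M"
    and touch: "\<And>c. c \<in> cycles (oedges M) (sigma2 M) \<Longrightarrow> c \<inter> set r = {} \<longleftrightarrow> c \<inter> set (roots M) = {}"
  shows "multirooted (M\<lparr>roots := r\<rparr>)" "boundary_edges (M\<lparr>roots := r\<rparr>) = boundary_edges M"
    "fully_simple (M\<lparr>roots := r\<rparr>) \<longleftrightarrow> fully_simple M"
proof -
  have u: "unrooted_cycles (M\<lparr>roots := r\<rparr>) = unrooted_cycles M"
    using touch by (auto simp: unrooted_cycles_def)
  have "rooted_cycles (M\<lparr>roots := r\<rparr>) = rooted_cycles M"
    using touch by (auto simp: rooted_cycles_def)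
  then show b: "boundary_edges (M\<lparr>roots := r\<rparr>) = boundary_edges M" by (simp add: boundary_edges_def)
  show "multirooted (M\<lparr>roots := r\<rparr>)" using pre r u by (simp add: multirooted_def)
  show "fully_simple (M\<lparr>roots := r\<rparr>) \<longleftrightarrow> fully_simple M"
    by (simp add: fully_simple_def b) (simp add: vertices_def)
qed

lemma reroot_simps:
  "face_monomial (M\<lparr>roots := r\<rparr>) = face_monomial M" "euler_char (M\<lparr>roots := r\<rparr>) = euler_char M"
  by (simp_all add: face_monomial_def euler_char_def vertices_def edges_def)

lemma cycle_touch:
  assumes A: "finite A" "f permutes A" and c: "c \<in> cycles A f" and U: "R \<subseteq> U" "U \<subseteq> \<Union>(orbit f ` R)"
  shows "c \<inter> U = {} \<longleftrightarrow> c \<inter> R = {}"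
proof -
  from c obtain a where a: "c = orbit f a" by (auto simp: cycles_def)
  have "c \<inter> R \<noteq> {}" if "c \<inter> U \<noteq> {}"
  proof -
    from that obtain x y where x: "x \<in> orbit f a" "y \<in> R" "x \<in> orbit f y" using U(2) a by blast
    have "orbit f y = c" using orbit_eq[OF A x(1)] orbit_eq[OF A x(3)] a by simp
    then have "y \<in> c" using self_in_orbit[OF A, of y] by simp
    then show ?thesis using x(2) by blast
  qed
  then show ?thesis using U(1) by blast
qed

text \<open>
  The numbers start at \<open>1\<close>, as do the points permuted in \<^const>\<open>hurwitz_tuples\<close>, but list positions
  start at \<open>0\<close>.
\<close>

definition mark :: "'a smap \<Rightarrow> nat \<Rightarrow> 'a" where
  "mark M i = roots M ! (i - 1)"

text \<open>
  Labelled maps in which all \<open>d\<close> boundary edges are listed as roots, and which have the boundary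
  permutation \<open>\<rho>\<close> in this numbering.
\<close>

definition marked_maps :: "nat \<Rightarrow> nat \<Rightarrow> (nat \<Rightarrow> nat) \<Rightarrow> nat smap set" where
  "marked_maps N d \<rho> = {M. multirooted M \<and> oedges M = {..<N} \<and> (\<forall>p. p \<notin> parts M \<longrightarrow> genus M p = 0) \<and>
     length (roots M) = d \<and> distinct (roots M) \<and> (\<forall>i\<in>{1..d}. sigma2 M (mark M i) = mark M (\<rho> i))}"

locale marked_map =
  fixes N d :: nat and \<rho> :: "nat \<Rightarrow> nat" and M :: "nat smap"
  assumes marked: "M \<in> marked_maps N d \<rho>" and perm: "\<rho> permutes {1..d}"
begin

lemma pre: "multirooted M" and oe: "oedges M = {..<N}" and norm: "p \<notin> parts M \<Longrightarrow> genus M p = 0"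
  and len: "length (roots M) = d" and dist: "distinct (roots M)"
  and equivar: "i \<in> {1..d} \<Longrightarrow> sigma2 M (mark M i) = mark M (\<rho> i)"
  using marked by (auto simp: marked_maps_def)

lemma fin: "finite (oedges M)"
  and p0: "sigma0 M permutes oedges M" and p1: "sigma1 M permutes oedges M"
  and p2: "sigma2 M permutes oedges M" and roots_sub: "set (roots M) \<subseteq> oedges M"
  using pre by (auto simp: multirooted_def)

lemma mark_bij: "bij_betw (mark M) {1..d} (set (roots M))"
proof -
  have "bij_betw (\<lambda>i. i - 1) {1..d} {..<d}"
    by (rule bij_betw_byWitness[where f' = Suc]) auto
  from bij_betw_trans[OF this bij_betw_nth[OF dist]] len
  show ?thesis by (simp add: mark_def[abs_def] o_def)
qed

lemma mark_inj: "inj_on (mark M) {1..d}" and mark_im: "mark M ` {1..d} = set (roots M)"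
  using mark_bij by (auto simp: bij_betw_def)

lemma roots_mark: "roots M = map (mark M) [1..<Suc d]"
  by (rule nth_equalityI) (simp_all add: len mark_def del: upt_Suc)

lemma mark_orbit: "i \<in> {1..d} \<Longrightarrow> orbit (sigma2 M) (mark M i) = mark M ` orbit \<rho> i"
  by (rule cycles_image(1)[OF _ perm]) (auto simp: equivar)

lemma face_closed: "x \<in> set (roots M) \<Longrightarrow> orbit (sigma2 M) x \<subseteq> set (roots M)"
proof -
  assume "x \<in> set (roots M)"
  then obtain i where i: "i \<in> {1..d}" "x = mark M i" using mark_im by blast
  show ?thesis unfolding i(2) mark_orbit[OF i(1)] mark_im[symmetric]
    by (rule image_mono) (rule permutes_orbit_subset[OF perm i(1)])
qed

lemma boundary: "boundary_edges M = set (roots M)"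
proof -
  have "rooted_cycles M = orbit (sigma2 M) ` set (roots M)"
    using cycles_meeting[OF fin p2 roots_sub] by (simp add: rooted_cycles_def)
  then have "boundary_edges M = (\<Union>x\<in>set (roots M). orbit (sigma2 M) x)"
    by (simp add: boundary_edges_def)
  also have "\<dots> = set (roots M)"
  proof
    show "(\<Union>x\<in>set (roots M). orbit (sigma2 M) x) \<subseteq> set (roots M)" by (rule UN_least) (rule face_closed)
    show "set (roots M) \<subseteq> (\<Union>x\<in>set (roots M). orbit (sigma2 M) x)"
      by (rule subsetI, rule UN_I) (auto intro: self_in_orbit[OF fin p2])
  qed
  finally show ?thesis .
qed

end

lemma fully_simple_iff:
  assumes "multirooted M"
  shows "fully_simple M \<longleftrightarrow> simple_on (sigma0 M) (boundary_edges M)"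
proof
  have fin: "finite (oedges M)" and p0: "sigma0 M permutes oedges M" and p2: "sigma2 M permutes oedges M"
    using assms by (auto simp: multirooted_def)
  have bsub: "boundary_edges M \<subseteq> oedges M"
    using Union_cycles[OF fin p2] by (auto simp: boundary_edges_def rooted_cycles_def)
  have finv: "finite v" if "v \<in> vertices M" for v
    using that Union_cycles[OF fin p0] fin finite_subset[of v "oedges M"] unfolding vertices_def by blast
  show "simple_on (sigma0 M) (boundary_edges M)" if fs: "fully_simple M"
    unfolding simple_on_def
  proof (intro ballI subsetI)
    fix b x assume b: "b \<in> boundary_edges M" and x: "x \<in> orbit (sigma0 M) b \<inter> boundary_edges M"
    let ?v = "orbit (sigma0 M) b"
    have v: "?v \<in> vertices M" using b bsub by (auto simp: vertices_def cycles_def)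
    then have "card {e \<in> ?v. e \<in> boundary_edges M} \<le> 1" using fs by (simp add: fully_simple_def)
    moreover have "finite {e \<in> ?v. e \<in> boundary_edges M}" using finv[OF v] by simp
    moreover have "{b, x} \<subseteq> {e \<in> ?v. e \<in> boundary_edges M}" using b x self_in_orbit[OF fin p0, of b] by blast
    ultimately have "card {b, x} \<le> 1" using card_mono order_trans by metis
    then show "x \<in> {b}" by (cases "x = b") auto
  qed
  show "fully_simple M" if s: "simple_on (sigma0 M) (boundary_edges M)"
    unfolding fully_simple_def
  proof
    fix v assume v: "v \<in> vertices M"
    then obtain a where a: "v = orbit (sigma0 M) a" by (auto simp: vertices_def cycles_def)
    have "x = y" if xy: "x \<in> v" "x \<in> boundary_edges M" "y \<in> v" "y \<in> boundary_edges M" for x y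
    proof -
      have "orbit (sigma0 M) y = v" using orbit_eq[OF fin p0] xy(3) a by blast
      then show ?thesis using s xy unfolding simple_on_def by blast
    qed
    then show "card {e \<in> v. e \<in> boundary_edges M} \<le> 1"
      using finv[OF v] by (simp add: card_le_Suc0_iff_eq)
  qed
qed

text \<open>
  If \<open>s\<close> is a system of roots for \<open>\<rho>\<close>, a numbering of the boundary edges is determined by the edges
  with numbers in \<open>s\<close>, and these can be any roots of the same degrees.
\<close>

lemma choose_roots:
  assumes \<rho>: "\<rho> permutes {1..d}" and s: "set s \<subseteq> {1..d}" "root_system \<rho> s" "degrees \<rho> s = lam"
    and sum: "sum_list lam = d"
  shows "bij_betw (\<lambda>M. M\<lparr>roots := map (mark M) s\<rparr>) (marked_maps N d \<rho>)
      {M \<in> labelled_maps N. boundary_degrees M = lam}"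
    and "M \<in> marked_maps N d \<rho> \<Longrightarrow> fully_simple (M\<lparr>roots := map (mark M) s\<rparr>) \<longleftrightarrow> fully_simple M"
proof -
  let ?F = "\<lambda>M. M\<lparr>roots := map (mark M) s\<rparr>"
  let ?T = "{M \<in> labelled_maps N. boundary_degrees M = lam}"
  have cov: "\<Union>(orbit \<rho> ` set s) = {1..d}" using \<rho> s sum by (intro root_system_covers) auto
  have A: "finite {1..d}" by simp
  have F: "?F M \<in> ?T \<and> (fully_simple (?F M) \<longleftrightarrow> fully_simple M)" if "M \<in> marked_maps N d \<rho>" for M
  proof -
    interpret marked_map N d \<rho> M by unfold_locales (use that \<rho> in auto)
    have s1: "x \<in> {1..d}" if "x \<in> set s" for x using that s(1) by blast
    have sub: "set (map (mark M) s) \<subseteq> set (roots M)" using s(1) mark_im by auto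
    have cover: "set (roots M) \<subseteq> \<Union>(orbit (sigma2 M) ` set (map (mark M) s))"
    proof
      fix x assume "x \<in> set (roots M)"
      then obtain i where i: "i \<in> {1..d}" "x = mark M i" using mark_im by blast
      then obtain k where k: "k \<in> set s" "i \<in> orbit \<rho> k" using cov by blast
      then have "x \<in> orbit (sigma2 M) (mark M k)" using i(2) mark_orbit[OF s1[OF k(1)]] by blast
      then show "x \<in> \<Union>(orbit (sigma2 M) ` set (map (mark M) s))" using k(1) by auto
    qed
    have touch: "c \<inter> set (map (mark M) s) = {} \<longleftrightarrow> c \<inter> set (roots M) = {}"
      if "c \<in> cycles (oedges M) (sigma2 M)" for c
      using cycle_touch[OF fin p2 that sub cover] by blast
    note re = reroot[OF pre order_trans[OF sub roots_sub] touch]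
    have orb: "map (orbit (sigma2 M)) (map (mark M) s) = map ((`) (mark M)) (map (orbit \<rho>) s)"
      using s1 mark_orbit by simp
    have osub: "orbit \<rho> k \<subseteq> {1..d}" if "k \<in> set s" for k
      by (rule permutes_orbit_subset[OF \<rho> s1[OF that]])
    have "root_system (sigma2 M) (map (mark M) s)"
    proof -
      have "set (map (orbit \<rho>) s) \<subseteq> Pow {1..d}" using osub by auto
      then have "inj_on ((`) (mark M)) (set (map (orbit \<rho>) s))"
        by (rule inj_on_subset[OF inj_on_image_Pow[OF mark_inj]])
      then show ?thesis using s(2) unfolding root_system_def orb by (metis distinct_map)
    qed
    moreover have "degrees (sigma2 M) (map (mark M) s) = lam"
    proof -
      have "card (orbit (sigma2 M) (mark M k)) = card (orbit \<rho> k)" if "k \<in> set s" for k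
        unfolding mark_orbit[OF s1[OF that]]
        by (rule card_image) (rule inj_on_subset[OF mark_inj osub[OF that]])
      then show ?thesis unfolding s(3)[symmetric] by (simp add: degrees_def)
    qed
    ultimately show ?thesis
      using re(1,3) oe norm by (simp add: labelled_maps_def stuffed_map_iff boundary_degrees_eq)
  qed
  show "fully_simple (?F M) \<longleftrightarrow> fully_simple M" if "M \<in> marked_maps N d \<rho>" using F[OF that] by blast
  have inj: "inj_on ?F (marked_maps N d \<rho>)"
  proof (rule inj_onI)
    fix M1 M2 assume M: "M1 \<in> marked_maps N d \<rho>" "M2 \<in> marked_maps N d \<rho>" and eq: "?F M1 = ?F M2"
    interpret a: marked_map N d \<rho> M1 by unfold_locales (use M \<rho> in auto)
    interpret b: marked_map N d \<rho> M2 by unfold_locales (use M \<rho> in auto)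
    have fields: "oedges M1 = oedges M2" "sigma0 M1 = sigma0 M2" "sigma1 M1 = sigma1 M2" "sigma2 M1 = sigma2 M2"
      "parts M1 = parts M2" "genus M1 = genus M2" "map (mark M1) s = map (mark M2) s"
      using arg_cong[OF eq, of oedges] arg_cong[OF eq, of sigma0] arg_cong[OF eq, of sigma1]
        arg_cong[OF eq, of sigma2] arg_cong[OF eq, of parts] arg_cong[OF eq, of genus] arg_cong[OF eq, of roots]
      by simp_all
    have "mark M1 i = mark M2 i" if "i \<in> {1..d}" for i
    proof (rule equivariant_unique[where f = \<rho> and g = "sigma2 M1" and s = s and b = "mark M1"
        and b' = "mark M2" and A = "{1..d}"])
      show "mark M1 (\<rho> x) = sigma2 M1 (mark M1 x)" if "x \<in> \<Union>(orbit \<rho> ` set s)" for x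
        using that a.equivar unfolding cov by simp
      show "mark M2 (\<rho> x) = sigma2 M1 (mark M2 x)" if "x \<in> \<Union>(orbit \<rho> ` set s)" for x
        using that b.equivar unfolding cov fields by simp
    qed (use fields that \<rho> cov in auto)
    then have "roots M1 = roots M2" unfolding a.roots_mark b.roots_mark by (intro map_cong refl) auto
    then show "M1 = M2" using fields by (intro smap.equality) auto
  qed
  have surj: "M' \<in> ?F ` marked_maps N d \<rho>" if M': "M' \<in> ?T" for M'
  proof -
    from M' have st: "stuffed_map M'" "oedges M' = {..<N}" "degrees (sigma2 M') (roots M') = lam"
      and norm: "p \<notin> parts M' \<Longrightarrow> genus M' p = 0" for p
      by (auto simp: labelled_maps_def boundary_degrees_eq)
    then have pre: "multirooted M'" and rs: "root_system (sigma2 M') (roots M')" by (auto simp: stuffed_map_iff)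
    then have C: "finite (oedges M')" "sigma2 M' permutes oedges M'" and r: "set (roots M') \<subseteq> oedges M'"
      by (auto simp: multirooted_def)
    let ?U = "\<Union>(orbit (sigma2 M') ` set (roots M'))"
    have "degrees \<rho> s = degrees (sigma2 M') (roots M')" using s(3) st(3) by simp
    then obtain b where b: "bij_betw b {1..d} ?U" "\<And>x. x \<in> {1..d} \<Longrightarrow> b (\<rho> x) = sigma2 M' (b x)" "map b s = roots M'"
      using equivariant_exists[OF A \<rho> s(2) C rs] unfolding cov by metis
    let ?r = "map b [1..<Suc d]"
    let ?M = "M'\<lparr>roots := ?r\<rparr>"
    have mark: "mark ?M i = b i" if "i \<in> {1..d}" for i 
      using that by (cases i) (simp_all add: mark_def del: upt_Suc)
    have setr: "set ?r = ?U"
      using b(1) unfolding bij_betw_def set_map set_upt by (metis atLeastLessThanSuc_atLeastAtMost)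
    have rU: "set (roots M') \<subseteq> ?U"
      by (rule subsetI, rule UN_I) (auto intro: self_in_orbit[OF C])
    have "?U \<subseteq> oedges M'"
      by (rule UN_least) (use r in \<open>auto intro: permutes_orbit_subset[OF C(2), THEN subsetD]\<close>)
    moreover have "c \<inter> set ?r = {} \<longleftrightarrow> c \<inter> set (roots M') = {}" if "c \<in> cycles (oedges M') (sigma2 M')" for c
      unfolding setr by (rule cycle_touch[OF C that rU subset_refl])
    ultimately have "multirooted ?M" using reroot(1)[OF pre] setr by simp
    moreover have "distinct ?r" using b(1) by (simp add: distinct_map bij_betw_def atLeastLessThanSuc_atLeastAtMost del: upt_Suc)
    moreover have "sigma2 ?M (mark ?M i) = mark ?M (\<rho> i)" if "i \<in> {1..d}" for i
      using b(2) mark permutes_in_image[OF \<rho>] that by simp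
    ultimately have "?M \<in> marked_maps N d \<rho>"
      using st(2) norm by (simp add: marked_maps_def del: upt_Suc)
    moreover have "map (mark ?M) s = roots M'" using b(3) mark s(1) by (metis map_cong subsetD)
    then have "?F ?M = M'" by simp
    ultimately show ?thesis by force
  qed
  show "bij_betw ?F (marked_maps N d \<rho>) ?T"
    unfolding bij_betw_def using inj F surj by blast
qed

section \<open>Gluing and splitting boundary vertices\<close>

text \<open>
  The permutation of the oriented edges that permutes the numbers of the boundary edges by \<open>\<pi>\<close>.
\<close>

definition on_marks :: "'a smap \<Rightarrow> (nat \<Rightarrow> nat) \<Rightarrow> 'a \<Rightarrow> 'a" where
  "on_marks M \<pi> x =
     (if x \<in> mark M ` {1..length (roots M)}
      then mark M (\<pi> (inv_into {1..length (roots M)} (mark M) x)) else x)"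

text \<open>
  For a fully simple \<open>M\<close>, the vertices at the boundary are merged along the cycles of \<open>\<pi>\<close>; the
  change of \<open>sigma2\<close> restores the relation between the three permutations.
\<close>

definition glue :: "(nat \<Rightarrow> nat) \<Rightarrow> 'a smap \<Rightarrow> 'a smap" where
  "glue \<pi> M = M\<lparr>sigma0 := on_marks M \<pi> \<circ> sigma0 M, sigma2 := sigma2 M \<circ> inv (on_marks M \<pi>)\<rparr>"

context marked_map
begin

lemma on_marks_permutes:
  assumes "\<pi> permutes {1..d}" shows "on_marks M \<pi> permutes set (roots M)"
  using conj_permutes[OF assms mark_inj] unfolding on_marks_def[abs_def] len mark_im .

lemma on_marks_mark: "i \<in> {1..d} \<Longrightarrow> on_marks M \<pi> (mark M i) = mark M (\<pi> i)"
  using mark_inj by (simp add: on_marks_def len)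

lemma on_marks_permutes_edges:
  assumes "\<pi> permutes {1..d}" shows "on_marks M \<pi> permutes oedges M"
  by (rule permutes_subset[OF on_marks_permutes[OF assms] roots_sub])

lemma card_cycles_on_marks:
  assumes "\<pi> permutes {1..d}"
  shows "card (cycles (set (roots M)) (on_marks M \<pi>)) = card (cycles {1..d} \<pi>)"
proof -
  have "cycles (mark M ` {1..d}) (on_marks M \<pi>) = (`) (mark M) ` cycles {1..d} \<pi>"
    by (rule cycles_image(2)[OF _ assms]) (simp_all add: on_marks_mark)
  moreover have "cycles {1..d} \<pi> \<subseteq> Pow {1..d}"
    unfolding cycles_def by (intro image_subsetI PowI permutes_orbit_subset[OF assms])
  then have "card ((`) (mark M) ` cycles {1..d} \<pi>) = card (cycles {1..d} \<pi>)"
    by (intro card_image inj_on_subset[OF inj_on_image_Pow[OF mark_inj]])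
  ultimately show ?thesis by (simp only: mark_im)
qed

lemma simple_iff: "fully_simple M \<longleftrightarrow> simple_on (sigma0 M) (set (roots M))"
  using fully_simple_iff[OF pre] boundary by simp

lemma euler_char_glue:
  assumes \<pi>: "\<pi> permutes {1..d}" and fs: "fully_simple M"
  shows "euler_char (glue \<pi> M) = euler_char M - (int d - int (card (cycles {1..d} \<pi>)))"
proof -
  have "card (vertices (glue \<pi> M)) + d = card (vertices M) + card (cycles {1..d} \<pi>)"
    using card_cycles_comp_simple[OF fin p0 on_marks_permutes[OF \<pi>] roots_sub] fs distinct_card[OF dist]
    by (simp add: glue_def vertices_def simple_iff card_cycles_on_marks[OF \<pi>] len)
  moreover have "edges (glue \<pi> M) = edges M" "parts (glue \<pi> M) = parts M" "genus (glue \<pi> M) = genus M"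
    by (simp_all add: glue_def edges_def)
  ultimately show ?thesis unfolding euler_char_def by simp
qed

end

lemma face_monomial_glue: "face_monomial (glue \<pi> M) = face_monomial M"
  by (simp add: glue_def face_monomial_def)

lemma mark_glue [simp]: "mark (glue \<pi> M) = mark M"
  by (simp add: glue_def mark_def[abs_def])

text \<open>
  Moving the factor \<open>p\<close> from \<open>sigma0\<close> to \<open>sigma2\<close> keeps the product of the three permutations equal
  to the identity, because \<open>p\<close> is cyclically moved from its left end to its right end. The internal
  faces stay the same, because \<open>p\<close> moves roots only.
\<close>

lemma multirooted_refactor:
  assumes pre: "multirooted M" and B: "set (roots M) = B" and p: "p permutes B"
    and f: "f permutes oedges M" and p': "sigma0 M = p \<circ> f"
  shows "multirooted (M\<lparr>sigma0 := f, sigma2 := sigma2 M \<circ> p\<rparr>)"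
proof -
  let ?M = "M\<lparr>sigma0 := f, sigma2 := sigma2 M \<circ> p\<rparr>"
  have fin: "finite (oedges M)" and p2: "sigma2 M permutes oedges M" and sub: "B \<subseteq> oedges M"
    and prod: "sigma0 M \<circ> sigma1 M \<circ> sigma2 M = id"
    using pre B by (auto simp: multirooted_def)
  have p2': "sigma2 M \<circ> p permutes oedges M" by (rule permutes_compose[OF permutes_subset[OF p sub] p2])
  have "p \<circ> (f \<circ> sigma1 M \<circ> sigma2 M) = id" using prod unfolding p' by (simp only: comp_assoc)
  then have "inv p \<circ> (p \<circ> (f \<circ> sigma1 M \<circ> sigma2 M)) = inv p" by simp
  then have "f \<circ> sigma1 M \<circ> sigma2 M = inv p"
    unfolding o_assoc[of "inv p" p] permutes_inv_o(2)[OF p] by simp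
  then have "f \<circ> sigma1 M \<circ> (sigma2 M \<circ> p) = id" unfolding o_assoc by (simp add: permutes_inv_o(2)[OF p])
  moreover have "unrooted_cycles ?M = unrooted_cycles M"
    unfolding unrooted_cycles_def
    using cycles_avoiding_cong[OF fin p2' p2, of B] p B by (simp add: permutes_not_in)
  ultimately show ?thesis using pre f p2' by (simp add: multirooted_def)
qed

text \<open>
  The permutation \<open>\<pi>\<close> and the map \<open>M\<close> are recovered from \<open>glue \<pi> M\<close> by the factorization of its
  permutation \<open>sigma0\<close>: on the numbers of the boundary edges, \<open>\<pi>\<close> is the first return map.
\<close>

lemma glue_bij:
  assumes \<rho>: "\<rho> permutes {1..d}"
  shows "bij_betw (\<lambda>(\<pi>, M). glue \<pi> M)
     (SIGMA \<pi>:{\<pi>. \<pi> permutes {1..d}}. {M \<in> marked_maps N d (\<rho> \<circ> \<pi>). fully_simple M}) (marked_maps N d \<rho>)"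
proof -
  let ?X = "SIGMA \<pi>:{\<pi>. \<pi> permutes {1..d}}. {M \<in> marked_maps N d (\<rho> \<circ> \<pi>). fully_simple M}"
  have mm: "marked_map N d (\<rho> \<circ> \<pi>) M" if "\<pi> permutes {1..d}" "M \<in> marked_maps N d (\<rho> \<circ> \<pi>)" for \<pi> M
    using that \<rho> by unfold_locales (auto intro: permutes_compose)
  have in_marked: "glue \<pi> M \<in> marked_maps N d \<rho>"
    if \<pi>: "\<pi> permutes {1..d}" and M: "M \<in> marked_maps N d (\<rho> \<circ> \<pi>)" for \<pi> M
  proof -
    interpret marked_map N d "\<rho> \<circ> \<pi>" M by (rule mm[OF that])
    let ?P = "on_marks M \<pi>"
    note P = on_marks_permutes[OF \<pi>] and PE = on_marks_permutes_edges[OF \<pi>]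
    have "sigma0 M = inv ?P \<circ> (?P \<circ> sigma0 M)" unfolding o_assoc permutes_inv_o(2)[OF P] by simp
    have pre': "multirooted (glue \<pi> M)"
      unfolding glue_def
      by (rule multirooted_refactor[OF pre refl permutes_inv[OF P] permutes_compose[OF p0 PE]]) fact
    have "sigma2 (glue \<pi> M) (mark M i) = mark M (\<rho> i)" if i: "i \<in> {1..d}" for i
    proof -
      have j: "inv \<pi> i \<in> {1..d}" using permutes_in_image[OF permutes_inv[OF \<pi>]] i by simp
      have "?P (mark M (inv \<pi> i)) = mark M i"
        using on_marks_mark[OF j] permutes_inverses(1)[OF \<pi>] by simp
      then have "inv ?P (mark M i) = mark M (inv \<pi> i)" using permutes_inverses(2)[OF P] by metis
      then show ?thesis using equivar[OF j] permutes_inverses(1)[OF \<pi>] by (simp add: glue_def)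
    qed
    then show ?thesis using pre' oe norm len dist
      by (simp add: marked_maps_def) (simp add: glue_def)
  qed
  have inj: "inj_on (\<lambda>(\<pi>, M). glue \<pi> M) ?X"
  proof (rule inj_onI, clarify)
    fix \<pi> M \<pi>' M'
    assume h: "\<pi> permutes {1..d}" "M \<in> marked_maps N d (\<rho> \<circ> \<pi>)" "fully_simple M"
      "\<pi>' permutes {1..d}" "M' \<in> marked_maps N d (\<rho> \<circ> \<pi>')" "fully_simple M'" and eq: "glue \<pi> M = glue \<pi>' M'"
    interpret a: marked_map N d "\<rho> \<circ> \<pi>" M by (rule mm) fact+
    interpret b: marked_map N d "\<rho> \<circ> \<pi>'" M' by (rule mm) fact+
    let ?P = "on_marks M \<pi>" and ?P' = "on_marks M' \<pi>'"
    have fields: "oedges M = oedges M'" "sigma1 M = sigma1 M'" "parts M = parts M'" "genus M = genus M'"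
      "roots M = roots M'" and e0: "?P \<circ> sigma0 M = ?P' \<circ> sigma0 M'" and e2: "sigma2 M \<circ> inv ?P = sigma2 M' \<circ> inv ?P'"
      using arg_cong[OF eq, of oedges] arg_cong[OF eq, of sigma0] arg_cong[OF eq, of sigma1]
        arg_cong[OF eq, of sigma2] arg_cong[OF eq, of parts] arg_cong[OF eq, of genus] arg_cong[OF eq, of roots]
      by (simp_all add: glue_def)
    have marks: "mark M = mark M'" using fields(5) by (simp add: mark_def[abs_def])
    note P = a.on_marks_permutes[OF h(1)] and P' = b.on_marks_permutes[OF h(4), folded fields(5)]
    have "inv ?P \<circ> (?P \<circ> sigma0 M) = inv ?P \<circ> (?P' \<circ> sigma0 M')" using e0 by simp
    then have s0: "sigma0 M = (inv ?P \<circ> ?P') \<circ> sigma0 M'"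
      unfolding o_assoc permutes_inv_o(2)[OF P] by simp
    have "inv ?P \<circ> ?P' = id"
    proof (rule simple_on_unique[OF a.fin _ _ a.roots_sub])
      show "sigma0 M' permutes oedges M" using b.p0 fields(1) by simp
      show "(inv ?P \<circ> ?P') permutes set (roots M)" by (rule permutes_compose[OF P' permutes_inv[OF P]])
      show "simple_on (sigma0 M') (set (roots M))" using h(6) b.simple_iff fields(5) by simp
      show "simple_on ((inv ?P \<circ> ?P') \<circ> sigma0 M') (set (roots M))"
        using h(3) a.simple_iff unfolding s0[symmetric] by simp
    qed
    then have "?P \<circ> (inv ?P \<circ> ?P') = ?P" by simp
    then have PP: "?P' = ?P" unfolding o_assoc permutes_inv_o(1)[OF P] by simp
    have "\<pi> i = \<pi>' i" for i
    proof (cases "i \<in> {1..d}")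
      case True
      have "mark M (\<pi> i) = mark M (\<pi>' i)"
        using a.on_marks_mark[OF True, of \<pi>] b.on_marks_mark[OF True, of \<pi>'] PP marks by simp
      then show ?thesis
        using inj_onD[OF a.mark_inj] permutes_in_image[OF h(1)] permutes_in_image[OF h(4)] True by blast
    qed (use h(1,4) in \<open>simp add: permutes_not_in\<close>)
    moreover have "sigma0 M = sigma0 M'" using s0 \<open>inv ?P \<circ> ?P' = id\<close> by simp
    moreover have "sigma2 M = sigma2 M'"
    proof -
      have "sigma2 M \<circ> inv ?P \<circ> ?P = sigma2 M' \<circ> inv ?P \<circ> ?P" using e2 PP by simp
      then show ?thesis unfolding comp_assoc permutes_inv_o(2)[OF P] by simp
    qed
    ultimately show "\<pi> = \<pi>' \<and> M = M'" using fields by (auto intro!: smap.equality ext)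
  qed
  have surj: "\<exists>\<pi> M'. \<pi> permutes {1..d} \<and> M' \<in> marked_maps N d (\<rho> \<circ> \<pi>) \<and> fully_simple M' \<and> M = glue \<pi> M'"
    if M: "M \<in> marked_maps N d \<rho>" for M
  proof -
    interpret marked_map N d \<rho> M by unfold_locales (use M \<rho> in auto)
    obtain p f where p: "p permutes set (roots M)" "f permutes oedges M" "simple_on f (set (roots M))" "sigma0 M = p \<circ> f"
      using simple_factor_exists[OF fin p0 roots_sub] .
    let ?i = "inv_into {1..d} (mark M)"
    have ii: "bij_betw ?i (set (roots M)) {1..d}" by (rule bij_betw_inv_into[OF mark_bij])
    define \<pi> where "\<pi> = (\<lambda>i. if i \<in> {1..d} then ?i (p (mark M i)) else i)"
    have "bij_betw (?i \<circ> (p \<circ> mark M)) {1..d} {1..d}"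
      by (rule bij_betw_trans[OF bij_betw_trans[OF mark_bij permutes_imp_bij[OF p(1)]] ii])
    then have "bij_betw \<pi> {1..d} {1..d}"
      by (rule bij_betw_cong[THEN iffD1, rotated]) (simp add: \<pi>_def)
    then have \<pi>: "\<pi> permutes {1..d}" by (rule bij_imp_permutes) (auto simp: \<pi>_def)
    have m\<pi>: "mark M (\<pi> i) = p (mark M i)" if "i \<in> {1..d}" for i
    proof -
      have "p (mark M i) \<in> set (roots M)" using permutes_in_image[OF p(1)] mark_im that by blast
      then show ?thesis using that bij_betw_inv_into_right[OF mark_bij] by (simp add: \<pi>_def)
    qed
    have P: "on_marks M \<pi> = p"
    proof
      fix x show "on_marks M \<pi> x = p x"
      proof (cases "x \<in> set (roots M)")
        case True
        then obtain i where "i \<in> {1..d}" "x = mark M i" using mark_im by blast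
        then show ?thesis using on_marks_mark m\<pi> by simp
      next
        case False
        then show ?thesis using p(1) on_marks_permutes[OF \<pi>] by (simp add: permutes_not_in)
      qed
    qed
    let ?M = "M\<lparr>sigma0 := f, sigma2 := sigma2 M \<circ> p\<rparr>"
    have mark': "mark ?M = mark M" by (simp add: mark_def[abs_def])
    have "multirooted ?M" by (rule multirooted_refactor[OF pre refl p(1,2,4)])
    moreover have "sigma2 ?M (mark ?M i) = mark ?M ((\<rho> \<circ> \<pi>) i)" if i: "i \<in> {1..d}" for i
    proof -
      have "\<pi> i \<in> {1..d}" using permutes_in_image[OF \<pi>] i by simp
      then have "sigma2 M (p (mark M i)) = mark M (\<rho> (\<pi> i))" using equivar m\<pi>[OF i] by metis
      then show ?thesis by (simp add: mark')
    qed
    ultimately have M': "?M \<in> marked_maps N d (\<rho> \<circ> \<pi>)"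
      using oe norm len dist by (simp add: marked_maps_def)
    then interpret c: marked_map N d "\<rho> \<circ> \<pi>" ?M by (rule mm[OF \<pi>])
    have "fully_simple ?M" using c.simple_iff p(3) by simp
    moreover have "roots ?M = roots M" by simp
    then have "on_marks ?M \<pi> = on_marks M \<pi>" by (intro ext) (simp only: on_marks_def mark')
    then have "on_marks ?M \<pi> = p" using P by simp
    then have "glue \<pi> ?M = M"
      using p(4) by (simp add: glue_def comp_assoc permutes_inv_o(1)[OF p(1)])
    ultimately show ?thesis using \<pi> M' by metis
  qed
  show ?thesis unfolding bij_betw_def
  proof
    show "(\<lambda>(\<pi>, M). glue \<pi> M) ` ?X = marked_maps N d \<rho>"
    proof
      show "(\<lambda>(\<pi>, M). glue \<pi> M) ` ?X \<subseteq> marked_maps N d \<rho>" using in_marked by auto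
      show "marked_maps N d \<rho> \<subseteq> (\<lambda>(\<pi>, M). glue \<pi> M) ` ?X"
      proof
        fix M assume "M \<in> marked_maps N d \<rho>"
        then obtain \<pi> M' where "(\<pi>, M') \<in> ?X" "M = glue \<pi> M'" using surj by blast
        then show "M \<in> (\<lambda>(\<pi>, M). glue \<pi> M) ` ?X" by force
      qed
    qed
  qed (rule inj)
qed

section \<open>Comparison of the generating series\<close>

abbreviation map_term :: "'a smap \<Rightarrow> laurent" where
  "map_term M \<equiv> Poly_Mapping.single (- euler_char M) 1"

text \<open>
  This is the smallest number of transpositions with product \<open>\<pi>\<close>, and the length of the strictly
  monotone sequence with product \<open>\<pi>\<close>.
\<close>

definition transposition_length :: "nat \<Rightarrow> (nat \<Rightarrow> nat) \<Rightarrow> nat" where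
  "transposition_length d \<pi> = d - card (cycles {1..d} \<pi>)"

definition type_partition :: "nat \<Rightarrow> (nat \<Rightarrow> nat) \<Rightarrow> nat list" where
  "type_partition d \<rho> = rev (sorted_list_of_multiset (cycle_type {1..d} \<rho>))"

lemma card_cycles_le:
  assumes "finite A" shows "card (cycles A f) \<le> card A"
  using card_image_le[OF assms] by (simp add: cycles_def)

lemma is_partition_unique:
  assumes "mu \<turnstile> d" "mu' \<turnstile> d'" "mset mu = mset mu'" shows "mu = mu'"
proof -
  have "sorted (rev mu)" "sorted (rev mu')" using assms(1,2) by (auto simp: is_partition_def sorted_wrt_rev)
  then have "rev mu = rev mu'" using assms(3) by (metis mset_rev properties_for_sort)
  then show ?thesis by simp
qed

lemma type_partition:
  assumes "\<rho> permutes {1..d}"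
  shows "type_partition d \<rho> \<turnstile> d" "mset (type_partition d \<rho>) = cycle_type {1..d} \<rho>"
proof -
  show m: "mset (type_partition d \<rho>) = cycle_type {1..d} \<rho>" by (simp add: type_partition_def)
  have "0 < i" if "i \<in> set (type_partition d \<rho>)" for i
  proof -
    have "i \<in># cycle_type {1..d} \<rho>" using that m by (metis set_mset_mset)
    then obtain a where "a \<in> {1..d}" "i = card (orbit \<rho> a)"
      using finite_cycles[of "{1..d}" \<rho>] by (auto simp: cycle_type_def cycles_def)
    then show ?thesis using orbit_enum(3)[OF _ assms] by simp
  qed
  moreover have "sum_list (type_partition d \<rho>) = d"
    using sum_cycle_type[OF _ assms] unfolding m[symmetric] sum_mset_sum_list by simp
  moreover have "sorted_wrt (\<ge>) (type_partition d \<rho>)"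
    by (simp add: type_partition_def sorted_wrt_rev)
  ultimately show "type_partition d \<rho> \<turnstile> d" by (simp add: is_partition_def)
qed

lemma type_partition_eq_iff:
  assumes "\<rho> permutes {1..d}" "mu \<turnstile> d"
  shows "cycle_type {1..d} \<rho> = mset mu \<longleftrightarrow> mu = type_partition d \<rho>"
  using type_partition[OF assms(1)] is_partition_unique[OF assms(2)] by metis

lemma finite_partitions: "finite {mu. mu \<turnstile> d}"
proof (rule finite_subset)
  show "{mu. mu \<turnstile> d} \<subseteq> {xs. set xs \<subseteq> {..d} \<and> length xs \<le> d}"
  proof (intro subsetI CollectI conjI)
    fix mu assume "mu \<in> {mu. mu \<turnstile> d}"
    then have mu: "\<forall>i\<in>set mu. 0 < i" "sum_list mu = d" by (auto simp: is_partition_def)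
    fix x assume "x \<in> set mu"
    then show "x \<in> {..d}" using member_le_sum_list[of x mu] mu(2) by simp
  next
    fix mu assume "mu \<in> {mu. mu \<turnstile> d}"
    then have mu: "\<forall>i\<in>set mu. 0 < i" "sum_list mu = d" by (auto simp: is_partition_def)
    have "length mu \<le> sum_list mu" using mu(1) by (induction mu) auto
    then show "length mu \<le> d" using mu(2) by simp
  qed
qed (rule finite_lists_length_le, simp)

lemma cycle_type_inv:
  assumes "finite A" "f permutes A" shows "cycle_type A (inv f) = cycle_type A f"
proof -
  have "permutation f" using assms by (auto simp: permutation_permutes)
  then show ?thesis by (simp add: cycle_type_def cycles_def orbit_inv_eq)
qed

definition hurwitz_pairs :: "nat \<Rightarrow> nat list \<Rightarrow> nat list \<Rightarrow> ((nat \<Rightarrow> nat) \<times> (nat \<Rightarrow> nat)) set" where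
  "hurwitz_pairs d lam mu = {(\<rho>, \<pi>). \<rho> permutes {1..d} \<and> cycle_type {1..d} \<rho> = mset lam \<and>
     \<pi> permutes {1..d} \<and> cycle_type {1..d} (\<rho> \<circ> \<pi>) = mset mu}"

lemma finite_hurwitz_pairs: "finite (hurwitz_pairs d lam mu)"
  by (rule finite_subset[of _ "{p. p permutes {1..d}} \<times> {p. p permutes {1..d}}"])
    (auto simp: hurwitz_pairs_def finite_permutations)

text \<open>
  The product of the transpositions determines their sequence and, together with the first
  permutation, also the last permutation of the tuple. The latter is the inverse of \<open>\<rho> \<circ> \<pi>\<close>,
  which has the same cycle type as \<open>\<rho> \<circ> \<pi>\<close>.
\<close>

lemma card_hurwitz_tuples:
  "card (hurwitz_tuples d k lam mu) =
    card {x \<in> hurwitz_pairs d lam mu. transposition_length d (snd x) = k}"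
proof (rule bij_betw_same_card[of "\<lambda>(\<rho>, ts, \<rho>'). (\<rho>, comp_list ts)"], unfold bij_betw_def, rule conjI)
  let ?f = "\<lambda>(\<rho>, ts, \<rho>'). (\<rho>, comp_list ts)"
  let ?X = "hurwitz_tuples d k lam mu" and ?Y = "{x \<in> hurwitz_pairs d lam mu. transposition_length d (snd x) = k}"
  have fold: "foldr (\<circ>) ts id = comp_list ts" for ts :: "(nat \<Rightarrow> nat) list" by (simp add: comp_list_def)
  have determined: "\<rho>' = inv (\<rho> \<circ> comp_list ts)"
    if "\<rho> \<circ> comp_list ts \<circ> \<rho>' = id" "\<rho> permutes {1..d}" "strictly_monotone d ts" for \<rho> ts \<rho>'
  proof -
    have "\<rho> \<circ> comp_list ts permutes {1..d}"
      by (rule permutes_compose[OF strictly_monotone_permutes(1)[OF that(3)] that(2)])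
    then show ?thesis using that(1) by (metis comp_assoc comp_id id_comp permutes_inv_o(2))
  qed
  show "inj_on ?f ?X"
  proof (rule inj_onI)
    fix x y assume "x \<in> ?X" "y \<in> ?X" "?f x = ?f y"
    moreover obtain \<rho> ts \<rho>' where "x = (\<rho>, ts, \<rho>')" by (rule prod_cases3)
    moreover obtain \<rho>2 us \<rho>'' where "y = (\<rho>2, us, \<rho>'')" by (rule prod_cases3)
    ultimately have a: "(\<rho>, ts, \<rho>') \<in> ?X" "(\<rho>, us, \<rho>'') \<in> ?X" "comp_list ts = comp_list us"
      and xy: "x = (\<rho>, ts, \<rho>')" "y = (\<rho>, us, \<rho>'')" by auto
    have "ts = us"
      by (rule strictly_monotone_unique[of d]) (use a in \<open>auto simp: hurwitz_tuples_def\<close>)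
    moreover have "\<rho>' = \<rho>''"
      using a determined[of \<rho> ts \<rho>'] determined[of \<rho> us \<rho>''] by (auto simp: hurwitz_tuples_def fold)
    ultimately show "x = y" using xy by simp
  qed
  show "?f ` ?X = ?Y"
  proof (intro set_eqI iffI)
    fix y assume "y \<in> ?f ` ?X"
    then obtain \<rho> ts \<rho>' where y: "y = (\<rho>, comp_list ts)" and x: "(\<rho>, ts, \<rho>') \<in> ?X" by auto
    then have h: "\<rho> permutes {1..d}" "cycle_type {1..d} \<rho> = mset lam" "length ts = k" "strictly_monotone d ts"
      "cycle_type {1..d} \<rho>' = mset mu" "\<rho> \<circ> comp_list ts \<circ> \<rho>' = id"
      by (auto simp: hurwitz_tuples_def fold)
    note t = strictly_monotone_permutes[OF h(4)]
    have "\<rho> \<circ> comp_list ts permutes {1..d}" by (rule permutes_compose[OF t(1) h(1)])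
    then have "cycle_type {1..d} (\<rho> \<circ> comp_list ts) = mset mu"
      using cycle_type_inv[of "{1..d}" "\<rho> \<circ> comp_list ts"] determined[OF h(6,1,4)] h(5) by simp
    moreover have "transposition_length d (comp_list ts) = k" using t(2) h(3) by (simp add: transposition_length_def)
    ultimately show "y \<in> ?Y" using h t(1) by (simp add: hurwitz_pairs_def y)
  next
    fix y assume "y \<in> ?Y"
    then obtain \<rho> \<pi> where y: "y = (\<rho>, \<pi>)" and h: "\<rho> permutes {1..d}" "cycle_type {1..d} \<rho> = mset lam"
      "\<pi> permutes {1..d}" "cycle_type {1..d} (\<rho> \<circ> \<pi>) = mset mu" "transposition_length d \<pi> = k"
      by (auto simp: hurwitz_pairs_def)
    obtain ts where ts: "strictly_monotone d ts" "comp_list ts = \<pi>" using strictly_monotone_exists[OF h(3)] by blast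
    have r: "\<rho> \<circ> \<pi> permutes {1..d}" by (rule permutes_compose[OF h(3,1)])
    have "length ts = k" using strictly_monotone_permutes(2)[OF ts(1)] ts(2) h(5) by (simp add: transposition_length_def)
    then have "(\<rho>, ts, inv (\<rho> \<circ> \<pi>)) \<in> ?X"
      using h ts r cycle_type_inv[OF _ r] permutes_inv[OF r] permutes_inv_o(1)[OF r]
      by (simp add: hurwitz_tuples_def fold)
    then show "y \<in> ?f ` ?X" using y ts(2) by force
  qed
qed

lemma hurwitz_series_pairs:
  "hurwitz_series d lam mu =
    (\<Sum>(\<rho>, \<pi>)\<in>hurwitz_pairs d lam mu. Poly_Mapping.single (int (transposition_length d \<pi>)) (1 / fact d))"
proof -
  let ?P = "hurwitz_pairs d lam mu"
  let ?k = "\<lambda>x. transposition_length d (snd x)"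
  let ?g = "\<lambda>k. Poly_Mapping.single (int k) (hurwitz_number d k lam mu)"
  let ?t = "\<lambda>x. Poly_Mapping.single (int (?k x)) (1 / fact d) :: laurent"
  have g: "?g k = sum ?t {x \<in> ?P. ?k x = k}" for k
  proof -
    have single_mult: "of_nat n * Poly_Mapping.single (int k) (c :: rat) = Poly_Mapping.single (int k) (of_nat n * c)" for n c
      using mult_single[of 0 "of_nat n" "int k" c] by simp
    have "sum ?t {x \<in> ?P. ?k x = k} = (\<Sum>x\<in>{x \<in> ?P. ?k x = k}. Poly_Mapping.single (int k) (1 / fact d))"
      by (rule sum.cong) auto
    also have "\<dots> = ?g k" by (simp add: single_mult hurwitz_number_def card_hurwitz_tuples)
    finally show ?thesis by simp
  qed
  have "hurwitz_series d lam mu = (\<Sum>k\<in>{..d}. ?g k)"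
    unfolding hurwitz_series_def
  proof (rule Sum_any.expand_superset)
    show "{k. ?g k \<noteq> 0} \<subseteq> {..d}"
    proof
      fix k assume "k \<in> {k. ?g k \<noteq> 0}"
      then have "sum ?t {x \<in> ?P. ?k x = k} \<noteq> 0" using g by simp
      then have "{x \<in> ?P. ?k x = k} \<noteq> {}" by (metis (lifting) sum.empty)
      then obtain x where "x \<in> ?P" "?k x = k" by blast
      then show "k \<in> {..d}" by (auto simp: transposition_length_def)
    qed
  qed simp
  also have "\<dots> = (\<Sum>k\<in>{..d}. sum ?t {x \<in> ?P. ?k x = k})" by (simp only: g)
  also have "\<dots> = sum ?t ?P"
    by (rule sum.group[OF finite_hurwitz_pairs]) (auto simp: transposition_length_def)
  finally show ?thesis by (simp add: case_prod_unfold)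
qed

lemma finite_marked_maps:
  assumes "\<rho> permutes {1..d}"
  shows "finite {M \<in> marked_maps N d \<rho>. face_monomial M = m}"
proof -
  let ?lam = "type_partition d \<rho>"
  have p: "\<And>x. x \<in> set ?lam \<Longrightarrow> 0 < x" "sum_list ?lam = d"
    using type_partition(1)[OF assms] by (auto simp: is_partition_def)
  obtain s where s: "set s \<subseteq> {1..d}" "root_system \<rho> s" "degrees \<rho> s = ?lam"
    using root_system_exists[OF _ assms type_partition(2)[OF assms, symmetric] p(1)] by auto
  have "bij_betw (\<lambda>M. M\<lparr>roots := map (mark M) s\<rparr>) {M \<in> marked_maps N d \<rho>. face_monomial M = m}
      {M \<in> {M \<in> labelled_maps N. boundary_degrees M = ?lam}. face_monomial M = m}"
    by (rule bij_betw_Collect[OF choose_roots(1)[OF assms s p(2)]]) (simp add: reroot_simps)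
  moreover have "finite {M \<in> {M \<in> labelled_maps N. boundary_degrees M = ?lam}. face_monomial M = m}"
    by (rule finite_subset[OF _ finite_labelled_maps[of N m]]) auto
  ultimately show ?thesis using bij_betw_finite by blast
qed

lemma sum_marked_maps:
  assumes \<rho>: "\<rho> permutes {1..d}" "cycle_type {1..d} \<rho> = mset lam" and lam: "lam \<turnstile> d"
  shows "(\<Sum>M | M \<in> marked_maps N d \<rho> \<and> face_monomial M = m. map_term M) =
      (\<Sum>M | M \<in> labelled_maps N \<and> boundary_degrees M = lam \<and> face_monomial M = m. map_term M)"
    and "(\<Sum>M | M \<in> marked_maps N d \<rho> \<and> fully_simple M \<and> face_monomial M = m. map_term M) =
      (\<Sum>M | M \<in> labelled_maps N \<and> fully_simple M \<and> boundary_degrees M = lam \<and> face_monomial M = m. map_term M)"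
proof -
  have p: "\<And>x. x \<in> set lam \<Longrightarrow> 0 < x" "sum_list lam = d"
    using lam by (auto simp: is_partition_def)
  obtain s where s: "set s \<subseteq> {1..d}" "root_system \<rho> s" "degrees \<rho> s = lam"
    using root_system_exists[OF _ \<rho> p(1)] by auto
  let ?F = "\<lambda>M. M\<lparr>roots := map (mark M) s\<rparr>"
  have b: "bij_betw ?F {M \<in> marked_maps N d \<rho>. P M}
      {M \<in> {M \<in> labelled_maps N. boundary_degrees M = lam}. Q M}"
    if "\<And>M. M \<in> marked_maps N d \<rho> \<Longrightarrow> Q (?F M) \<longleftrightarrow> P M" for P Q
    by (rule bij_betw_Collect[where P = P and Q = Q, OF choose_roots(1)[OF \<rho>(1) s p(2)] that])
  have w: "map_term (?F M) = map_term M" for M by (simp add: reroot_simps)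
  have "(\<Sum>M\<in>{M \<in> marked_maps N d \<rho>. face_monomial M = m}. map_term (?F M)) =
    (\<Sum>M\<in>{M \<in> {M \<in> labelled_maps N. boundary_degrees M = lam}. face_monomial M = m}. map_term M)"
    by (rule sum.reindex_bij_betw[OF b]) (simp add: reroot_simps)
  then show "(\<Sum>M | M \<in> marked_maps N d \<rho> \<and> face_monomial M = m. map_term M) =
      (\<Sum>M | M \<in> labelled_maps N \<and> boundary_degrees M = lam \<and> face_monomial M = m. map_term M)"
    by (simp add: w conj_assoc)
  have "(\<Sum>M\<in>{M \<in> marked_maps N d \<rho>. fully_simple M \<and> face_monomial M = m}. map_term (?F M)) =
    (\<Sum>M\<in>{M \<in> {M \<in> labelled_maps N. boundary_degrees M = lam}. fully_simple M \<and> face_monomial M = m}. map_term M)"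
    by (rule sum.reindex_bij_betw[OF b]) (simp add: reroot_simps choose_roots(2)[OF \<rho>(1) s p(2)])
  then show "(\<Sum>M | M \<in> marked_maps N d \<rho> \<and> fully_simple M \<and> face_monomial M = m. map_term M) =
      (\<Sum>M | M \<in> labelled_maps N \<and> fully_simple M \<and> boundary_degrees M = lam \<and> face_monomial M = m. map_term M)"
    by (simp add: w conj_ac)
qed

lemma sum_marked_maps_glue:
  assumes \<rho>: "\<rho> permutes {1..d}"
  shows "(\<Sum>M | M \<in> marked_maps N d \<rho> \<and> face_monomial M = m. map_term M) =
    (\<Sum>\<pi> | \<pi> permutes {1..d}. Poly_Mapping.single (int (transposition_length d \<pi>)) 1 *
      (\<Sum>M | M \<in> marked_maps N d (\<rho> \<circ> \<pi>) \<and> fully_simple M \<and> face_monomial M = m. map_term M))"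
proof -
  let ?S = "{\<pi>. \<pi> permutes {1..d}}"
  let ?X = "\<lambda>\<pi>. {M \<in> marked_maps N d (\<rho> \<circ> \<pi>). fully_simple M}"
  let ?Y = "\<lambda>\<pi>. {M. M \<in> marked_maps N d (\<rho> \<circ> \<pi>) \<and> fully_simple M \<and> face_monomial M = m}"
  have XY: "{x \<in> Sigma ?S ?X. face_monomial (snd x) = m} = Sigma ?S ?Y" by auto
  have "bij_betw (\<lambda>(\<pi>, M). glue \<pi> M) {x \<in> Sigma ?S ?X. face_monomial (snd x) = m}
      {M \<in> marked_maps N d \<rho>. face_monomial M = m}"
    by (rule bij_betw_Collect[OF glue_bij[OF \<rho>]]) (auto simp: face_monomial_glue)
  then have b: "bij_betw (\<lambda>(\<pi>, M). glue \<pi> M) (Sigma ?S ?Y) {M \<in> marked_maps N d \<rho>. face_monomial M = m}"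
    unfolding XY .
  have finY: "finite (?Y \<pi>)" if "\<pi> \<in> ?S" for \<pi>
  proof (rule finite_subset)
    show "finite {M \<in> marked_maps N d (\<rho> \<circ> \<pi>). face_monomial M = m}"
      using that \<rho> by (intro finite_marked_maps permutes_compose) auto
  qed auto
  have w: "map_term (glue \<pi> M) = Poly_Mapping.single (int (transposition_length d \<pi>)) 1 * map_term M"
    if "\<pi> \<in> ?S" "M \<in> ?Y \<pi>" for \<pi> M
  proof -
    have \<pi>: "\<pi> permutes {1..d}" using that(1) by simp
    interpret marked_map N d "\<rho> \<circ> \<pi>" M
      by unfold_locales (use that permutes_compose[OF \<pi> \<rho>] in auto)
    have "int (transposition_length d \<pi>) = int d - int (card (cycles {1..d} \<pi>))"
      using card_cycles_le[of "{1..d}" \<pi>] by (simp add: transposition_length_def of_nat_diff)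
    then have "- euler_char (glue \<pi> M) = int (transposition_length d \<pi>) + - euler_char M"
      using euler_char_glue[OF \<pi>] that(2) by simp
    then show ?thesis by (simp add: mult_single)
  qed
  have "(\<Sum>M | M \<in> marked_maps N d \<rho> \<and> face_monomial M = m. map_term M) =
    (\<Sum>x\<in>Sigma ?S ?Y. map_term ((\<lambda>(\<pi>, M). glue \<pi> M) x))"
    by (rule sum.reindex_bij_betw[OF b, symmetric])
  also have "\<dots> = (\<Sum>(\<pi>, M)\<in>Sigma ?S ?Y. map_term (glue \<pi> M))" by (simp add: case_prod_unfold)
  also have "\<dots> = (\<Sum>\<pi>\<in>?S. \<Sum>M\<in>?Y \<pi>. map_term (glue \<pi> M))"
    by (rule sum.Sigma[symmetric]) (use finY in \<open>auto simp: finite_permutations\<close>)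
  also have "\<dots> = (\<Sum>\<pi>\<in>?S. Poly_Mapping.single (int (transposition_length d \<pi>)) 1 * (\<Sum>M\<in>?Y \<pi>. map_term M))"
    unfolding sum_distrib_left by (intro sum.cong refl w) auto
  finally show ?thesis .
qed

theorem theorem5p2:
  fixes d :: nat and lam :: "nat list"
  assumes "0 < d" and "lam \<turnstile> d"
  shows "Map_st lam =
    (\<lambda>m. of_nat (zfactor lam) * (\<Sum>mu | mu \<turnstile> d. hurwitz_series d lam mu * FSMap_st mu m))"
proof
  fix m :: tmonomial
  define N where "N = d + (\<Sum>(g, l)\<in>#m. sum_mset l)"
  define c :: laurent where "c = Poly_Mapping.single 0 (1 / fact N)"
  define W where "W = (\<lambda>mu. \<Sum>M | M \<in> labelled_maps N \<and> boundary_degrees M = mu \<and> face_monomial M = m. map_term M)"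
  define WF where "WF = (\<lambda>mu. \<Sum>M | M \<in> labelled_maps N \<and> fully_simple M \<and> boundary_degrees M = mu \<and> face_monomial M = m. map_term M)"
  let ?S = "{\<pi>. \<pi> permutes {1..d}}"
  let ?T = "{\<rho>. \<rho> permutes {1..d} \<and> cycle_type {1..d} \<rho> = mset lam}"
  let ?h = "\<lambda>\<pi>. Poly_Mapping.single (int (transposition_length d \<pi>)) 1 :: laurent"
  let ?D = "Poly_Mapping.single 0 (1 / fact d) :: laurent"
  have finS: "finite ?S" by (simp add: finite_permutations)
  have finT: "finite ?T" by (rule finite_subset[OF _ finS]) auto
  have iso_inv: "boundary_degrees M' = boundary_degrees M \<and> (fully_simple M' \<longleftrightarrow> fully_simple M)"
    if "stuffed_map M" "smap_iso \<phi> M M'" for M :: "nat smap" and M' :: "nat smap" and \<phi>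
  proof -
    interpret smap_isomorphism \<phi> M M' by unfold_locales (use that in \<open>auto simp: stuffed_map_iff\<close>)
    show ?thesis using degrees_eq fully_simple_eq by simp
  qed
  have edges: "card (oedges M) = N" if "stuffed_map M" "boundary_degrees M = mu" "mu \<turnstile> d" "face_monomial M = m" for M mu
    using card_oedges[OF that(1)] that(2-4) by (simp add: N_def is_partition_def)
  have Map: "Map_st mu m = c * W mu" if mu: "mu \<turnstile> d" for mu
  proof -
    have "Map_st mu m = c * (\<Sum>M | M \<in> labelled_maps N \<and> M \<in> {M. stuffed_map M \<and> boundary_degrees M = mu} \<and> face_monomial M = m. map_term M)"
      unfolding Map_st_def c_def
      by (rule smap_enum_labelled) (use iso_inv edges[OF _ _ mu] in auto)
    also have "{M. M \<in> labelled_maps N \<and> M \<in> {M. stuffed_map M \<and> boundary_degrees M = mu} \<and> face_monomial M = m}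
      = {M. M \<in> labelled_maps N \<and> boundary_degrees M = mu \<and> face_monomial M = m}" by (auto simp: labelled_maps_def)
    finally show ?thesis by (simp add: W_def)
  qed
  have FSMap: "FSMap_st mu m = c * WF mu" if mu: "mu \<turnstile> d" for mu
  proof -
    have "FSMap_st mu m = c * (\<Sum>M | M \<in> labelled_maps N \<and> M \<in> {M. stuffed_map M \<and> fully_simple M \<and> boundary_degrees M = mu} \<and> face_monomial M = m. map_term M)"
      unfolding FSMap_st_def c_def
      by (rule smap_enum_labelled) (use iso_inv edges[OF _ _ mu] in auto)
    also have "{M. M \<in> labelled_maps N \<and> M \<in> {M. stuffed_map M \<and> fully_simple M \<and> boundary_degrees M = mu} \<and> face_monomial M = m}
      = {M. M \<in> labelled_maps N \<and> fully_simple M \<and> boundary_degrees M = mu \<and> face_monomial M = m}" by (auto simp: labelled_maps_def)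
    finally show ?thesis by (simp add: WF_def)
  qed
  \<comment> \<open>This holds for every \<open>\<rho>\<close> of the right cycle type separately, although the right-hand side
      depends on \<open>\<rho>\<close>; averaging over \<open>\<rho>\<close> produces the Hurwitz numbers.\<close>
  have split: "W lam = (\<Sum>\<pi>\<in>?S. ?h \<pi> * WF (type_partition d (\<rho> \<circ> \<pi>)))" if "\<rho> \<in> ?T" for \<rho>
  proof -
    have \<rho>: "\<rho> permutes {1..d}" "cycle_type {1..d} \<rho> = mset lam" using that by auto
    have "(\<Sum>M | M \<in> marked_maps N d (\<rho> \<circ> \<pi>) \<and> fully_simple M \<and> face_monomial M = m. map_term M)
      = WF (type_partition d (\<rho> \<circ> \<pi>))" if "\<pi> \<in> ?S" for \<pi>
    proof -
      have "\<rho> \<circ> \<pi> permutes {1..d}" using that \<rho>(1) by (auto intro: permutes_compose)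
      from sum_marked_maps(2)[OF this type_partition(2)[OF this, symmetric] type_partition(1)[OF this]]
      show ?thesis by (simp add: WF_def)
    qed
    then show ?thesis
      using sum_marked_maps_glue[OF \<rho>(1), of N m] sum_marked_maps(1)[OF \<rho> assms(2), of N m]
      by (simp add: W_def)
  qed
  have H: "hurwitz_series d lam mu * WF mu =
     (\<Sum>\<rho>\<in>?T. \<Sum>\<pi>\<in>?S. if mu = type_partition d (\<rho> \<circ> \<pi>) then ?D * ?h \<pi> * WF mu else 0)"
    if mu: "mu \<turnstile> d" for mu
  proof -
    have "hurwitz_pairs d lam mu = {x \<in> ?T \<times> ?S. mu = type_partition d (fst x \<circ> snd x)}"
      using type_partition_eq_iff[OF permutes_compose mu] by (auto simp: hurwitz_pairs_def)
    then have "hurwitz_series d lam mu =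
      (\<Sum>x\<in>{x \<in> ?T \<times> ?S. mu = type_partition d (fst x \<circ> snd x)}. ?D * ?h (snd x))"
      by (simp add: hurwitz_series_pairs case_prod_unfold mult_single)
    also have "\<dots> = (\<Sum>x\<in>?T \<times> ?S. if mu = type_partition d (fst x \<circ> snd x) then ?D * ?h (snd x) else 0)"
      by (rule sum.inter_filter) (use finS finT in simp)
    also have "\<dots> = (\<Sum>\<rho>\<in>?T. \<Sum>\<pi>\<in>?S. if mu = type_partition d (\<rho> \<circ> \<pi>) then ?D * ?h \<pi> else 0)"
      by (simp add: sum.cartesian_product case_prod_unfold)
    finally have series: "hurwitz_series d lam mu =
      (\<Sum>\<rho>\<in>?T. \<Sum>\<pi>\<in>?S. if mu = type_partition d (\<rho> \<circ> \<pi>) then ?D * ?h \<pi> else 0)" .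
    show ?thesis unfolding series sum_distrib_right by (intro sum.cong refl) simp
  qed
  have "(\<Sum>mu | mu \<turnstile> d. hurwitz_series d lam mu * FSMap_st mu m)
    = (\<Sum>mu | mu \<turnstile> d. c * (\<Sum>\<rho>\<in>?T. \<Sum>\<pi>\<in>?S. if mu = type_partition d (\<rho> \<circ> \<pi>) then ?D * ?h \<pi> * WF mu else 0))"
  proof (rule sum.cong[OF refl])
    fix mu assume "mu \<in> {mu. mu \<turnstile> d}"
    then have mu: "mu \<turnstile> d" by simp
    show "hurwitz_series d lam mu * FSMap_st mu m = c * (\<Sum>\<rho>\<in>?T. \<Sum>\<pi>\<in>?S.
        if mu = type_partition d (\<rho> \<circ> \<pi>) then ?D * ?h \<pi> * WF mu else 0)"
      unfolding H[OF mu, symmetric] FSMap[OF mu] by (rule mult.left_commute)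
  qed
  also have "\<dots> = c * (\<Sum>\<rho>\<in>?T. \<Sum>\<pi>\<in>?S. \<Sum>mu | mu \<turnstile> d.
      if mu = type_partition d (\<rho> \<circ> \<pi>) then ?D * ?h \<pi> * WF mu else 0)"
    unfolding sum_distrib_left[symmetric]
    by (subst sum.swap) (intro arg_cong2[where f = "(*)"] refl sum.cong sum.swap)
  also have "\<dots> = c * (\<Sum>\<rho>\<in>?T. \<Sum>\<pi>\<in>?S. ?D * ?h \<pi> * WF (type_partition d (\<rho> \<circ> \<pi>)))"
  proof (intro arg_cong2[where f = "(*)"] refl sum.cong)
    fix \<rho> \<pi> assume "\<rho> \<in> ?T" "\<pi> \<in> ?S"
    then have "\<rho> \<circ> \<pi> permutes {1..d}" by (auto intro: permutes_compose)
    then have "type_partition d (\<rho> \<circ> \<pi>) \<turnstile> d" by (rule type_partition(1))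
    then show "(\<Sum>mu | mu \<turnstile> d. if mu = type_partition d (\<rho> \<circ> \<pi>) then ?D * ?h \<pi> * WF mu else 0)
      = ?D * ?h \<pi> * WF (type_partition d (\<rho> \<circ> \<pi>))"
      using finite_partitions[of d] by (simp add: sum.delta)
  qed
  also have "\<dots> = c * (\<Sum>\<rho>\<in>?T. ?D * W lam)"
    by (intro arg_cong2[where f = "(*)"] refl sum.cong) (simp add: split sum_distrib_left mult.assoc)
  also have "\<dots> = of_nat (card ?T) * ?D * (c * W lam)" by (simp add: ac_simps)
  finally have "of_nat (zfactor lam) * (\<Sum>mu | mu \<turnstile> d. hurwitz_series d lam mu * FSMap_st mu m)
    = of_nat (card ?T * zfactor lam) * ?D * (c * W lam)" by (simp add: ac_simps)
  also have "card ?T * zfactor lam = fact d"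
    using card_permutations_of_type[of "{1..d}" lam] assms(2) by (simp add: is_partition_def)
  also have "of_nat (fact d) * ?D = (1 :: laurent)"
  proof -
    have "of_nat (fact d) * ?D = Poly_Mapping.single (0 + 0) (of_nat (fact d) * (1 / fact d))"
      unfolding single_of_nat[symmetric] by (rule mult_single)
    then show ?thesis by simp
  qed
  finally show "Map_st lam m = of_nat (zfactor lam) * (\<Sum>mu | mu \<turnstile> d. hurwitz_series d lam mu * FSMap_st mu m)"
    using Map[OF assms(2)] by simp
qed

end
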